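(* Let $(\mathfrak g,[\cdot,\cdot]_{\mathfrak g},B)$ be a Rota-Baxter Lie algebra. Assume that $B$ is integrable and $(G,\cdot,\mathcal B)$ is the integrated Rota-Baxter Lie group of $(\mathfrak g,[\cdot,\cdot]_{\mathfrak g},B)$. Then $(G_{\mathcal B},G_{diag})$ is a matched pair of Lie groups, where $G_{diag}=\{(g,g)\mid g\in G\}$ and $G_{\mathcal B}=\{(\mathcal B(g),g\cdot\mathcal B(g))\mid g\in G\}$ (Lie subgroups of the direct product $G\times G$). Furthermore, the differentiation of $(G_{\mathcal B},G_{diag})$ is the matched pair of Lie algebras $(\mathfrak g_B,\mathfrak g_{diag})$, where $\mathfrak g_{diag}=\{(x,x)\mid x\in\mathfrak g\}$ and $\mathfrak g_B=\{(B(x),x+B(x))\mid x\in\mathfrak g\}$ (Lie subalgebras of the direct sum Lie algebra $\mathfrak g\oplus\mathfrak g$).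
   Context: Lie groups and algebras are real and finite-dimensional. A Rota-Baxter Lie algebra is a Lie algebra $\mathfrak g$ with a linear map $B:\mathfrak g\to\mathfrak g$ satisfying $[B(u),B(v)]_{\mathfrak g}=B([B(u),v]_{\mathfrak g}+[u,B(v)]_{\mathfrak g}+[u,v]_{\mathfrak g})$. A Rota-Baxter Lie group is a Lie group $G$ with a smooth map $\mathcal B:G\to G$ satisfying $\mathcal B(g)\mathcal B(h)=\mathcal B(g\mathcal B(g)h\mathcal B(g)^{-1})$ for all $g,h\in G$. "$B$ is integrable with integrated Rota-Baxter Lie group $(G,\cdot,\mathcal B)$" means that $G$ has Lie algebra $\mathfrak g$, $\mathcal B:G\to G$ is a (globally defined) Rota-Baxter operator, and its tangent map at $e$ is $B$. Matched pair of Lie groups: a pair $(P,Q)$ with a left action $\triangleright:P\times Q\to Q$ of $P$ on $Q$ and a right action $\triangleleft:P\times Q\to P$ of $Q$ on $P$ such that $p\triangleright(q_1q_2)=(p\triangleright q_1)\big((p\triangleleft q_1)\triangleright q_2\big)$ and $(p_1p_2)\triangleleft q=\big(p_1\triangleleft(p_2\triangleright q)\big)(p_2\triangleleft q)$. If $P,Q$ are Lie subgroups of a Lie group $K$ such that $P\times Q\to K$, $(p,q)\mapsto pq$, is a diffeomorphism, then $(P,Q)$ is a matched pair with actions determined by $pq=(p\triangleright q)(p\triangleleft q)$; here $K=G\times G$. Matched pair of Lie algebras: Lie algebras $(\mathfrak p,\mathfrak q)$ with representations $\rho:\mathfrak p\to\mathfrak{gl}(\mathfrak q)$, $\mu:\mathfrak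 q\to\mathfrak{gl}(\mathfrak p)$ such that $\rho(x)[\xi,\eta]=[\rho(x)\xi,\eta]+[\xi,\rho(x)\eta]+\rho(\mu(\eta)x)\xi-\rho(\mu(\xi)x)\eta$ and $\mu(\xi)[x,y]=[\mu(\xi)x,y]+[x,\mu(\xi)y]+\mu(\rho(y)\xi)x-\mu(\rho(x)\xi)y$ for $x,y\in\mathfrak p$, $\xi,\eta\in\mathfrak q$. If $\mathfrak p,\mathfrak q$ are subalgebras of a Lie algebra $\mathfrak k=\mathfrak p\oplus\mathfrak q$ (direct sum of vector spaces), then $(\mathfrak p,\mathfrak q)$ is a matched pair with $\rho,\mu$ determined by $[x,\xi]=\rho(x)\xi-\mu(\xi)x$; here $\mathfrak k=\mathfrak g\oplus\mathfrak g$, and $\mathfrak g\oplus\mathfrak g=\mathfrak g_B\oplus\mathfrak g_{diag}$ as vector spaces. The differentiation of a matched pair of Lie groups consists of the Lie algebras of $P$ and $Q$, with $\rho$ the differential of the linear $P$-action on $\mathrm{Lie}(Q)$ (tangent maps at $e$ of $q\mapsto p\triangleright q$) and $\mu$ the representation obtained from the linear right $Q$-action on $\mathrm{Lie}(P)$ (tangent maps at $e$ of $p\mapsto p\triangleleft q$), $\mu(\xi)x=-\frac{d}{dt}\big|_{t=0}(x\triangleleft\exp t\xi)$. *)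

theory Defs
  imports "HOL-Analysis.Analysis" "HOL-Algebra.Group" "HOL-Library.Function_Algebras"
begin

section \<open>Pointwise vector space structure on functions\<close>

instantiation "fun" :: (type, real_vector) real_vector
begin

definition "scaleR r f = (\<lambda>x. r *\<^sub>R f x)" for f :: "'a \<Rightarrow> 'b"

instance
  by standard (auto simp: scaleR_fun_def fun_eq_iff scaleR_add_right scaleR_add_left)

end

lemma scaleR_fun_apply [simp]: "(r *\<^sub>R f) x = r *\<^sub>R f x" for f :: "'a \<Rightarrow> 'b::real_vector"
  by (simp add: scaleR_fun_def)

definition linear_on :: "'a::real_vector set \<Rightarrow> ('a \<Rightarrow> 'b::real_vector) \<Rightarrow> bool" where
  "linear_on S f \<longleftrightarrow>
     (\<forall>x\<in>S. \<forall>y\<in>S. f (x + y) = f x + f y) \<and> (\<forall>r. \<forall>x\<in>S. f (r *\<^sub>R x) = r *\<^sub>R f x)"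


section \<open>Lie algebras\<close>

text \<open>All Lie algebras are real, finite-dimensional, and carried by a linear subspace of a
  vector space type.\<close>

definition lie_algebra :: "'a::real_vector set \<Rightarrow> ('a \<Rightarrow> 'a \<Rightarrow> 'a) \<Rightarrow> bool" where
  "lie_algebra S br \<longleftrightarrow>
     subspace S \<and> (\<exists>X. finite X \<and> span X = S) \<and>
     (\<forall>x\<in>S. \<forall>y\<in>S. br x y \<in> S) \<and>
     (\<forall>x\<in>S. linear_on S (br x)) \<and> (\<forall>y\<in>S. linear_on S (\<lambda>x. br x y)) \<and>
     (\<forall>x\<in>S. br x x = 0) \<and>
     (\<forall>x\<in>S. \<forall>y\<in>S. \<forall>z\<in>S. br x (br y z) + br y (br z x) + br z (br x y) = 0)"

definition lie_subalgebra ::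
  "'a::real_vector set \<Rightarrow> 'a set \<Rightarrow> ('a \<Rightarrow> 'a \<Rightarrow> 'a) \<Rightarrow> bool" where
  "lie_subalgebra T S br \<longleftrightarrow>
     lie_algebra S br \<and> T \<subseteq> S \<and> subspace T \<and> (\<forall>x\<in>T. \<forall>y\<in>T. br x y \<in> T)"

definition lie_algebra_iso ::
  "'a::real_vector set \<Rightarrow> ('a \<Rightarrow> 'a \<Rightarrow> 'a) \<Rightarrow> 'b::real_vector set \<Rightarrow> ('b \<Rightarrow> 'b \<Rightarrow> 'b)
    \<Rightarrow> ('a \<Rightarrow> 'b) \<Rightarrow> bool" where
  "lie_algebra_iso S br T br' f \<longleftrightarrow>
     linear_on S f \<and> bij_betw f S T \<and> (\<forall>x\<in>S. \<forall>y\<in>S. f (br x y) = br' (f x) (f y))"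

definition direct_sum_bracket ::
  "('a \<Rightarrow> 'a \<Rightarrow> 'a) \<Rightarrow> ('b \<Rightarrow> 'b \<Rightarrow> 'b) \<Rightarrow> 'a \<times> 'b \<Rightarrow> 'a \<times> 'b \<Rightarrow> 'a \<times> 'b" where
  "direct_sum_bracket br br' = (\<lambda>(x, y) (x', y'). (br x x', br' y y'))"

definition lie_representation ::
  "'a::real_vector set \<Rightarrow> ('a \<Rightarrow> 'a \<Rightarrow> 'a) \<Rightarrow> 'b::real_vector set \<Rightarrow> ('a \<Rightarrow> 'b \<Rightarrow> 'b) \<Rightarrow> bool"
  where
  "lie_representation S br V \<rho> \<longleftrightarrow>
     (\<forall>x\<in>S. linear_on V (\<rho> x) \<and> \<rho> x ` V \<subseteq> V) \<and>
     (\<forall>v\<in>V. linear_on S (\<lambda>x. \<rho> x v)) \<and>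
     (\<forall>x\<in>S. \<forall>y\<in>S. \<forall>v\<in>V. \<rho> (br x y) v = \<rho> x (\<rho> y v) - \<rho> y (\<rho> x v))"

definition matched_pair_lie_algebras ::
  "'a::real_vector set \<Rightarrow> ('a \<Rightarrow> 'a \<Rightarrow> 'a) \<Rightarrow> 'b::real_vector set \<Rightarrow> ('b \<Rightarrow> 'b \<Rightarrow> 'b)
    \<Rightarrow> ('a \<Rightarrow> 'b \<Rightarrow> 'b) \<Rightarrow> ('b \<Rightarrow> 'a \<Rightarrow> 'a) \<Rightarrow> bool" where
  "matched_pair_lie_algebras \<pp> br \<qq> br' \<rho> \<mu> \<longleftrightarrow>
     lie_algebra \<pp> br \<and> lie_algebra \<qq> br' \<and>
     lie_representation \<pp> br \<qq> \<rho> \<and> lie_representation \<qq> br' \<pp> \<mu> \<and>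
     (\<forall>x\<in>\<pp>. \<forall>\<xi>\<in>\<qq>. \<forall>\<eta>\<in>\<qq>.
        \<rho> x (br' \<xi> \<eta>) = br' (\<rho> x \<xi>) \<eta> + br' \<xi> (\<rho> x \<eta>) + \<rho> (\<mu> \<eta> x) \<xi> - \<rho> (\<mu> \<xi> x) \<eta>) \<and>
     (\<forall>\<xi>\<in>\<qq>. \<forall>x\<in>\<pp>. \<forall>y\<in>\<pp>.
        \<mu> \<xi> (br x y) = br (\<mu> \<xi> x) y + br x (\<mu> \<xi> y) + \<mu> (\<rho> y \<xi>) x - \<mu> (\<rho> x \<xi>) y)"

definition complementary_subspaces :: "'a::real_vector set \<Rightarrow> 'a set \<Rightarrow> 'a set \<Rightarrow> bool" where
  "complementary_subspaces V S T \<longleftrightarrow>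
     subspace S \<and> subspace T \<and> V = {x + y | x y. x \<in> S \<and> y \<in> T} \<and> S \<inter> T = {0}"

text \<open>For complementary subalgebras \<open>\<pp>\<close>, \<open>\<qq>\<close>, these are the unique \<open>\<rho>\<close> and \<open>\<mu>\<close> with
  \<open>[x, \<xi>] = \<rho>(x)\<xi> - \<mu>(\<xi>)x\<close>.\<close>

definition splitting_rho ::
  "'a::real_vector set \<Rightarrow> 'a set \<Rightarrow> ('a \<Rightarrow> 'a \<Rightarrow> 'a) \<Rightarrow> 'a \<Rightarrow> 'a \<Rightarrow> 'a" where
  "splitting_rho \<pp> \<qq> br x \<xi> = (THE \<eta>. \<eta> \<in> \<qq> \<and> (\<exists>y\<in>\<pp>. br x \<xi> = \<eta> - y))"

definition splitting_mu ::
  "'a::real_vector set \<Rightarrow> 'a set \<Rightarrow> ('a \<Rightarrow> 'a \<Rightarrow> 'a) \<Rightarrow> 'a \<Rightarrow> 'a \<Rightarrow> 'a" where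
  "splitting_mu \<pp> \<qq> br \<xi> x = (THE y. y \<in> \<pp> \<and> (\<exists>\<eta>\<in>\<qq>. br x \<xi> = \<eta> - y))"


section \<open>Smooth maps between subsets of Euclidean spaces\<close>

text \<open>In finite dimensions, \<open>f\<close> is \<open>C\<^sup>k\<^sup>+\<^sup>1\<close> on an open set iff it is differentiable there
  and all its directional derivatives are \<open>C\<^sup>k\<close>.\<close>

primrec Ck_open ::
  "nat \<Rightarrow> ('a::euclidean_space \<Rightarrow> 'b::euclidean_space) \<Rightarrow> 'a set \<Rightarrow> bool" where
  "Ck_open 0 f U \<longleftrightarrow> continuous_on U f"
| "Ck_open (Suc k) f U \<longleftrightarrow>
     (\<forall>x\<in>U. f differentiable (at x)) \<and> (\<forall>v. Ck_open k (\<lambda>x. frechet_derivative f (at x) v) U)"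

text \<open>On arbitrary subsets, smoothness means the existence of local smooth extensions.
  On relatively open subsets of a linear subspace this is ordinary smoothness within the
  subspace.\<close>

definition smooth_on :: "'a::euclidean_space set \<Rightarrow> ('a \<Rightarrow> 'b::euclidean_space) \<Rightarrow> bool" where
  "smooth_on S f \<longleftrightarrow>
     (\<forall>x\<in>S. \<exists>U g. open U \<and> x \<in> U \<and> (\<forall>k. Ck_open k g U) \<and> (\<forall>y\<in>S \<inter> U. g y = f y))"


section \<open>Smooth manifolds\<close>

text \<open>Charts take values in a linear subspace \<open>model M\<close> of a Euclidean space, so that every
  dimension, 0 included, occurs. A chart is a pair of its domain and its coordinate map; the
  atlas determines the topology and is not required to be maximal.\<close>

record ('m, 'e) manifold =
  points :: "'m set"
  model :: "'e set"
  charts :: "('m set \<times> ('m \<Rightarrow> 'e)) set"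

definition manifold_topology :: "('m, 'e::euclidean_space) manifold \<Rightarrow> 'm topology" where
  "manifold_topology M = topology (\<lambda>W. W \<subseteq> points M \<and>
     (\<forall>(U, \<phi>)\<in>charts M. openin (top_of_set (model M)) (\<phi> ` (U \<inter> W))))"

definition smooth_manifold :: "('m, 'e::euclidean_space) manifold \<Rightarrow> bool" where
  "smooth_manifold M \<longleftrightarrow>
     subspace (model M) \<and>
     points M = (\<Union>(U, \<phi>)\<in>charts M. U) \<and>
     (\<forall>(U, \<phi>)\<in>charts M. inj_on \<phi> U) \<and>
     (\<forall>(U, \<phi>)\<in>charts M. \<forall>(W, \<psi>)\<in>charts M.
        openin (top_of_set (model M)) (\<phi> ` (U \<inter> W)) \<and>
        smooth_on (\<phi> ` (U \<inter> W)) (\<psi> \<circ> inv_into U \<phi>)) \<and>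
     Hausdorff_space (manifold_topology M) \<and> second_countable (manifold_topology M)"

lemma openin_manifold_topology:
  assumes "smooth_manifold M"
  shows "openin (manifold_topology M) W \<longleftrightarrow> W \<subseteq> points M \<and>
     (\<forall>(U, \<phi>)\<in>charts M. openin (top_of_set (model M)) (\<phi> ` (U \<inter> W)))"
proof -
  let ?P = "\<lambda>W. W \<subseteq> points M \<and>
     (\<forall>(U, \<phi>)\<in>charts M. openin (top_of_set (model M)) (\<phi> ` (U \<inter> W)))"
  have inj: "inj_on \<phi> U" if "(U, \<phi>) \<in> charts M" for U \<phi>
    using assms that by (auto simp: smooth_manifold_def)
  have "istopology ?P"
    unfolding istopology_def
  proof (intro conjI allI impI)
    fix S T assume S: "?P S" and T: "?P T"
    have "openin (top_of_set (model M)) (\<phi> ` (U \<inter> (S \<inter> T)))" if c: "(U, \<phi>) \<in> charts M" for U \<phi>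
    proof -
      have "\<phi> ` (U \<inter> (S \<inter> T)) = \<phi> ` (U \<inter> S) \<inter> \<phi> ` (U \<inter> T)"
        using inj[OF c] by (auto simp: inj_on_def)
      then show ?thesis using S T c by auto
    qed
    then show "S \<inter> T \<subseteq> points M"
      and "\<forall>(U, \<phi>)\<in>charts M. openin (top_of_set (model M)) (\<phi> ` (U \<inter> (S \<inter> T)))"
      using S by auto
  next
    fix \<K> assume K: "\<forall>S\<in>\<K>. ?P S"
    have "openin (top_of_set (model M)) (\<phi> ` (U \<inter> \<Union>\<K>))" if c: "(U, \<phi>) \<in> charts M" for U \<phi>
    proof -
      have "\<phi> ` (U \<inter> \<Union>\<K>) = (\<Union>S\<in>\<K>. \<phi> ` (U \<inter> S))" by auto
      moreover have "openin (top_of_set (model M)) (\<phi> ` (U \<inter> S))" if "S \<in> \<K>" for S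
        using K c that by blast
      ultimately show ?thesis by auto
    qed
    then show "\<Union>\<K> \<subseteq> points M"
      and "\<forall>(U, \<phi>)\<in>charts M. openin (top_of_set (model M)) (\<phi> ` (U \<inter> \<Union>\<K>))"
      using K by auto
  qed
  then show ?thesis by (simp add: manifold_topology_def topology_inverse')
qed

definition smooth_map ::
  "('m, 'e::euclidean_space) manifold \<Rightarrow> ('n, 'f::euclidean_space) manifold \<Rightarrow> ('m \<Rightarrow> 'n) \<Rightarrow> bool"
  where
  "smooth_map M N f \<longleftrightarrow>
     continuous_map (manifold_topology M) (manifold_topology N) f \<and>
     (\<forall>(U, \<phi>)\<in>charts M. \<forall>(W, \<psi>)\<in>charts N.
        smooth_on (\<phi> ` (U \<inter> f -` W)) (\<psi> \<circ> f \<circ> inv_into U \<phi>))"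

definition diffeomorphism ::
  "('m, 'e::euclidean_space) manifold \<Rightarrow> ('n, 'f::euclidean_space) manifold \<Rightarrow> ('m \<Rightarrow> 'n) \<Rightarrow> bool"
  where
  "diffeomorphism M N f \<longleftrightarrow>
     bij_betw f (points M) (points N) \<and> smooth_map M N f \<and>
     smooth_map N M (inv_into (points M) f)"

definition open_submanifold :: "('m, 'e) manifold \<Rightarrow> 'm set \<Rightarrow> ('m, 'e) manifold" where
  "open_submanifold M W =
     \<lparr>points = W, model = model M, charts = (\<lambda>(U, \<phi>). (U \<inter> W, \<phi>)) ` charts M\<rparr>"

definition manifold_prod ::
  "('m, 'e) manifold \<Rightarrow> ('n, 'f) manifold \<Rightarrow> ('m \<times> 'n, 'e \<times> 'f) manifold" where
  "manifold_prod M N =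
     \<lparr>points = points M \<times> points N, model = model M \<times> model N,
      charts = {(U \<times> W, map_prod \<phi> \<psi>) | U \<phi> W \<psi>. (U, \<phi>) \<in> charts M \<and> (W, \<psi>) \<in> charts N}\<rparr>"

definition real_line :: "(real, real) manifold" where
  "real_line = \<lparr>points = UNIV, model = UNIV, charts = {(UNIV, \<lambda>t. t)}\<rparr>"


section \<open>Tangent vectors\<close>

text \<open>A tangent vector at \<open>p\<close> is the velocity of a smooth curve through \<open>p\<close>, regarded as the
  derivation \<open>f \<mapsto> (d/dt) f(c(t))\<close> at \<open>t = 0\<close> of germs of smooth functions at \<open>p\<close>. Germs are
  represented by total functions that are smooth near \<open>p\<close>; on all other functions a tangent
  vector is set to 0.\<close>

definition smooth_near :: "('m, 'e::euclidean_space) manifold \<Rightarrow> 'm \<Rightarrow> ('m \<Rightarrow> real) \<Rightarrow> bool" where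
  "smooth_near M p f \<longleftrightarrow>
     (\<exists>W. openin (manifold_topology M) W \<and> p \<in> W \<and> smooth_map (open_submanifold M W) real_line f)"

definition smooth_curve :: "('m, 'e::euclidean_space) manifold \<Rightarrow> (real \<Rightarrow> 'm) \<Rightarrow> bool" where
  "smooth_curve M c \<longleftrightarrow>
     (\<exists>\<epsilon>>0. smooth_map (open_submanifold real_line {-\<epsilon><..<\<epsilon>}) M c)"

type_synonym 'm tangent = "('m \<Rightarrow> real) \<Rightarrow> real"

definition velocity :: "('m, 'e::euclidean_space) manifold \<Rightarrow> (real \<Rightarrow> 'm) \<Rightarrow> 'm tangent" where
  "velocity M c = (\<lambda>f. if smooth_near M (c 0) f then deriv (\<lambda>t. f (c t)) 0 else 0)"

definition tangent_space :: "('m, 'e::euclidean_space) manifold \<Rightarrow> 'm \<Rightarrow> 'm tangent set" where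
  "tangent_space M p = {velocity M c | c. smooth_curve M c \<and> c 0 = p}"

text \<open>\<open>tangent_map N f p\<close> is the tangent map at \<open>p\<close> of a smooth map \<open>f\<close> into \<open>N\<close>.\<close>

definition tangent_map ::
  "('n, 'f::euclidean_space) manifold \<Rightarrow> ('m \<Rightarrow> 'n) \<Rightarrow> 'm \<Rightarrow> 'm tangent \<Rightarrow> 'n tangent" where
  "tangent_map N f p v = (\<lambda>h. if smooth_near N (f p) h then v (\<lambda>x. h (f x)) else 0)"

text \<open>Derivative at 0 of a curve in a tangent space. Tangent spaces are finite-dimensional,
  so this may be tested by evaluating on functions.\<close>

definition has_tangent_derivative :: "(real \<Rightarrow> 'm tangent) \<Rightarrow> 'm tangent \<Rightarrow> bool" where
  "has_tangent_derivative F D \<longleftrightarrow> (\<forall>h. ((\<lambda>t. F t h) has_real_derivative D h) (at 0))"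


section \<open>Lie groups\<close>

record ('g, 'e) lie_group_struct = "'g monoid" +
  mfd :: "('g, 'e) manifold"

definition lie_group :: "('g, 'e::euclidean_space) lie_group_struct \<Rightarrow> bool" where
  "lie_group G \<longleftrightarrow>
     group G \<and> smooth_manifold (mfd G) \<and> points (mfd G) = carrier G \<and>
     smooth_map (manifold_prod (mfd G) (mfd G)) (mfd G) (\<lambda>(x, y). x \<otimes>\<^bsub>G\<^esub> y) \<and>
     smooth_map (mfd G) (mfd G) (m_inv G)"

definition lie_group_prod ::
  "('g, 'e) lie_group_struct \<Rightarrow> ('h, 'f) lie_group_struct \<Rightarrow> ('g \<times> 'h, 'e \<times> 'f) lie_group_struct"
  where
  "lie_group_prod G H =
     \<lparr>carrier = carrier (G \<times>\<times> H), mult = mult (G \<times>\<times> H), one = one (G \<times>\<times> H),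
      mfd = manifold_prod (mfd G) (mfd H)\<rparr>"

text \<open>\<open>P\<close> is an embedded Lie subgroup of \<open>K\<close>: a subgroup with a Lie group structure whose
  inclusion is a smooth immersion and a topological embedding.\<close>

definition lie_subgroup ::
  "('g, 'e::euclidean_space) lie_group_struct \<Rightarrow> ('g, 'e) lie_group_struct \<Rightarrow> bool" where
  "lie_subgroup P K \<longleftrightarrow>
     lie_group K \<and> lie_group P \<and>
     subgroup (carrier P) K \<and> P = K\<lparr>carrier := carrier P, mfd := mfd P\<rparr> \<and>
     smooth_map (mfd P) (mfd K) (\<lambda>x. x) \<and>
     (\<forall>p\<in>carrier P. inj_on (tangent_map (mfd K) (\<lambda>x. x) p) (tangent_space (mfd P) p)) \<and>
     manifold_topology (mfd P) = subtopology (manifold_topology (mfd K)) (carrier P)"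

text \<open>The Lie algebra of \<open>G\<close> is the tangent space at the identity with the commutator
  \<open>f \<mapsto> u(Y f) - v(X f)\<close> of the left-invariant vector fields \<open>X\<close>, \<open>Y\<close> extending \<open>u\<close>, \<open>v\<close>.\<close>

definition lie :: "('g, 'e::euclidean_space) lie_group_struct \<Rightarrow> 'g tangent set" where
  "lie G = tangent_space (mfd G) \<one>\<^bsub>G\<^esub>"

definition left_invariant_field ::
  "('g, 'e::euclidean_space) lie_group_struct \<Rightarrow> 'g tangent \<Rightarrow> 'g \<Rightarrow> 'g tangent" where
  "left_invariant_field G v g = tangent_map (mfd G) (\<lambda>x. g \<otimes>\<^bsub>G\<^esub> x) \<one>\<^bsub>G\<^esub> v"

definition lie_bracket ::
  "('g, 'e::euclidean_space) lie_group_struct \<Rightarrow> 'g tangent \<Rightarrow> 'g tangent \<Rightarrow> 'g tangent" where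
  "lie_bracket G u v = (\<lambda>f. if smooth_near (mfd G) \<one>\<^bsub>G\<^esub> f
     then u (\<lambda>g. left_invariant_field G v g f) - v (\<lambda>g. left_invariant_field G u g f) else 0)"

text \<open>The identification of \<open>Lie(G) \<oplus> Lie(H)\<close> with \<open>Lie(G \<times> H)\<close>.\<close>

definition lie_prod_pair ::
  "('g, 'e::euclidean_space) lie_group_struct \<Rightarrow> ('h, 'f::euclidean_space) lie_group_struct
    \<Rightarrow> 'g tangent \<times> 'h tangent \<Rightarrow> ('g \<times> 'h) tangent" where
  "lie_prod_pair G H = (\<lambda>(u, v).
     tangent_map (mfd (lie_group_prod G H)) (\<lambda>g. (g, \<one>\<^bsub>H\<^esub>)) \<one>\<^bsub>G\<^esub> u +
     tangent_map (mfd (lie_group_prod G H)) (\<lambda>h. (\<one>\<^bsub>G\<^esub>, h)) \<one>\<^bsub>H\<^esub> v)"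


section \<open>Matched pairs of Lie groups\<close>

definition matched_pair_lie_groups ::
  "('p, 'e::euclidean_space) lie_group_struct \<Rightarrow> ('q, 'f::euclidean_space) lie_group_struct
    \<Rightarrow> ('p \<Rightarrow> 'q \<Rightarrow> 'q) \<Rightarrow> ('p \<Rightarrow> 'q \<Rightarrow> 'p) \<Rightarrow> bool" where
  "matched_pair_lie_groups P Q lact ract \<longleftrightarrow>
     lie_group P \<and> lie_group Q \<and>
     smooth_map (manifold_prod (mfd P) (mfd Q)) (mfd Q) (\<lambda>(p, q). lact p q) \<and>
     smooth_map (manifold_prod (mfd P) (mfd Q)) (mfd P) (\<lambda>(p, q). ract p q) \<and>
     (\<forall>q\<in>carrier Q. lact \<one>\<^bsub>P\<^esub> q = q) \<and>
     (\<forall>p1\<in>carrier P. \<forall>p2\<in>carrier P. \<forall>q\<in>carrier Q.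
        lact (p1 \<otimes>\<^bsub>P\<^esub> p2) q = lact p1 (lact p2 q)) \<and>
     (\<forall>p\<in>carrier P. ract p \<one>\<^bsub>Q\<^esub> = p) \<and>
     (\<forall>p\<in>carrier P. \<forall>q1\<in>carrier Q. \<forall>q2\<in>carrier Q.
        ract p (q1 \<otimes>\<^bsub>Q\<^esub> q2) = ract (ract p q1) q2) \<and>
     (\<forall>p\<in>carrier P. \<forall>q1\<in>carrier Q. \<forall>q2\<in>carrier Q.
        lact p (q1 \<otimes>\<^bsub>Q\<^esub> q2) = lact p q1 \<otimes>\<^bsub>Q\<^esub> lact (ract p q1) q2) \<and>
     (\<forall>p1\<in>carrier P. \<forall>p2\<in>carrier P. \<forall>q\<in>carrier Q.
        ract (p1 \<otimes>\<^bsub>P\<^esub> p2) q = ract p1 (lact p2 q) \<otimes>\<^bsub>P\<^esub> ract p2 q)"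

text \<open>If \<open>(p, q) \<mapsto> p q\<close> is a bijection \<open>P \<times> Q \<rightarrow> K\<close> for subgroups \<open>P\<close>, \<open>Q\<close> of \<open>K\<close>, these
  are the unique maps into \<open>Q\<close> and \<open>P\<close> with
  \<open>p q = (factor_lact K P Q p q) (factor_ract K P Q p q)\<close>.\<close>

definition factor_lact ::
  "('g, 'e) lie_group_struct \<Rightarrow> 'g set \<Rightarrow> 'g set \<Rightarrow> 'g \<Rightarrow> 'g \<Rightarrow> 'g" where
  "factor_lact K P Q p q = (THE q'. q' \<in> Q \<and> (\<exists>p'\<in>P. p \<otimes>\<^bsub>K\<^esub> q = q' \<otimes>\<^bsub>K\<^esub> p'))"

definition factor_ract ::
  "('g, 'e) lie_group_struct \<Rightarrow> 'g set \<Rightarrow> 'g set \<Rightarrow> 'g \<Rightarrow> 'g \<Rightarrow> 'g" where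
  "factor_ract K P Q p q = (THE p'. p' \<in> P \<and> (\<exists>q'\<in>Q. p \<otimes>\<^bsub>K\<^esub> q = q' \<otimes>\<^bsub>K\<^esub> p'))"

text \<open>The differentiation of the matched pair of Lie groups \<open>(P, Q)\<close> is
  \<open>(\<pp>, \<qq>, \<rho>, \<mu>)\<close>, under the identifications \<open>\<alpha> : \<pp> \<rightarrow> Lie(P)\<close> and \<open>\<beta> : \<qq> \<rightarrow> Lie(Q)\<close>.
  The differential at the identity of the map from \<open>P\<close> to \<open>gl(Lie(Q))\<close> in direction \<open>x\<close> is
  computed along all curves with velocity \<open>x\<close>; similarly for \<open>\<mu>\<close>, where the curve
  \<open>t \<mapsto> exp(t\<xi>)\<close> gives \<open>\<mu>(\<xi>)x = -(d/dt)(x \<triangleleft> exp(t\<xi>))\<close> at \<open>t = 0\<close>.\<close>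

definition is_differentiation ::
  "('p, 'e::euclidean_space) lie_group_struct \<Rightarrow> ('q, 'f::euclidean_space) lie_group_struct
    \<Rightarrow> ('p \<Rightarrow> 'q \<Rightarrow> 'q) \<Rightarrow> ('p \<Rightarrow> 'q \<Rightarrow> 'p)
    \<Rightarrow> 'a::real_vector set \<Rightarrow> ('a \<Rightarrow> 'a \<Rightarrow> 'a) \<Rightarrow> 'b::real_vector set \<Rightarrow> ('b \<Rightarrow> 'b \<Rightarrow> 'b)
    \<Rightarrow> ('a \<Rightarrow> 'b \<Rightarrow> 'b) \<Rightarrow> ('b \<Rightarrow> 'a \<Rightarrow> 'a) \<Rightarrow> ('a \<Rightarrow> 'p tangent) \<Rightarrow> ('b \<Rightarrow> 'q tangent) \<Rightarrow> bool"
  where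
  "is_differentiation P Q lact ract \<pp> br \<qq> br' \<rho> \<mu> \<alpha> \<beta> \<longleftrightarrow>
     lie_algebra_iso \<pp> br (lie P) (lie_bracket P) \<alpha> \<and>
     lie_algebra_iso \<qq> br' (lie Q) (lie_bracket Q) \<beta> \<and>
     (\<forall>x\<in>\<pp>. \<forall>\<xi>\<in>\<qq>. \<forall>c.
        smooth_curve (mfd P) c \<and> c 0 = \<one>\<^bsub>P\<^esub> \<and> velocity (mfd P) c = \<alpha> x \<longrightarrow>
        has_tangent_derivative
          (\<lambda>t. tangent_map (mfd Q) (\<lambda>q. lact (c t) q) \<one>\<^bsub>Q\<^esub> (\<beta> \<xi>)) (\<beta> (\<rho> x \<xi>))) \<and>
     (\<forall>x\<in>\<pp>. \<forall>\<xi>\<in>\<qq>. \<forall>c.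
        smooth_curve (mfd Q) c \<and> c 0 = \<one>\<^bsub>Q\<^esub> \<and> velocity (mfd Q) c = \<beta> \<xi> \<longrightarrow>
        has_tangent_derivative
          (\<lambda>t. tangent_map (mfd P) (\<lambda>p. ract p (c t)) \<one>\<^bsub>P\<^esub> (\<alpha> x)) (- \<alpha> (\<mu> \<xi> x)))"


section \<open>Rota-Baxter operators\<close>

definition rota_baxter_lie_algebra ::
  "'a::real_vector set \<Rightarrow> ('a \<Rightarrow> 'a \<Rightarrow> 'a) \<Rightarrow> ('a \<Rightarrow> 'a) \<Rightarrow> bool" where
  "rota_baxter_lie_algebra \<gg> br B \<longleftrightarrow>
     lie_algebra \<gg> br \<and> linear_on \<gg> B \<and> B ` \<gg> \<subseteq> \<gg> \<and>
     (\<forall>u\<in>\<gg>. \<forall>v\<in>\<gg>. br (B u) (B v) = B (br (B u) v + br u (B v) + br u v))"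

definition rota_baxter_lie_group ::
  "('g, 'e::euclidean_space) lie_group_struct \<Rightarrow> ('g \<Rightarrow> 'g) \<Rightarrow> bool" where
  "rota_baxter_lie_group G \<B> \<longleftrightarrow>
     lie_group G \<and> smooth_map (mfd G) (mfd G) \<B> \<and>
     (\<forall>g\<in>carrier G. \<forall>h\<in>carrier G.
        \<B> g \<otimes>\<^bsub>G\<^esub> \<B> h = \<B> (g \<otimes>\<^bsub>G\<^esub> \<B> g \<otimes>\<^bsub>G\<^esub> h \<otimes>\<^bsub>G\<^esub> m_inv G (\<B> g)))"

text \<open>\<open>(G, \<B>)\<close> integrates the Rota-Baxter Lie algebra \<open>(\<gg>, B)\<close>, where \<open>\<gg>\<close> is identified
  with \<open>Lie(G)\<close> by \<open>\<iota>\<close>.\<close>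

definition integrated_rota_baxter ::
  "'a::real_vector set \<Rightarrow> ('a \<Rightarrow> 'a \<Rightarrow> 'a) \<Rightarrow> ('a \<Rightarrow> 'a)
    \<Rightarrow> ('g, 'e::euclidean_space) lie_group_struct \<Rightarrow> ('g \<Rightarrow> 'g) \<Rightarrow> ('a \<Rightarrow> 'g tangent) \<Rightarrow> bool" where
  "integrated_rota_baxter \<gg> br B G \<B> \<iota> \<longleftrightarrow>
     rota_baxter_lie_group G \<B> \<and>
     lie_algebra_iso \<gg> br (lie G) (lie_bracket G) \<iota> \<and>
     (\<forall>x\<in>\<gg>. tangent_map (mfd G) \<B> \<one>\<^bsub>G\<^esub> (\<iota> x) = \<iota> (B x))"

definition rb_graph_group ::
  "('g, 'e) lie_group_struct \<Rightarrow> ('g \<Rightarrow> 'g) \<Rightarrow> ('g \<times> 'g) set" where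
  "rb_graph_group G \<B> = {(\<B> g, g \<otimes>\<^bsub>G\<^esub> \<B> g) | g. g \<in> carrier G}"

definition rb_graph_algebra :: "'a::real_vector set \<Rightarrow> ('a \<Rightarrow> 'a) \<Rightarrow> ('a \<times> 'a) set" where
  "rb_graph_algebra \<gg> B = {(B x, x + B x) | x. x \<in> \<gg>}"

definition diagonal :: "'a set \<Rightarrow> ('a \<times> 'a) set" where
  "diagonal S = {(x, x) | x. x \<in> S}"

end

theory Submission
  imports Defs
begin

text \<open>
  The Rota-Baxter identity says that the graph
  \<open>P = {(\<B>(g), g \<B>(g))}\<close> is closed under multiplication in \<open>K = G \<times> G\<close>, where the points over \<open>g\<close>
  and \<open>h\<close> multiply to the point over \<open>g \<B>(g) h \<B>(g)\<^sup>-\<^sup>1\<close>. Every \<open>(a, b)\<close> in \<open>K\<close> is in a unique way a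
  product \<open>q p\<close> with \<open>q\<close> in the diagonal \<open>Q\<close> and \<open>p\<close> in \<open>P\<close>: the factor \<open>q\<close> is the diagonal element of
  \<open>a \<B>(b\<^sup>-\<^sup>1 a)\<close>. This formula is smooth, and so are the factorization, its inverse and the two actions
  \<open>p \<triangleright> q\<close>, \<open>p \<triangleleft> q\<close> read off from \<open>p q = (p \<triangleright> q)(p \<triangleleft> q)\<close>. The identities of a matched pair follow from
  the uniqueness of factorizations alone (locales group_factorization, lie_group_factorization).
  Both \<open>P\<close> and \<open>Q\<close> are images of \<open>G\<close> under a smooth map with a smooth left inverse on all of \<open>K\<close>, which
  makes them embedded Lie subgroups (locale retract_embedding).

  On the Lie algebra side \<open>\<gg> \<oplus> \<gg>\<close> splits into the subalgebras \<open>{(B x, x + B x)}\<close> and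
  \<open>{(x, x)}\<close>, and the components of the Jacobi identity are the identities of a matched pair of Lie
  algebras (locale lie_splitting).

  For the differentiation, brackets are written as mixed second derivatives along curves \<open>c\<close>, \<open>d\<close>
  through the identity (lemma lie_bracket_velocity):
  \<open>[u, v] f\<close> is \<open>\<partial>\<^sub>s\<partial>\<^sub>t f(c(s) d(t)) - \<partial>\<^sub>s\<partial>\<^sub>t f(d(s) c(t))\<close>. The symmetry of second derivatives gives the
  bracket of a direct product (lemma lie_bracket_prod). Now let \<open>h\<close> be a function on \<open>Q\<close>, let \<open>f(q p) = h(q)\<close>
  be its extension to \<open>K\<close>, and let \<open>c\<close> and \<open>d\<close> be curves in \<open>P\<close> and \<open>Q\<close> with velocities \<open>x\<close> and \<open>\<xi>\<close>.
  Then \<open>f(c(t) d(s)) = h(c(t) \<triangleright> d(s))\<close>, while \<open>f(d(s) c(t)) = h(d(s))\<close> does not depend on \<open>t\<close>. So the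
  mixed derivative of \<open>h(c(t) \<triangleright> d(s))\<close> is \<open>[x, \<xi>] f = (\<rho>(x)\<xi>) f - (\<mu>(\<xi>)x) f\<close>, and this is \<open>(\<rho>(x)\<xi>) h\<close>,
  because \<open>f\<close> extends \<open>h\<close> and is constant on \<open>P\<close>. The extension of functions on \<open>P\<close> by the other
  projection gives \<open>-\<mu>\<close> in the same way (locale differentiated_factorization).

  All smoothness arguments use one pointwise notion of smoothness in charts, smooth_at, which is
  closed under composition and pairing and expresses smooth maps, germs of functions and curves.
\<close>

section \<open>Calculus of smooth functions on open sets\<close>

lemma frechet_derivative_eqI:
  "(f has_derivative f') (at x) \<Longrightarrow> frechet_derivative f (at x) = f'"
  by (rule frechet_derivative_at[symmetric])

lemma Ck_open_cong:
  assumes "open U" "\<And>x. x \<in> U \<Longrightarrow> f x = g x"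
  shows "Ck_open k f U \<longleftrightarrow> Ck_open k g U"
  using assms(2)
proof (induction k arbitrary: f g)
  case 0
  then show ?case by (simp cong: continuous_on_cong)
next
  case (Suc k)
  have der: "(f has_derivative D) (at x) \<longleftrightarrow> (g has_derivative D) (at x)" if "x \<in> U" for x D
    using has_derivative_transform_within_open[OF _ \<open>open U\<close> that, of f D UNIV g]
      has_derivative_transform_within_open[OF _ \<open>open U\<close> that, of g D UNIV f] Suc.prems by auto
  have "frechet_derivative f (at x) = frechet_derivative g (at x)" if "x \<in> U" for x
    by (simp add: frechet_derivative_def der[OF that])
  then have "Ck_open k (\<lambda>x. frechet_derivative f (at x) v) U
      \<longleftrightarrow> Ck_open k (\<lambda>x. frechet_derivative g (at x) v) U" for v
    by (intro Suc.IH) simp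
  moreover have "f differentiable (at x) \<longleftrightarrow> g differentiable (at x)" if "x \<in> U" for x
    by (simp add: differentiable_def der[OF that])
  ultimately show ?case by simp
qed

lemma Ck_open_subset: "Ck_open k f U \<Longrightarrow> V \<subseteq> U \<Longrightarrow> Ck_open k f V"
  by (induction k arbitrary: f) (auto intro: continuous_on_subset)

lemma Ck_open_SucI:
  assumes "open U" "\<And>x. x \<in> U \<Longrightarrow> (f has_derivative D x) (at x)"
    and "\<And>v. Ck_open k (\<lambda>x. D x v) U"
  shows "Ck_open (Suc k) f U"
proof -
  have "Ck_open k (\<lambda>x. frechet_derivative f (at x) v) U" for v
    using assms(3)[of v] Ck_open_cong[OF assms(1), of "\<lambda>x. frechet_derivative f (at x) v" "\<lambda>x. D x v" k]
    by (simp add: frechet_derivative_eqI[OF assms(2)])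
  then show ?thesis using assms(2) by (auto simp: differentiable_def)
qed

lemma Ck_open_Suc_derivative:
  assumes "Ck_open (Suc k) f U" "x \<in> U"
  shows "(f has_derivative frechet_derivative f (at x)) (at x)"
  using assms by (simp flip: frechet_derivative_works)

lemma Ck_open_SucD: "Ck_open (Suc k) f U \<Longrightarrow> Ck_open k f U"
proof (induction k arbitrary: f)
  case 0
  then show ?case
    by (auto intro!: continuous_at_imp_continuous_on differentiable_imp_continuous_within)
next
  case (Suc k)
  show ?case
    using Suc.IH Suc.prems by (metis Ck_open.simps(2))
qed

lemma Ck_open_continuous: "Ck_open k f U \<Longrightarrow> continuous_on U f"
  by (induction k) (simp, blast dest: Ck_open_SucD)

lemma Ck_open_const: "Ck_open k (\<lambda>x. c) U"
  by (induction k arbitrary: c) auto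

lemma Ck_open_linear:
  assumes "bounded_linear L" "open U" shows "Ck_open k L U"
proof (cases k)
  case 0
  then show ?thesis using assms by (simp add: linear_continuous_on)
next
  case (Suc m)
  show ?thesis unfolding Suc
    by (rule Ck_open_SucI[OF assms(2), where D="\<lambda>_. L"])
      (auto intro: bounded_linear_imp_has_derivative assms Ck_open_const)
qed

lemma Ck_open_add:
  assumes "open U" "Ck_open k f U" "Ck_open k g U"
  shows "Ck_open k (\<lambda>x. f x + g x) U"
  using assms(2,3)
proof (induction k arbitrary: f g)
  case 0
  then show ?case by (auto intro: continuous_intros)
next
  case (Suc k)
  show ?case
  proof (rule Ck_open_SucI[OF assms(1)])
    fix x assume "x \<in> U"
    show "((\<lambda>x. f x + g x) has_derivative
        (\<lambda>v. frechet_derivative f (at x) v + frechet_derivative g (at x) v)) (at x)"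
      using Suc.prems \<open>x \<in> U\<close> by (auto intro!: has_derivative_add Ck_open_Suc_derivative simp del: Ck_open.simps)
  qed (use Suc in auto)
qed

lemma Ck_open_sum:
  assumes "open U" "finite A" "\<And>i. i \<in> A \<Longrightarrow> Ck_open k (f i) U"
  shows "Ck_open k (\<lambda>x. \<Sum>i\<in>A. f i x) U"
  using assms(2,3) by (induction A) (auto intro: Ck_open_const Ck_open_add assms(1))

lemma Ck_open_scaleR:
  fixes f :: "'a::euclidean_space \<Rightarrow> real"
  assumes "open U" "Ck_open k f U" "Ck_open k g U"
  shows "Ck_open k (\<lambda>x. f x *\<^sub>R g x) U"
  using assms(2,3)
proof (induction k arbitrary: f g)
  case 0
  then show ?case by (auto intro: continuous_intros)
next
  case (Suc k)
  show ?case
  proof (rule Ck_open_SucI[OF assms(1)])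
    fix x assume "x \<in> U"
    show "((\<lambda>x. f x *\<^sub>R g x) has_derivative
        (\<lambda>v. f x *\<^sub>R frechet_derivative g (at x) v + frechet_derivative f (at x) v *\<^sub>R g x)) (at x)"
      using Suc.prems \<open>x \<in> U\<close> by (auto intro!: has_derivative_scaleR Ck_open_Suc_derivative simp del: Ck_open.simps)
  next
    show "Ck_open k (\<lambda>x. f x *\<^sub>R frechet_derivative g (at x) v
        + frechet_derivative f (at x) v *\<^sub>R g x) U" for v
      using Suc.prems Suc.prems[THEN Ck_open_SucD] by (intro Ck_open_add assms(1) Suc.IH) auto
  qed
qed

lemma Ck_open_compose_linear:
  assumes "open U" "bounded_linear L" "Ck_open k f U"
  shows "Ck_open k (\<lambda>x. L (f x)) U"
  using assms(3)
proof (induction k arbitrary: f)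
  case 0
  then show ?case using assms(2)
    by (auto intro: continuous_on_compose2[OF linear_continuous_on[of L UNIV]])
next
  case (Suc k)
  show ?case
    by (rule Ck_open_SucI[OF assms(1)
          bounded_linear.has_derivative[OF assms(2) Ck_open_Suc_derivative[OF Suc.prems]]])
      (use Suc in auto)
qed

text \<open>The derivative of a composite is
  \<open>D(g \<circ> f)(x) v = (\<Sum>b. (Df(x) v \<bullet> b) Dg(f x) b)\<close> over an orthonormal basis: a sum of products of
  \<open>C\<^sup>k\<close> functions, so the claim passes from \<open>k\<close> to \<open>k + 1\<close>.\<close>

lemma Ck_open_compose:
  assumes "open U" "open V" "f ` U \<subseteq> V" "Ck_open k f U" "Ck_open k g V"
  shows "Ck_open k (\<lambda>x. g (f x)) U"
  using assms(4,5)
proof (induction k arbitrary: g)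
  case 0
  then show ?case using assms(3) by (auto intro: continuous_on_compose2)
next
  case (Suc k)
  show ?case
  proof (rule Ck_open_SucI[OF assms(1)])
    fix x assume x: "x \<in> U"
    let ?F = "frechet_derivative f (at x)" and ?G = "frechet_derivative g (at (f x))"
    have G: "(g has_derivative ?G) (at (f x))"
      by (rule Ck_open_Suc_derivative[OF Suc.prems(2)]) (use x assms(3) in auto)
    have "?G w = (\<Sum>b\<in>Basis. (w \<bullet> b) *\<^sub>R ?G b)" for w
    proof -
      have lin: "linear ?G" using G by (rule has_derivative_linear)
      have "?G w = ?G (\<Sum>b\<in>Basis. (w \<bullet> b) *\<^sub>R b)" by (simp add: euclidean_representation)
      then show ?thesis by (simp add: linear_sum[OF lin] linear_scale[OF lin])
    qed
    then have eq: "(\<lambda>v. \<Sum>b\<in>Basis. (?F v \<bullet> b) *\<^sub>R ?G b) = (\<lambda>v. ?G (?F v))"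
      by (intro ext) (rule sym)
    show "((\<lambda>x. g (f x)) has_derivative (\<lambda>v. \<Sum>b\<in>Basis. (?F v \<bullet> b) *\<^sub>R ?G b)) (at x)"
      unfolding eq by (rule has_derivative_compose[OF Ck_open_Suc_derivative[OF Suc.prems(1) x] G])
  next
    fix v
    show "Ck_open k (\<lambda>x. \<Sum>b\<in>Basis. (frechet_derivative f (at x) v \<bullet> b) *\<^sub>R
        frechet_derivative g (at (f x)) b) U"
    proof (intro Ck_open_sum assms(1) finite_Basis Ck_open_scaleR)
      fix b :: 'b
      show "Ck_open k (\<lambda>x. frechet_derivative f (at x) v \<bullet> b) U"
        using Suc.prems(1)
        by (intro Ck_open_compose_linear[OF assms(1) bounded_linear_inner_left]) simp
      show "Ck_open k (\<lambda>x. frechet_derivative g (at (f x)) b) U"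
        using Suc.IH[OF Ck_open_SucD[OF Suc.prems(1)], of "\<lambda>y. frechet_derivative g (at y) b"]
          Suc.prems(2) by simp
    qed
  qed
qed

lemma Ck_open_Pair:
  assumes "open U" "Ck_open k f U" "Ck_open k g U"
  shows "Ck_open k (\<lambda>x. (f x, g x)) U"
proof -
  have "bounded_linear (\<lambda>a::'b. (a, 0::'c))" "bounded_linear (\<lambda>b::'c. (0::'b, b))"
    by (intro bounded_linear_Pair bounded_linear_ident bounded_linear_zero)+
  then have "Ck_open k (\<lambda>x. (f x, 0) + (0, g x)) U"
    using assms by (intro Ck_open_add Ck_open_compose_linear[where L="\<lambda>a. (a, 0)"]
        Ck_open_compose_linear[where L="\<lambda>b. (0, b)"])
  then show ?thesis by simp
qed

lemma has_real_derivative_along: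
  fixes f :: "'a::real_normed_vector \<Rightarrow> real"
  assumes f: "(f has_derivative D) (at (c t))" and c: "(c has_derivative (\<lambda>h. h *\<^sub>R v)) (at t)"
  shows "((\<lambda>t. f (c t)) has_real_derivative D v) (at t)"
proof -
  have "(\<lambda>h. D (h *\<^sub>R v)) = (*) (D v)"
    using linear_scale[OF has_derivative_linear[OF f], of _ v] by (simp add: fun_eq_iff mult.commute)
  then show ?thesis
    using has_derivative_compose[OF c f] by (simp add: has_field_derivative_def)
qed

lemma has_derivative_partial_real:
  fixes f :: "real \<times> real \<Rightarrow> real"
  assumes "(f has_derivative D) (at (s, t))"
  shows "((\<lambda>s. f (s, t)) has_real_derivative D (1, 0)) (at s)"
    and "((\<lambda>t. f (s, t)) has_real_derivative D (0, 1)) (at t)"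
  by (rule has_real_derivative_along[of f D _ _ "(1, 0)"] has_real_derivative_along[of f D _ _ "(0, 1)"];
      use assms in \<open>auto intro!: derivative_eq_intros\<close>)+

text \<open>Two applications of the mean value theorem to the second difference
  \<open>f(h,h) - f(h,0) - f(0,h) + f(0,0)\<close>, in either order of the variables, express it as \<open>h\<^sup>2\<close> times
  a value of either mixed derivative near the origin; both values tend to those at the origin.\<close>

lemma mixed_partials_commute:
  fixes f f1 f2 f12 f21 :: "real \<times> real \<Rightarrow> real"
  assumes O: "open O'" "(0, 0) \<in> O'"
    and f1: "\<And>s t. (s, t) \<in> O' \<Longrightarrow> ((\<lambda>s. f (s, t)) has_real_derivative f1 (s, t)) (at s)"
    and f2: "\<And>s t. (s, t) \<in> O' \<Longrightarrow> ((\<lambda>t. f (s, t)) has_real_derivative f2 (s, t)) (at t)"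
    and f12: "\<And>s t. (s, t) \<in> O' \<Longrightarrow> ((\<lambda>t. f1 (s, t)) has_real_derivative f12 (s, t)) (at t)"
    and f21: "\<And>s t. (s, t) \<in> O' \<Longrightarrow> ((\<lambda>s. f2 (s, t)) has_real_derivative f21 (s, t)) (at s)"
    and cont: "continuous_on O' f12" "continuous_on O' f21"
  shows "f12 (0, 0) = f21 (0, 0)"
proof (rule ccontr)
  assume neq: "f12 (0, 0) \<noteq> f21 (0, 0)"
  define e where "e = \<bar>f12 (0, 0) - f21 (0, 0)\<bar> / 2"
  have "e > 0" using neq by (simp add: e_def)
  have "\<exists>d>0. \<forall>x\<in>O'. dist x (0, 0) < d \<longrightarrow> dist (F x) (F (0, 0)) < e"
    if "continuous_on O' F" for F :: "real \<times> real \<Rightarrow> real"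
    using that[unfolded continuous_on_iff, rule_format, OF O(2) \<open>e > 0\<close>] by blast
  note near = this
  obtain d1 where d1: "d1 > 0" "\<And>x. x \<in> O' \<Longrightarrow> dist x (0, 0) < d1 \<Longrightarrow> dist (f12 x) (f12 (0, 0)) < e"
    using near[OF cont(1)] by metis
  obtain d2 where d2: "d2 > 0" "\<And>x. x \<in> O' \<Longrightarrow> dist x (0, 0) < d2 \<Longrightarrow> dist (f21 x) (f21 (0, 0)) < e"
    using near[OF cont(2)] by metis
  note d = d1 d2
  obtain d3 where d3: "d3 > 0" "ball (0, 0) d3 \<subseteq> O'"
    using O openE by blast
  define h where "h = min d1 (min d2 d3) / 3"
  have "h > 0" using d d3 by (simp add: h_def)
  have small: "dist (s, t) (0, 0) < d1 \<and> dist (s, t) (0, 0) < d2 \<and> (s, t) \<in> O'"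
    if "0 \<le> s" "s \<le> h" "0 \<le> t" "t \<le> h" for s t
  proof -
    have "dist (s, t) (0, 0) \<le> s + t"
      using that sqrt_sum_squares_le_sum_abs[of s t] by (simp add: dist_prod_def)
    also have "\<dots> < min d1 (min d2 d3)" using that \<open>h > 0\<close> by (simp add: h_def)
    finally have l: "dist (s, t) (0, 0) < min d1 (min d2 d3)" .
    then have "(s, t) \<in> ball (0, 0) d3" by (simp add: dist_commute)
    then show ?thesis using l d3 by auto
  qed
  define \<Delta> where "\<Delta> = f (h, h) - f (h, 0) - f (0, h) + f (0, 0)"
  obtain s1 where s1: "0 < s1" "s1 < h" "\<Delta> = h * (f1 (s1, h) - f1 (s1, 0))"
  proof -
    have "((\<lambda>s. f (s, h) - f (s, 0)) has_real_derivative f1 (s, h) - f1 (s, 0)) (at s)"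
      if "0 \<le> s" "s \<le> h" for s
      using that small \<open>h > 0\<close> by (intro DERIV_diff f1) auto
    from MVT2[OF \<open>h > 0\<close> this] that show ?thesis by (auto simp: \<Delta>_def)
  qed
  obtain t1 where t1: "0 < t1" "t1 < h" "f1 (s1, h) - f1 (s1, 0) = h * f12 (s1, t1)"
  proof -
    have "((\<lambda>t. f1 (s1, t)) has_real_derivative f12 (s1, t)) (at t)" if "0 \<le> t" "t \<le> h" for t
      using that small s1 by (intro f12) auto
    from MVT2[OF \<open>h > 0\<close> this] that show ?thesis by auto
  qed
  obtain t2 where t2: "0 < t2" "t2 < h" "\<Delta> = h * (f2 (h, t2) - f2 (0, t2))"
  proof -
    have "((\<lambda>t. f (h, t) - f (0, t)) has_real_derivative f2 (h, t) - f2 (0, t)) (at t)"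
      if "0 \<le> t" "t \<le> h" for t
      using that small \<open>h > 0\<close> by (intro DERIV_diff f2) auto
    from MVT2[OF \<open>h > 0\<close> this] that show ?thesis by (auto simp: \<Delta>_def)
  qed
  obtain s2 where s2: "0 < s2" "s2 < h" "f2 (h, t2) - f2 (0, t2) = h * f21 (s2, t2)"
  proof -
    have "((\<lambda>s. f2 (s, t2)) has_real_derivative f21 (s, t2)) (at s)" if "0 \<le> s" "s \<le> h" for s
      using that small t2 by (intro f21) auto
    from MVT2[OF \<open>h > 0\<close> this] that show ?thesis by auto
  qed
  have "f12 (s1, t1) = f21 (s2, t2)"
    using s1 t1 s2 t2 \<open>h > 0\<close> by auto
  moreover have "dist (f12 (s1, t1)) (f12 (0, 0)) < e"
    using small[of s1 t1] s1 t1 by (intro d) auto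
  moreover have "dist (f21 (s2, t2)) (f21 (0, 0)) < e"
    using small[of s2 t2] s2 t2 by (intro d) auto
  ultimately have "dist (f12 (0, 0)) (f21 (0, 0)) < 2 * e"
    using dist_triangle3[of "f12 (0, 0)" "f21 (0, 0)" "f12 (s1, t1)"] by simp
  then show False by (simp add: e_def dist_real_def)
qed

section \<open>Smoothness at a point of a manifold\<close>

text \<open>The coordinate expression of \<open>f\<close> at \<open>p\<close> has a smooth extension \<open>g\<close> to an open set \<open>A\<close> of the
  ambient Euclidean space. Requiring \<open>f q \<in> V\<close> for all points with coordinates in \<open>A\<close> includes the
  continuity of \<open>f\<close> at \<open>p\<close>.\<close>

definition chart_smooth_at ::
  "'m set \<Rightarrow> ('m \<Rightarrow> 'e::euclidean_space) \<Rightarrow> 'n set \<Rightarrow> ('n \<Rightarrow> 'f::euclidean_space)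
    \<Rightarrow> ('m \<Rightarrow> 'n) \<Rightarrow> 'm \<Rightarrow> bool" where
  "chart_smooth_at U \<phi> V \<psi> f p \<longleftrightarrow>
     (\<exists>A g. open A \<and> \<phi> p \<in> A \<and> (\<forall>k. Ck_open k g A) \<and>
        (\<forall>q\<in>U. \<phi> q \<in> A \<longrightarrow> f q \<in> V \<and> g (\<phi> q) = \<psi> (f q)))"

definition smooth_at ::
  "('m, 'e::euclidean_space) manifold \<Rightarrow> ('n, 'f::euclidean_space) manifold
    \<Rightarrow> 'm \<Rightarrow> ('m \<Rightarrow> 'n) \<Rightarrow> bool" where
  "smooth_at M N p f \<longleftrightarrow>
     (\<exists>(U, \<phi>)\<in>charts M. \<exists>(V, \<psi>)\<in>charts N. p \<in> U \<and> f p \<in> V \<and> chart_smooth_at U \<phi> V \<psi> f p)"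

text \<open>A smooth manifold up to the conditions on its topology: topologies of products and of images
  are identified first, by means of smooth maps, and only then seen to be Hausdorff and second
  countable.\<close>

definition atlas :: "('m, 'e::euclidean_space) manifold \<Rightarrow> bool" where
  "atlas M \<longleftrightarrow> subspace (model M) \<and> points M = (\<Union>(U, \<phi>)\<in>charts M. U) \<and>
     (\<forall>(U, \<phi>)\<in>charts M. inj_on \<phi> U \<and> openin (top_of_set (model M)) (\<phi> ` U)) \<and>
     (\<forall>(U, \<phi>)\<in>charts M. \<forall>(V, \<psi>)\<in>charts M. \<forall>p\<in>U \<inter> V. chart_smooth_at U \<phi> V \<psi> (\<lambda>x. x) p)"

lemma openin_top_of_set_iff:
  "openin (top_of_set E) S \<longleftrightarrow> S \<subseteq> E \<and> (\<forall>x\<in>S. \<exists>A. open A \<and> x \<in> A \<and> A \<inter> E \<subseteq> S)"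
proof
  assume "openin (top_of_set E) S"
  then show "S \<subseteq> E \<and> (\<forall>x\<in>S. \<exists>A. open A \<and> x \<in> A \<and> A \<inter> E \<subseteq> S)"
    unfolding openin_open by blast
next
  assume R: "S \<subseteq> E \<and> (\<forall>x\<in>S. \<exists>A. open A \<and> x \<in> A \<and> A \<inter> E \<subseteq> S)"
  have "\<exists>T. openin (top_of_set E) T \<and> x \<in> T \<and> T \<subseteq> S" if x: "x \<in> S" for x
  proof -
    obtain A where A: "open A" "x \<in> A" "A \<inter> E \<subseteq> S" using R x by blast
    then show ?thesis using R x by (intro exI[of _ "E \<inter> A"]) (auto intro: openin_open_Int)
  qed
  then show "openin (top_of_set E) S" by (subst openin_subopen) blast
qed

lemma chart_smooth_atE:
  assumes "chart_smooth_at U \<phi> V \<psi> f p"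
  obtains A g where "open A" "\<phi> p \<in> A" "\<And>k. Ck_open k g A"
    "\<And>q. q \<in> U \<Longrightarrow> \<phi> q \<in> A \<Longrightarrow> f q \<in> V" "\<And>q. q \<in> U \<Longrightarrow> \<phi> q \<in> A \<Longrightarrow> g (\<phi> q) = \<psi> (f q)"
  using assms unfolding chart_smooth_at_def by blast

lemma chart_smooth_atI:
  assumes "open A" "\<phi> p \<in> A" "\<And>k. Ck_open k g A"
    "\<And>q. q \<in> U \<Longrightarrow> \<phi> q \<in> A \<Longrightarrow> f q \<in> V" "\<And>q. q \<in> U \<Longrightarrow> \<phi> q \<in> A \<Longrightarrow> g (\<phi> q) = \<psi> (f q)"
  shows "chart_smooth_at U \<phi> V \<psi> f p"
  using assms unfolding chart_smooth_at_def by blast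

lemma chart_smooth_at_compose:
  assumes "chart_smooth_at U \<phi> V \<psi> f p" "chart_smooth_at V \<psi> X \<theta> g (f p)" "p \<in> U"
  shows "chart_smooth_at U \<phi> X \<theta> (\<lambda>x. g (f x)) p"
proof -
  obtain A a where A: "open A" "\<phi> p \<in> A" "\<And>k. Ck_open k a A"
    "\<And>q. q \<in> U \<Longrightarrow> \<phi> q \<in> A \<Longrightarrow> f q \<in> V" "\<And>q. q \<in> U \<Longrightarrow> \<phi> q \<in> A \<Longrightarrow> a (\<phi> q) = \<psi> (f q)"
    using assms(1) by (rule chart_smooth_atE) blast
  obtain B b where B: "open B" "\<psi> (f p) \<in> B" "\<And>k. Ck_open k b B"
    "\<And>q. q \<in> V \<Longrightarrow> \<psi> q \<in> B \<Longrightarrow> g q \<in> X" "\<And>q. q \<in> V \<Longrightarrow> \<psi> q \<in> B \<Longrightarrow> b (\<psi> q) = \<theta> (g q)"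
    using assms(2) by (rule chart_smooth_atE) blast
  have op: "open (A \<inter> a -` B)"
    using Ck_open_continuous[OF A(3)] A(1) B(1) by (rule continuous_open_preimage)
  show ?thesis
  proof (rule chart_smooth_atI[OF op])
    show "\<phi> p \<in> A \<inter> a -` B" using A B assms(3) by auto
    show "Ck_open k (\<lambda>x. b (a x)) (A \<inter> a -` B)" for k
      by (rule Ck_open_compose[OF op B(1) _ Ck_open_subset[OF A(3)] B(3)]) auto
  qed (use A B in auto)
qed

lemma chart_smooth_at_Pair:
  assumes "chart_smooth_at U \<phi> V \<psi> f p" "chart_smooth_at U \<phi> X \<theta> g p"
  shows "chart_smooth_at U \<phi> (V \<times> X) (map_prod \<psi> \<theta>) (\<lambda>x. (f x, g x)) p"
proof -
  obtain A a where A: "open A" "\<phi> p \<in> A" "\<And>k. Ck_open k a A"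
    "\<And>q. q \<in> U \<Longrightarrow> \<phi> q \<in> A \<Longrightarrow> f q \<in> V" "\<And>q. q \<in> U \<Longrightarrow> \<phi> q \<in> A \<Longrightarrow> a (\<phi> q) = \<psi> (f q)"
    using assms(1) by (rule chart_smooth_atE) blast
  obtain B b where B: "open B" "\<phi> p \<in> B" "\<And>k. Ck_open k b B"
    "\<And>q. q \<in> U \<Longrightarrow> \<phi> q \<in> B \<Longrightarrow> g q \<in> X" "\<And>q. q \<in> U \<Longrightarrow> \<phi> q \<in> B \<Longrightarrow> b (\<phi> q) = \<theta> (g q)"
    using assms(2) by (rule chart_smooth_atE) blast
  show ?thesis
  proof (rule chart_smooth_atI)
    show "Ck_open k (\<lambda>x. (a x, b x)) (A \<inter> B)" for k
      using A(1) B(1) by (intro Ck_open_Pair Ck_open_subset[OF A(3)] Ck_open_subset[OF B(3)]) auto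
  qed (use A B in auto)
qed

lemma chart_smooth_at_fst:
  "chart_smooth_at (U \<times> V) (map_prod \<phi> \<psi>) U \<phi> fst p"
  by (rule chart_smooth_atI[of UNIV _ _ fst]) (auto intro: Ck_open_linear bounded_linear_fst)

lemma chart_smooth_at_snd:
  "chart_smooth_at (U \<times> V) (map_prod \<phi> \<psi>) V \<psi> snd p"
  by (rule chart_smooth_atI[of UNIV _ _ snd]) (auto intro: Ck_open_linear bounded_linear_snd)

lemma atlasD:
  assumes "atlas M"
  shows "points M = (\<Union>(U, \<phi>)\<in>charts M. U)"
    and "(U, \<phi>) \<in> charts M \<Longrightarrow> inj_on \<phi> U"
    and "(U, \<phi>) \<in> charts M \<Longrightarrow> openin (top_of_set (model M)) (\<phi> ` U)"
    and "(U, \<phi>) \<in> charts M \<Longrightarrow> (V, \<psi>) \<in> charts M \<Longrightarrow> p \<in> U \<Longrightarrow> p \<in> V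
      \<Longrightarrow> chart_smooth_at U \<phi> V \<psi> (\<lambda>x. x) p"
    and "(U, \<phi>) \<in> charts M \<Longrightarrow> U \<subseteq> points M"
    and "(U, \<phi>) \<in> charts M \<Longrightarrow> q \<in> U \<Longrightarrow> \<phi> q \<in> model M"
proof -
  show "openin (top_of_set (model M)) (\<phi> ` U)" if "(U, \<phi>) \<in> charts M"
    using assms that unfolding atlas_def by blast
  then show "\<phi> q \<in> model M" if "(U, \<phi>) \<in> charts M" "q \<in> U"
    using that unfolding openin_top_of_set_iff by blast
qed (use assms in \<open>unfold atlas_def, blast+\<close>)

lemma chart_exists:
  assumes "atlas M" "p \<in> points M"
  obtains U \<phi> where "(U, \<phi>) \<in> charts M" "p \<in> U"
  using assms atlasD(1) by blast

text \<open>Near the coordinates of a common point, the smooth extension of the transition map pulls the open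
  set back to an open set, and the neighbourhood on which it is an extension consists of coordinates of
  common points.\<close>

lemma openin_chart_preimage:
  assumes M: "atlas M" and c: "(U, \<phi>) \<in> charts M" "(V, \<psi>) \<in> charts M" and A: "open A"
  shows "openin (top_of_set (model M)) (\<psi> ` (V \<inter> {q\<in>U. \<phi> q \<in> A}))"
  unfolding openin_top_of_set_iff
proof (intro conjI ballI)
  show "\<psi> ` (V \<inter> {q\<in>U. \<phi> q \<in> A}) \<subseteq> model M"
    using atlasD(6)[OF M c(2)] by auto
next
  fix y assume "y \<in> \<psi> ` (V \<inter> {q\<in>U. \<phi> q \<in> A})"
  then obtain q where q: "y = \<psi> q" "q \<in> V" "q \<in> U" "\<phi> q \<in> A" by auto
  obtain B b where B: "open B" "\<psi> q \<in> B" "\<And>k. Ck_open k b B"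
    "\<And>q. q \<in> V \<Longrightarrow> \<psi> q \<in> B \<Longrightarrow> q \<in> U" "\<And>q. q \<in> V \<Longrightarrow> \<psi> q \<in> B \<Longrightarrow> b (\<psi> q) = \<phi> q"
    using atlasD(4)[OF M c(2,1) q(2,3)] by (rule chart_smooth_atE) blast
  obtain C where C: "open C" "\<psi> q \<in> C" "C \<inter> model M \<subseteq> \<psi> ` V"
    using atlasD(3)[OF M c(2)] q(2) unfolding openin_top_of_set_iff by blast
  have "open ((B \<inter> b -` A) \<inter> C)"
    using continuous_open_preimage[OF Ck_open_continuous[OF B(3)] B(1) A] C(1) by blast
  moreover have "((B \<inter> b -` A) \<inter> C) \<inter> model M \<subseteq> \<psi> ` (V \<inter> {q\<in>U. \<phi> q \<in> A})"
    using B C by auto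
  ultimately show "\<exists>D. open D \<and> y \<in> D \<and> D \<inter> model M \<subseteq> \<psi> ` (V \<inter> {q\<in>U. \<phi> q \<in> A})"
    using q B C by (intro exI[of _ "(B \<inter> b -` A) \<inter> C"]) auto
qed

lemma openin_chart_Int:
  assumes "atlas M" "(U, \<phi>) \<in> charts M" "(V, \<psi>) \<in> charts M"
  shows "openin (top_of_set (model M)) (\<psi> ` (V \<inter> U))"
  using openin_chart_preimage[OF assms, of UNIV] by simp

lemma smooth_onD:
  assumes "smooth_on S f" "x \<in> S"
  obtains A g where "open A" "x \<in> A" "\<And>k. Ck_open k g A" "\<And>y. y \<in> S \<Longrightarrow> y \<in> A \<Longrightarrow> g y = f y"
proof -
  obtain A g where "open A" "x \<in> A" "\<forall>k. Ck_open k g A" "\<forall>y\<in>S \<inter> A. g y = f y"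
    using assms(1)[unfolded smooth_on_def, rule_format, OF assms(2)] by blast
  then show ?thesis using that[of A g] by auto
qed

lemma smooth_manifold_iff_atlas:
  "smooth_manifold M \<longleftrightarrow> atlas M \<and> Hausdorff_space (manifold_topology M) \<and>
     second_countable (manifold_topology M)"
proof -
  have "atlas M" if M: "smooth_manifold M"
    unfolding atlas_def
  proof (intro conjI ballI)
    show "subspace (model M)" "points M = (\<Union>(U, \<phi>)\<in>charts M. U)"
      using M by (auto simp: smooth_manifold_def)
  next
    fix c assume "c \<in> charts M"
    moreover obtain U \<phi> where c: "c = (U, \<phi>)" by (cases c)
    ultimately have "inj_on \<phi> U" "openin (top_of_set (model M)) (\<phi> ` (U \<inter> U))"
      using M unfolding smooth_manifold_def by blast+
    then show "case c of (U, \<phi>) \<Rightarrow> inj_on \<phi> U \<and> openin (top_of_set (model M)) (\<phi> ` U)"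
      by (simp add: c)
    have "chart_smooth_at U \<phi> V \<psi> (\<lambda>x. x) p"
      if V: "(V, \<psi>) \<in> charts M" and p: "p \<in> U" "p \<in> V" for V \<psi> p
    proof -
      have op: "openin (top_of_set (model M)) (\<phi> ` (U \<inter> V))"
        and sm: "smooth_on (\<phi> ` (U \<inter> V)) (\<psi> \<circ> inv_into U \<phi>)"
        using M V \<open>c \<in> charts M\<close> c unfolding smooth_manifold_def by blast+
      obtain A g where A: "open A" "\<phi> p \<in> A" "\<And>k. Ck_open k g A"
        "\<And>y. y \<in> \<phi> ` (U \<inter> V) \<Longrightarrow> y \<in> A \<Longrightarrow> g y = (\<psi> \<circ> inv_into U \<phi>) y"
        by (rule smooth_onD[OF sm, of "\<phi> p"]) (use p in auto)
      obtain B where B: "open B" "\<phi> p \<in> B" "B \<inter> model M \<subseteq> \<phi> ` (U \<inter> V)"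
        using op p unfolding openin_top_of_set_iff by blast
      have U: "\<phi> ` U \<subseteq> model M"
        using \<open>openin (top_of_set (model M)) (\<phi> ` (U \<inter> U))\<close>
        unfolding openin_top_of_set_iff by simp
      have V': "q \<in> V" if "q \<in> U" "\<phi> q \<in> B" for q
      proof -
        have "\<phi> q \<in> \<phi> ` (U \<inter> V)" using B(3) U that by blast
        then show ?thesis using \<open>inj_on \<phi> U\<close> that(1) by (auto dest: inj_onD)
      qed
      show ?thesis
      proof (rule chart_smooth_atI[of "A \<inter> B" _ _ g])
        show "Ck_open k g (A \<inter> B)" for k using A(3) by (rule Ck_open_subset) simp
        show "g (\<phi> q) = \<psi> q" if "q \<in> U" "\<phi> q \<in> A \<inter> B" for q
          using A(4)[of "\<phi> q"] V'[of q] that inv_into_f_f[OF \<open>inj_on \<phi> U\<close>] by auto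
      qed (use A B V' in auto)
    qed
    then show "case c of (U, \<phi>) \<Rightarrow>
        \<forall>(V, \<psi>)\<in>charts M. \<forall>p\<in>U \<inter> V. chart_smooth_at U \<phi> V \<psi> (\<lambda>x. x) p"
      by (auto simp: c)
  qed
  moreover have "openin (top_of_set (model M)) (\<phi> ` (U \<inter> V)) \<and>
      smooth_on (\<phi> ` (U \<inter> V)) (\<psi> \<circ> inv_into U \<phi>)"
    if M: "atlas M" and c: "(U, \<phi>) \<in> charts M" "(V, \<psi>) \<in> charts M" for U \<phi> V \<psi>
  proof
    show "openin (top_of_set (model M)) (\<phi> ` (U \<inter> V))" by (rule openin_chart_Int[OF M c(2,1)])
    show "smooth_on (\<phi> ` (U \<inter> V)) (\<psi> \<circ> inv_into U \<phi>)"
      unfolding smooth_on_def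
    proof safe
      fix q assume q: "q \<in> U" "q \<in> V"
      obtain A g where A: "open A" "\<phi> q \<in> A" "\<And>k. Ck_open k g A"
        "\<And>q. q \<in> U \<Longrightarrow> \<phi> q \<in> A \<Longrightarrow> g (\<phi> q) = \<psi> q"
        using atlasD(4)[OF M c q] by (rule chart_smooth_atE) blast
      show "\<exists>A g. open A \<and> \<phi> q \<in> A \<and> (\<forall>k. Ck_open k g A) \<and>
          (\<forall>y\<in>\<phi> ` (U \<inter> V) \<inter> A. g y = (\<psi> \<circ> inv_into U \<phi>) y)"
        using A inv_into_f_f[OF atlasD(2)[OF M c(1)]] by (intro exI[of _ A] exI[of _ g]) auto
    qed
  qed
  moreover have "subspace (model M)" "points M = (\<Union>(U, \<phi>)\<in>charts M. U)"
    "\<forall>(U, \<phi>)\<in>charts M. inj_on \<phi> U" if "atlas M"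
    using that unfolding atlas_def by auto
  ultimately show ?thesis unfolding smooth_manifold_def by blast
qed

lemma openin_atlas_topology:
  assumes M: "atlas M"
  shows "openin (manifold_topology M) W \<longleftrightarrow> W \<subseteq> points M \<and>
     (\<forall>(U, \<phi>)\<in>charts M. openin (top_of_set (model M)) (\<phi> ` (U \<inter> W)))"
proof -
  let ?P = "\<lambda>W. W \<subseteq> points M \<and>
     (\<forall>(U, \<phi>)\<in>charts M. openin (top_of_set (model M)) (\<phi> ` (U \<inter> W)))"
  have "istopology ?P"
    unfolding istopology_def
  proof (rule conjI; intro allI; rule impI; (rule impI)?)
    fix S T assume S: "?P S" and T: "?P T"
    have "openin (top_of_set (model M)) (\<phi> ` (U \<inter> (S \<inter> T)))" if c: "(U, \<phi>) \<in> charts M" for U \<phi>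
    proof -
      have "\<phi> ` (U \<inter> (S \<inter> T)) = \<phi> ` (U \<inter> S) \<inter> \<phi> ` (U \<inter> T)"
        using atlasD(2)[OF M c] by (auto simp: inj_on_def)
      then show ?thesis using S T c by auto
    qed
    then show "?P (S \<inter> T)" using S by auto
  next
    fix K assume K: "\<forall>S\<in>K. ?P S"
    have "openin (top_of_set (model M)) (\<phi> ` (U \<inter> \<Union>K))" if c: "(U, \<phi>) \<in> charts M" for U \<phi>
    proof -
      have "\<phi> ` (U \<inter> \<Union>K) = (\<Union>S\<in>K. \<phi> ` (U \<inter> S))" by auto
      moreover have "openin (top_of_set (model M)) (\<phi> ` (U \<inter> S))" if "S \<in> K" for S
        using K c that by blast
      ultimately show ?thesis by auto
    qed
    then show "?P (\<Union>K)" using K by auto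
  qed
  then show ?thesis by (simp add: manifold_topology_def topology_inverse')
qed

lemma openin_manifold_nhds:
  assumes M: "atlas M" and c: "(U, \<phi>) \<in> charts M" and A: "open A"
  shows "openin (manifold_topology M) {q\<in>U. \<phi> q \<in> A}"
  using openin_chart_preimage[OF M c _ A] atlasD(5)[OF M c]
  by (auto simp: openin_atlas_topology[OF M])

lemma openin_chart_domain:
  assumes "atlas M" "(U, \<phi>) \<in> charts M"
  shows "openin (manifold_topology M) U"
  using openin_manifold_nhds[OF assms, of UNIV] by simp

lemma topspace_manifold_topology:
  assumes M: "atlas M" shows "topspace (manifold_topology M) = points M"
proof
  show "topspace (manifold_topology M) \<subseteq> points M"
    using openin_topspace openin_atlas_topology[OF M] by blast
  show "points M \<subseteq> topspace (manifold_topology M)"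
    using openin_chart_domain[OF M] atlasD(1)[OF M] openin_subset by fastforce
qed

lemma openin_chart_nhdE:
  assumes M: "atlas M" and W: "openin (manifold_topology M) W" and c: "(U, \<phi>) \<in> charts M"
    and p: "p \<in> U" "p \<in> W"
  obtains A where "open A" "\<phi> p \<in> A" "\<And>q. q \<in> U \<Longrightarrow> \<phi> q \<in> A \<Longrightarrow> q \<in> W"
    "A \<inter> model M \<subseteq> \<phi> ` (U \<inter> W)"
proof -
  have "openin (top_of_set (model M)) (\<phi> ` (U \<inter> W))"
    using W c unfolding openin_atlas_topology[OF M] by blast
  then obtain A where A: "open A" "\<phi> p \<in> A" "A \<inter> model M \<subseteq> \<phi> ` (U \<inter> W)"
    using p unfolding openin_top_of_set_iff by blast
  moreover have "q \<in> W" if "q \<in> U" "\<phi> q \<in> A" for q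
  proof -
    have "\<phi> q \<in> \<phi> ` (U \<inter> W)" using A(3) atlasD(6)[OF M c that(1)] that(2) by blast
    then show ?thesis using atlasD(2)[OF M c] that(1) by (auto dest: inj_onD)
  qed
  ultimately show ?thesis using that by blast
qed

text \<open>Transition maps are identity maps read in two charts, so changing charts is a composition.\<close>

lemma smooth_atD:
  assumes M: "atlas M" and N: "atlas N" and f: "smooth_at M N p f"
    and c: "(U, \<phi>) \<in> charts M" "p \<in> U" "(V, \<psi>) \<in> charts N" "f p \<in> V"
  shows "chart_smooth_at U \<phi> V \<psi> f p"
proof -
  obtain U' \<phi>' V' \<psi>' where c': "(U', \<phi>') \<in> charts M" "(V', \<psi>') \<in> charts N" "p \<in> U'" "f p \<in> V'"
    "chart_smooth_at U' \<phi>' V' \<psi>' f p"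
    using f unfolding smooth_at_def by blast
  have "chart_smooth_at U \<phi> V' \<psi>' f p"
    using chart_smooth_at_compose[OF atlasD(4)[OF M c(1) c'(1)] c'(5)] c c' by simp
  then show ?thesis
    using chart_smooth_at_compose[OF _ atlasD(4)[OF N c'(2) c(3)], of U \<phi> f p] c c' by simp
qed

lemma smooth_atI:
  "(U, \<phi>) \<in> charts M \<Longrightarrow> p \<in> U \<Longrightarrow> (V, \<psi>) \<in> charts N \<Longrightarrow> f p \<in> V
    \<Longrightarrow> chart_smooth_at U \<phi> V \<psi> f p \<Longrightarrow> smooth_at M N p f"
  unfolding smooth_at_def by blast

lemma smooth_at_points:
  assumes "atlas M" "atlas N" "smooth_at M N p f"
  shows "p \<in> points M" "f p \<in> points N"
  using assms(3) atlasD(5)[OF assms(1)] atlasD(5)[OF assms(2)] unfolding smooth_at_def by blast+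

lemma smooth_at_compose:
  assumes M: "atlas M" and N: "atlas N" and L: "atlas L"
    and f: "smooth_at M N p f" and g: "smooth_at N L (f p) g"
  shows "smooth_at M L p (\<lambda>x. g (f x))"
proof -
  obtain U \<phi> where U: "(U, \<phi>) \<in> charts M" "p \<in> U"
    using chart_exists[OF M smooth_at_points(1)[OF M N f]] .
  obtain V \<psi> where V: "(V, \<psi>) \<in> charts N" "f p \<in> V"
    using chart_exists[OF N smooth_at_points(2)[OF M N f]] .
  obtain X \<theta> where X: "(X, \<theta>) \<in> charts L" "g (f p) \<in> X"
    using chart_exists[OF L smooth_at_points(2)[OF N L g]] .
  show ?thesis
    using chart_smooth_at_compose[OF smooth_atD[OF M N f U V] smooth_atD[OF N L g V X] U(2)] U X
    by (intro smooth_atI)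
qed

lemma smooth_at_ident:
  assumes "atlas M" "p \<in> points M" shows "smooth_at M M p (\<lambda>x. x)"
  using assms chart_exists[OF assms] atlasD(4)[OF assms(1)] smooth_atI by metis

lemma smooth_at_const:
  assumes M: "atlas M" "p \<in> points M" and N: "atlas N" "q \<in> points N"
  shows "smooth_at M N p (\<lambda>x. q)"
proof -
  obtain U \<phi> where U: "(U, \<phi>) \<in> charts M" "p \<in> U" using chart_exists[OF M] .
  obtain V \<psi> where V: "(V, \<psi>) \<in> charts N" "q \<in> V" using chart_exists[OF N] .
  show ?thesis
    by (rule smooth_atI[OF U V(1)])
      (use V in \<open>auto intro!: chart_smooth_atI[of UNIV _ _ "\<lambda>_. \<psi> q"] Ck_open_const\<close>)
qed

lemma smooth_at_cong_open:
  assumes M: "atlas M" and f: "smooth_at M N p f"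
    and W: "openin (manifold_topology M) W" "p \<in> W" and eq: "\<And>q. q \<in> W \<Longrightarrow> f q = g q"
  shows "smooth_at M N p g"
proof -
  obtain U \<phi> V \<psi> where c: "(U, \<phi>) \<in> charts M" "(V, \<psi>) \<in> charts N" "p \<in> U" "f p \<in> V"
    "chart_smooth_at U \<phi> V \<psi> f p"
    using f unfolding smooth_at_def by blast
  obtain A a where A: "open A" "\<phi> p \<in> A" "\<And>k. Ck_open k a A"
    "\<And>q. q \<in> U \<Longrightarrow> \<phi> q \<in> A \<Longrightarrow> f q \<in> V" "\<And>q. q \<in> U \<Longrightarrow> \<phi> q \<in> A \<Longrightarrow> a (\<phi> q) = \<psi> (f q)"
    using c(5) by (rule chart_smooth_atE) blast
  obtain B where B: "open B" "\<phi> p \<in> B" "\<And>q. q \<in> U \<Longrightarrow> \<phi> q \<in> B \<Longrightarrow> q \<in> W"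
    by (rule openin_chart_nhdE[OF M W(1) c(1,3) W(2)]) blast
  have "chart_smooth_at U \<phi> V \<psi> g p"
  proof (rule chart_smooth_atI[of "A \<inter> B" _ _ a])
    show "Ck_open k a (A \<inter> B)" for k using A(3) by (rule Ck_open_subset) simp
  qed (use A B eq[symmetric] in auto)
  then show ?thesis using c eq[OF W(2)] by (intro smooth_atI[OF c(1,3,2)]) auto
qed

lemma openin_points:
  "atlas M \<Longrightarrow> openin (manifold_topology M) (points M)"
  using topspace_manifold_topology openin_topspace by metis

lemma smooth_at_cong:
  assumes "atlas M" "p \<in> points M" "\<And>q. q \<in> points M \<Longrightarrow> f q = g q"
  shows "smooth_at M N p f \<longleftrightarrow> smooth_at M N p g"
  using smooth_at_cong_open[OF assms(1) _ openin_points[OF assms(1)] assms(2), of N] assms(3) by metis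

lemma smooth_at_open:
  assumes M: "atlas M" and N: "atlas N" and f: "smooth_at M N p f"
  obtains W where "openin (manifold_topology M) W" "p \<in> W" "\<And>q. q \<in> W \<Longrightarrow> smooth_at M N q f"
proof -
  obtain U \<phi> V \<psi> where c: "(U, \<phi>) \<in> charts M" "(V, \<psi>) \<in> charts N" "p \<in> U" "f p \<in> V"
    "chart_smooth_at U \<phi> V \<psi> f p"
    using f unfolding smooth_at_def by blast
  obtain A a where A: "open A" "\<phi> p \<in> A" "\<And>k. Ck_open k a A"
    "\<And>q. q \<in> U \<Longrightarrow> \<phi> q \<in> A \<Longrightarrow> f q \<in> V" "\<And>q. q \<in> U \<Longrightarrow> \<phi> q \<in> A \<Longrightarrow> a (\<phi> q) = \<psi> (f q)"
    using c(5) by (rule chart_smooth_atE) blast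
  have "smooth_at M N q f" if q: "q \<in> {q\<in>U. \<phi> q \<in> A}" for q
  proof -
    have "chart_smooth_at U \<phi> V \<psi> f q" by (rule chart_smooth_atI[of A]) (use A q in auto)
    then show ?thesis using A(4) q by (intro smooth_atI[OF c(1) _ c(2)]) auto
  qed
  moreover have "openin (manifold_topology M) {q\<in>U. \<phi> q \<in> A}"
    by (rule openin_manifold_nhds[OF M c(1) A(1)])
  ultimately show ?thesis using that c(3) A(2) by blast
qed

lemma smooth_at_open_preimage:
  assumes M: "atlas M" and N: "atlas N" and f: "smooth_at M N p f"
    and Y: "openin (manifold_topology N) Y" "f p \<in> Y"
  obtains W where "openin (manifold_topology M) W" "p \<in> W" "\<And>q. q \<in> W \<Longrightarrow> f q \<in> Y"
proof -
  obtain U \<phi> V \<psi> where c: "(U, \<phi>) \<in> charts M" "(V, \<psi>) \<in> charts N" "p \<in> U" "f p \<in> V"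
    "chart_smooth_at U \<phi> V \<psi> f p"
    using f unfolding smooth_at_def by blast
  obtain A a where A: "open A" "\<phi> p \<in> A" "\<And>k. Ck_open k a A"
    "\<And>q. q \<in> U \<Longrightarrow> \<phi> q \<in> A \<Longrightarrow> f q \<in> V" "\<And>q. q \<in> U \<Longrightarrow> \<phi> q \<in> A \<Longrightarrow> a (\<phi> q) = \<psi> (f q)"
    using c(5) by (rule chart_smooth_atE) blast
  obtain B where B: "open B" "\<psi> (f p) \<in> B" "\<And>q. q \<in> V \<Longrightarrow> \<psi> q \<in> B \<Longrightarrow> q \<in> Y"
    by (rule openin_chart_nhdE[OF N Y(1) c(2,4) Y(2)]) blast
  have "open (A \<inter> a -` B)"
    by (rule continuous_open_preimage[OF Ck_open_continuous[OF A(3)] A(1) B(1)])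
  then have "openin (manifold_topology M) {q\<in>U. \<phi> q \<in> A \<inter> a -` B}"
    by (rule openin_manifold_nhds[OF M c(1)])
  then show ?thesis
  proof (rule that)
    show "p \<in> {q\<in>U. \<phi> q \<in> A \<inter> a -` B}" using A B c by auto
    show "f q \<in> Y" if "q \<in> {q\<in>U. \<phi> q \<in> A \<inter> a -` B}" for q
      using that A(4,5)[of q] B(3)[of "f q"] by auto
  qed
qed

lemma smooth_map_iff_smooth_at:
  assumes M: "atlas M" and N: "atlas N"
  shows "smooth_map M N f \<longleftrightarrow> (\<forall>p\<in>points M. smooth_at M N p f)"
proof
  assume f: "smooth_map M N f"
  then have cont: "continuous_map (manifold_topology M) (manifold_topology N) f"
    by (simp add: smooth_map_def)
  show "\<forall>p\<in>points M. smooth_at M N p f"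
  proof
    fix p assume p: "p \<in> points M"
    then have "f p \<in> points N"
      using continuous_map_image_subset_topspace[OF cont]
      unfolding topspace_manifold_topology[OF M] topspace_manifold_topology[OF N] by blast
    then obtain V \<psi> where V: "(V, \<psi>) \<in> charts N" "f p \<in> V" using chart_exists[OF N] by blast
    obtain U \<phi> where U: "(U, \<phi>) \<in> charts M" "p \<in> U" using chart_exists[OF M p] .
    have inj: "inj_on \<phi> U" by (rule atlasD(2)[OF M U(1)])
    have "smooth_on (\<phi> ` (U \<inter> f -` V)) (\<psi> \<circ> f \<circ> inv_into U \<phi>)"
      using f U(1) V(1) unfolding smooth_map_def by blast
    then obtain A g where A: "open A" "\<phi> p \<in> A" "\<And>k. Ck_open k g A"
      "\<And>y. y \<in> \<phi> ` (U \<inter> f -` V) \<Longrightarrow> y \<in> A \<Longrightarrow> g y = (\<psi> \<circ> f \<circ> inv_into U \<phi>) y"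
      by (rule smooth_onD[of _ _ "\<phi> p"]) (use U V in auto)
    have "openin (manifold_topology M) {q \<in> topspace (manifold_topology M). f q \<in> V}"
      using cont openin_chart_domain[OF N V(1)] by (rule openin_continuous_map_preimage)
    moreover have "p \<in> {q \<in> topspace (manifold_topology M). f q \<in> V}"
      using V(2) p topspace_manifold_topology[OF M] by simp
    ultimately obtain B where B: "open B" "\<phi> p \<in> B"
      "\<And>q. q \<in> U \<Longrightarrow> \<phi> q \<in> B \<Longrightarrow> q \<in> {q \<in> topspace (manifold_topology M). f q \<in> V}"
      by (rule openin_chart_nhdE[OF M _ U]) blast
    have "chart_smooth_at U \<phi> V \<psi> f p"
    proof (rule chart_smooth_atI[of "A \<inter> B" _ _ g])
      show "Ck_open k g (A \<inter> B)" for k using A(3) by (rule Ck_open_subset) simp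
      show "g (\<phi> q) = \<psi> (f q)" if "q \<in> U" "\<phi> q \<in> A \<inter> B" for q
        using A(4)[of "\<phi> q"] B(3)[of q] that inv_into_f_f[OF inj] by auto
    qed (use A B in auto)
    then show "smooth_at M N p f" using U V by (intro smooth_atI)
  qed
next
  assume f: "\<forall>p\<in>points M. smooth_at M N p f"
  show "smooth_map M N f"
    unfolding smooth_map_def
  proof (intro conjI)
    show "continuous_map (manifold_topology M) (manifold_topology N) f"
      unfolding continuous_map topspace_manifold_topology[OF M] topspace_manifold_topology[OF N]
    proof (intro conjI allI impI)
      show "f ` points M \<subseteq> points N" using f smooth_at_points(2)[OF M N] by blast
      fix Y assume Y: "openin (manifold_topology N) Y"
      show "openin (manifold_topology M) {x \<in> points M. f x \<in> Y}"
      proof (subst openin_subopen, intro ballI)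
        fix p assume p: "p \<in> {x \<in> points M. f x \<in> Y}"
        then obtain W where W: "openin (manifold_topology M) W" "p \<in> W" "\<And>q. q \<in> W \<Longrightarrow> f q \<in> Y"
          using smooth_at_open_preimage[OF M N _ Y] f by blast
        have "W \<subseteq> points M" using openin_subset[OF W(1)] topspace_manifold_topology[OF M] by simp
        then show "\<exists>T. openin (manifold_topology M) T \<and> p \<in> T \<and> T \<subseteq> {x \<in> points M. f x \<in> Y}"
          using W by blast
      qed
    qed
    have "smooth_on (\<phi> ` (U \<inter> f -` V)) (\<psi> \<circ> f \<circ> inv_into U \<phi>)"
      if U: "(U, \<phi>) \<in> charts M" and V: "(V, \<psi>) \<in> charts N" for U \<phi> V \<psi>
      unfolding smooth_on_def
    proof safe
      fix p assume p: "p \<in> U" "f p \<in> V"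
      have "smooth_at M N p f" using f p atlasD(5)[OF M U] by blast
      from smooth_atD[OF M N this U p(1) V p(2)] obtain A a where A: "open A" "\<phi> p \<in> A"
        "\<And>k. Ck_open k a A" "\<And>q. q \<in> U \<Longrightarrow> \<phi> q \<in> A \<Longrightarrow> a (\<phi> q) = \<psi> (f q)"
        by (rule chart_smooth_atE) blast
      show "\<exists>A g. open A \<and> \<phi> p \<in> A \<and> (\<forall>k. Ck_open k g A) \<and>
          (\<forall>y\<in>\<phi> ` (U \<inter> f -` V) \<inter> A. g y = (\<psi> \<circ> f \<circ> inv_into U \<phi>) y)"
        using A inv_into_f_f[OF atlasD(2)[OF M U]] by (intro exI[of _ A] exI[of _ a]) auto
    qed
    then show "\<forall>(U, \<phi>)\<in>charts M. \<forall>(V, \<psi>)\<in>charts N.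
        smooth_on (\<phi> ` (U \<inter> f -` V)) (\<psi> \<circ> f \<circ> inv_into U \<phi>)"
      by blast
  qed
qed

subsection \<open>Products\<close>

lemma charts_prodI:
  "(U, \<phi>) \<in> charts M \<Longrightarrow> (V, \<psi>) \<in> charts N
    \<Longrightarrow> (U \<times> V, map_prod \<phi> \<psi>) \<in> charts (manifold_prod M N)"
  by (auto simp: manifold_prod_def)

lemma charts_prodE:
  assumes "(X, \<theta>) \<in> charts (manifold_prod M N)"
  obtains U \<phi> V \<psi> where "(U, \<phi>) \<in> charts M" "(V, \<psi>) \<in> charts N" "X = U \<times> V" "\<theta> = map_prod \<phi> \<psi>"
  using assms by (auto simp: manifold_prod_def)

lemma atlas_prod:
  assumes M: "atlas M" and N: "atlas N"
  shows "atlas (manifold_prod M N)"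
  unfolding atlas_def
proof (intro conjI ballI)
  show "subspace (model (manifold_prod M N))"
    using M N by (auto simp: manifold_prod_def atlas_def intro: subspace_Times)
  show "points (manifold_prod M N) = (\<Union>(U, \<phi>)\<in>charts (manifold_prod M N). U)"
    unfolding manifold_prod_def using atlasD(1)[OF M] atlasD(1)[OF N] by force
next
  fix c assume "c \<in> charts (manifold_prod M N)"
  moreover obtain X \<theta> where c: "c = (X, \<theta>)" by (cases c)
  ultimately obtain U \<phi> V \<psi> where X: "(U, \<phi>) \<in> charts M" "(V, \<psi>) \<in> charts N"
    "X = U \<times> V" "\<theta> = map_prod \<phi> \<psi>"
    by (auto elim: charts_prodE)
  have "map_prod \<phi> \<psi> ` (U \<times> V) = \<phi> ` U \<times> \<psi> ` V" by (simp add: map_prod_image)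
  then show "case c of (U, \<phi>) \<Rightarrow> inj_on \<phi> U \<and>
      openin (top_of_set (model (manifold_prod M N))) (\<phi> ` U)"
    using atlasD(2,3)[OF M X(1)] atlasD(2,3)[OF N X(2)]
    by (auto simp: c X(3,4) manifold_prod_def intro: map_prod_inj_on openin_Times)
  have "chart_smooth_at X \<theta> X' \<theta>' (\<lambda>x. x) r"
    if X': "(X', \<theta>') \<in> charts (manifold_prod M N)" and r: "r \<in> X" "r \<in> X'" for X' \<theta>' r
  proof -
    obtain U' \<phi>' V' \<psi>' where c': "(U', \<phi>') \<in> charts M" "(V', \<psi>') \<in> charts N"
      "X' = U' \<times> V'" "\<theta>' = map_prod \<phi>' \<psi>'"
      using X' by (elim charts_prodE)
    have "chart_smooth_at X \<theta> U' \<phi>' fst r" "chart_smooth_at X \<theta> V' \<psi>' snd r"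
      using chart_smooth_at_compose[OF chart_smooth_at_fst[of U V \<phi> \<psi>] atlasD(4)[OF M X(1) c'(1)]]
        chart_smooth_at_compose[OF chart_smooth_at_snd[of U V \<phi> \<psi>] atlasD(4)[OF N X(2) c'(2)]]
        r X c' by auto
    from chart_smooth_at_Pair[OF this] show ?thesis using c' by simp
  qed
  then show "case c of (U, \<phi>) \<Rightarrow> \<forall>(V, \<psi>)\<in>charts (manifold_prod M N).
      \<forall>p\<in>U \<inter> V. chart_smooth_at U \<phi> V \<psi> (\<lambda>x. x) p"
    by (auto simp: c)
qed

lemma smooth_at_Pair:
  assumes M: "atlas M" and N: "atlas N" and L: "atlas L"
    and f: "smooth_at M N p f" and g: "smooth_at M L p g"
  shows "smooth_at M (manifold_prod N L) p (\<lambda>x. (f x, g x))"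
proof -
  obtain U \<phi> where U: "(U, \<phi>) \<in> charts M" "p \<in> U"
    using chart_exists[OF M smooth_at_points(1)[OF M N f]] .
  obtain V \<psi> where V: "(V, \<psi>) \<in> charts N" "f p \<in> V"
    using chart_exists[OF N smooth_at_points(2)[OF M N f]] .
  obtain X \<theta> where X: "(X, \<theta>) \<in> charts L" "g p \<in> X"
    using chart_exists[OF L smooth_at_points(2)[OF M L g]] .
  show ?thesis
    by (rule smooth_atI[OF U charts_prodI[OF V(1) X(1)]])
      (use U V X smooth_atD[OF M N f] smooth_atD[OF M L g] in \<open>auto intro: chart_smooth_at_Pair\<close>)
qed

lemma smooth_at_prod_fst:
  assumes M: "atlas M" and N: "atlas N" and r: "r \<in> points M \<times> points N"
  shows "smooth_at (manifold_prod M N) M r fst"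
proof -
  obtain U \<phi> V \<psi> where "(U, \<phi>) \<in> charts M" "fst r \<in> U" "(V, \<psi>) \<in> charts N" "snd r \<in> V"
    using r chart_exists[OF M] chart_exists[OF N] by (metis mem_Times_iff)
  then show ?thesis
    by (intro smooth_atI[OF charts_prodI]) (auto simp: mem_Times_iff chart_smooth_at_fst)
qed

lemma smooth_at_prod_snd:
  assumes M: "atlas M" and N: "atlas N" and r: "r \<in> points M \<times> points N"
  shows "smooth_at (manifold_prod M N) N r snd"
proof -
  obtain U \<phi> V \<psi> where "(U, \<phi>) \<in> charts M" "fst r \<in> U" "(V, \<psi>) \<in> charts N" "snd r \<in> V"
    using r chart_exists[OF M] chart_exists[OF N] by (metis mem_Times_iff)
  then show ?thesis
    by (intro smooth_atI[OF charts_prodI]) (auto simp: mem_Times_iff chart_smooth_at_snd)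
qed

lemma points_manifold_prod [simp]: "points (manifold_prod M N) = points M \<times> points N"
  by (simp add: manifold_prod_def)

lemma smooth_at_fst:
  assumes "atlas L" "atlas M" "atlas N" "smooth_at L (manifold_prod M N) p f"
  shows "smooth_at L M p (\<lambda>x. fst (f x))"
  using assms smooth_at_points(2)[OF assms(1) atlas_prod[OF assms(2,3)] assms(4)]
  by (intro smooth_at_compose[OF assms(1) atlas_prod assms(2,4)] smooth_at_prod_fst) auto

lemma smooth_at_snd:
  assumes "atlas L" "atlas M" "atlas N" "smooth_at L (manifold_prod M N) p f"
  shows "smooth_at L N p (\<lambda>x. snd (f x))"
  using assms smooth_at_points(2)[OF assms(1) atlas_prod[OF assms(2,3)] assms(4)]
  by (intro smooth_at_compose[OF assms(1) atlas_prod assms(3,4)] smooth_at_prod_snd) auto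

lemma manifold_topology_prod:
  assumes M: "atlas M" and N: "atlas N"
  shows "manifold_topology (manifold_prod M N) =
    prod_topology (manifold_topology M) (manifold_topology N)"
proof -
  note MN = atlas_prod[OF M N]
  have "openin (manifold_topology (manifold_prod M N)) W \<longleftrightarrow>
      openin (prod_topology (manifold_topology M) (manifold_topology N)) W" for W
  proof
    assume W: "openin (manifold_topology (manifold_prod M N)) W"
    show "openin (prod_topology (manifold_topology M) (manifold_topology N)) W"
      unfolding openin_prod_topology_alt
    proof (intro allI impI)
      fix p q assume pq: "(p, q) \<in> W"
      then have "p \<in> points M" "q \<in> points N"
        using openin_subset[OF W] by (auto simp: topspace_manifold_topology[OF MN])
      then obtain U \<phi> V \<psi> where c: "(U, \<phi>) \<in> charts M" "p \<in> U" "(V, \<psi>) \<in> charts N" "q \<in> V"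
        using chart_exists[OF M] chart_exists[OF N] by metis
      obtain A where A: "open A" "map_prod \<phi> \<psi> (p, q) \<in> A"
        "\<And>r. r \<in> U \<times> V \<Longrightarrow> map_prod \<phi> \<psi> r \<in> A \<Longrightarrow> r \<in> W"
        by (rule openin_chart_nhdE[OF MN W charts_prodI[OF c(1,3)] _ pq]) (use c in auto)
      obtain B C where BC: "open B" "open C" "\<phi> p \<in> B" "\<psi> q \<in> C" "B \<times> C \<subseteq> A"
        using A(1,2) open_prod_elim by (metis map_prod_simp mem_Sigma_iff)
      show "\<exists>S T. openin (manifold_topology M) S \<and> openin (manifold_topology N) T \<and>
          p \<in> S \<and> q \<in> T \<and> S \<times> T \<subseteq> W"
        using openin_manifold_nhds[OF M c(1) BC(1)] openin_manifold_nhds[OF N c(3) BC(2)] c BC A(3)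
        by (intro exI[of _ "{q\<in>U. \<phi> q \<in> B}"] exI[of _ "{q\<in>V. \<psi> q \<in> C}"]) auto
    qed
  next
    assume W: "openin (prod_topology (manifold_topology M) (manifold_topology N)) W"
    have "\<forall>r\<in>points M \<times> points N. smooth_at (manifold_prod M N) M r fst"
      "\<forall>r\<in>points M \<times> points N. smooth_at (manifold_prod M N) N r snd"
      using smooth_at_prod_fst[OF M N] smooth_at_prod_snd[OF M N] by auto
    then have "smooth_map (manifold_prod M N) M fst" "smooth_map (manifold_prod M N) N snd"
      by (simp_all add: smooth_map_iff_smooth_at M N MN)
    then have "continuous_map (manifold_topology (manifold_prod M N))
        (prod_topology (manifold_topology M) (manifold_topology N)) (\<lambda>x. (fst x, snd x))"
      by (intro continuous_map_pairedI) (auto simp: smooth_map_def)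
    then have "openin (manifold_topology (manifold_prod M N))
        {x \<in> topspace (manifold_topology (manifold_prod M N)). (fst x, snd x) \<in> W}"
      using W by (rule openin_continuous_map_preimage)
    moreover have "W \<subseteq> points M \<times> points N"
      using openin_subset[OF W]
      by (simp add: topspace_manifold_topology[OF M] topspace_manifold_topology[OF N])
    then have "{x \<in> topspace (manifold_topology (manifold_prod M N)). (fst x, snd x) \<in> W} = W"
      by (auto simp: topspace_manifold_topology[OF MN])
    ultimately show "openin (manifold_topology (manifold_prod M N)) W" by simp
  qed
  then show ?thesis by (simp add: topology_eq)
qed

lemma second_countable_prod_topology:
  assumes "second_countable X" "second_countable Y"
  shows "second_countable (prod_topology X Y)"
proof -
  obtain \<B> where B: "countable \<B>" "\<And>V. V \<in> \<B> \<Longrightarrow> openin X V"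
    "\<And>U x. openin X U \<Longrightarrow> x \<in> U \<Longrightarrow> \<exists>V\<in>\<B>. x \<in> V \<and> V \<subseteq> U"
    using assms(1) unfolding second_countable_def by metis
  obtain \<C> where C: "countable \<C>" "\<And>V. V \<in> \<C> \<Longrightarrow> openin Y V"
    "\<And>U x. openin Y U \<Longrightarrow> x \<in> U \<Longrightarrow> \<exists>V\<in>\<C>. x \<in> V \<and> V \<subseteq> U"
    using assms(2) unfolding second_countable_def by metis
  show ?thesis
    unfolding second_countable_def
  proof (intro exI[of _ "(\<lambda>(S, T). S \<times> T) ` (\<B> \<times> \<C>)"] conjI ballI allI impI)
    show "countable ((\<lambda>(S, T). S \<times> T) ` (\<B> \<times> \<C>))" using B(1) C(1) by simp
    show "openin (prod_topology X Y) V" if "V \<in> (\<lambda>(S, T). S \<times> T) ` (\<B> \<times> \<C>)" for V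
      using that B(2) C(2) by (auto simp: openin_prod_Times_iff)
    fix U z assume "openin (prod_topology X Y) U \<and> z \<in> U"
    then obtain S T where "openin X S" "openin Y T" "fst z \<in> S" "snd z \<in> T" "S \<times> T \<subseteq> U"
      unfolding openin_prod_topology_alt by (metis prod.collapse)
    moreover obtain S' where "S' \<in> \<B>" "fst z \<in> S'" "S' \<subseteq> S" using B(3) calculation by blast
    moreover obtain T' where "T' \<in> \<C>" "snd z \<in> T'" "T' \<subseteq> T" using C(3) calculation by blast
    ultimately show "\<exists>V\<in>(\<lambda>(S, T). S \<times> T) ` (\<B> \<times> \<C>). z \<in> V \<and> V \<subseteq> U"
      by (intro bexI[of _ "S' \<times> T'"]) (auto simp: mem_Times_iff)
  qed
qed

lemma smooth_manifold_prod:
  assumes "smooth_manifold M" "smooth_manifold N"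
  shows "smooth_manifold (manifold_prod M N)"
  using assms
  by (simp add: smooth_manifold_iff_atlas atlas_prod manifold_topology_prod
      Hausdorff_space_prod_topology second_countable_prod_topology)

subsection \<open>Euclidean spaces as manifolds\<close>

definition euclid :: "('a::euclidean_space, 'a) manifold" where
  "euclid = \<lparr>points = UNIV, model = UNIV, charts = {(UNIV, \<lambda>x. x)}\<rparr>"

lemma real_line_eq_euclid: "real_line = euclid"
  by (simp add: real_line_def euclid_def)

lemma points_euclid [simp]: "points euclid = UNIV"
  by (simp add: euclid_def)

lemma smooth_at_euclid_iff:
  "smooth_at euclid euclid p f \<longleftrightarrow> (\<exists>A. open A \<and> p \<in> A \<and> (\<forall>k. Ck_open k f A))"
proof
  assume "smooth_at euclid euclid p f"
  then have "chart_smooth_at UNIV (\<lambda>x. x) UNIV (\<lambda>x. x) f p"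
    by (simp add: smooth_at_def euclid_def)
  then obtain A g where A: "open A" "p \<in> A" "\<And>k. Ck_open k g A" "\<And>q. q \<in> A \<Longrightarrow> g q = f q"
    by (rule chart_smooth_atE) blast
  have "Ck_open k f A" for k using A(3)[of k] Ck_open_cong[OF A(1,4), where k=k] by simp
  with A(1,2) show "\<exists>A. open A \<and> p \<in> A \<and> (\<forall>k. Ck_open k f A)" by blast
next
  assume "\<exists>A. open A \<and> p \<in> A \<and> (\<forall>k. Ck_open k f A)"
  then have "chart_smooth_at UNIV (\<lambda>x. x) UNIV (\<lambda>x. x) f p"
    unfolding chart_smooth_at_def by blast
  then show "smooth_at euclid euclid p f" by (simp add: smooth_at_def euclid_def)
qed

lemma smooth_at_linear: "bounded_linear f \<Longrightarrow> smooth_at euclid euclid p f"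
  using Ck_open_linear[OF _ open_UNIV] by (auto simp: smooth_at_euclid_iff)

lemma atlas_euclid [simp]: "atlas euclid"
  using smooth_at_linear[OF bounded_linear_ident]
  by (auto simp: atlas_def euclid_def smooth_at_def)

lemma openin_euclid [simp]: "openin (manifold_topology euclid) W \<longleftrightarrow> open W"
  by (simp add: openin_atlas_topology) (simp add: euclid_def)

lemma manifold_prod_euclid: "manifold_prod euclid euclid = euclid"
proof -
  have "map_prod (\<lambda>x :: 'a. x) (\<lambda>y :: 'b. y) = (\<lambda>z. z)" by (simp add: fun_eq_iff)
  then show ?thesis by (simp add: manifold_prod_def euclid_def)
qed

subsection \<open>Open submanifolds, germs and curves\<close>

lemma chart_smooth_at_restrict:
  "chart_smooth_at U \<phi> V \<psi> f p \<Longrightarrow> U' \<subseteq> U \<Longrightarrow> chart_smooth_at U' \<phi> V \<psi> f p"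
  unfolding chart_smooth_at_def by blast

lemma chart_smooth_at_open:
  assumes M: "atlas M" and W: "openin (manifold_topology M) W"
    and c: "(U, \<phi>) \<in> charts M" and p: "p \<in> U" "p \<in> W"
  shows "chart_smooth_at U \<phi> (U \<inter> W) \<phi> (\<lambda>x. x) p"
proof -
  obtain A where A: "open A" "\<phi> p \<in> A" "\<And>q. q \<in> U \<Longrightarrow> \<phi> q \<in> A \<Longrightarrow> q \<in> W"
    by (rule openin_chart_nhdE[OF M W c p]) blast
  show ?thesis
    by (rule chart_smooth_atI[of A _ _ "\<lambda>x. x"]) (use A in \<open>auto intro: Ck_open_linear\<close>)
qed

lemma charts_open_submanifold:
  "(X, \<theta>) \<in> charts (open_submanifold M W) \<longleftrightarrow> (\<exists>U. (U, \<theta>) \<in> charts M \<and> X = U \<inter> W)"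
  by (auto simp: open_submanifold_def)

lemma points_open_submanifold [simp]: "points (open_submanifold M W) = W"
  by (simp add: open_submanifold_def)

lemma atlas_open_submanifold:
  assumes M: "atlas M" and W: "openin (manifold_topology M) W"
  shows "atlas (open_submanifold M W)"
  unfolding atlas_def
proof (intro conjI ballI)
  show "subspace (model (open_submanifold M W))"
    using M by (simp add: open_submanifold_def atlas_def)
  show "points (open_submanifold M W) = (\<Union>(U, \<phi>)\<in>charts (open_submanifold M W). U)"
  proof -
    have "(\<Union>(U, \<phi>)\<in>charts (open_submanifold M W). U) = (\<Union>(U, \<phi>)\<in>charts M. U) \<inter> W"
      by (auto simp: open_submanifold_def)
    then show ?thesis
      using openin_subset[OF W] unfolding topspace_manifold_topology[OF M] atlasD(1)[OF M] by auto
  qed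
next
  fix c assume "c \<in> charts (open_submanifold M W)"
  moreover obtain X \<phi> where c: "c = (X, \<phi>)" by (cases c)
  ultimately obtain U where U: "(U, \<phi>) \<in> charts M" "X = U \<inter> W"
    by (auto simp: charts_open_submanifold)
  have "openin (top_of_set (model M)) (\<phi> ` (U \<inter> W))"
    using W U unfolding openin_atlas_topology[OF M] by blast
  then show "case c of (U, \<phi>) \<Rightarrow> inj_on \<phi> U \<and>
      openin (top_of_set (model (open_submanifold M W))) (\<phi> ` U)"
    using atlasD(2)[OF M U(1)] by (auto simp: c U(2) open_submanifold_def intro: inj_on_subset)
  have "chart_smooth_at X \<phi> X' \<phi>' (\<lambda>x. x) p"
    if X': "(X', \<phi>') \<in> charts (open_submanifold M W)" and p: "p \<in> X" "p \<in> X'" for X' \<phi>' p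
  proof -
    obtain U' where U': "(U', \<phi>') \<in> charts M" "X' = U' \<inter> W"
      using X' by (auto simp: charts_open_submanifold)
    have "chart_smooth_at U \<phi> X' \<phi>' (\<lambda>x. x) p"
      using chart_smooth_at_compose[OF atlasD(4)[OF M U(1) U'(1)] chart_smooth_at_open[OF M W U'(1)]]
        p U U' by simp
    then show ?thesis by (rule chart_smooth_at_restrict) (use U in auto)
  qed
  then show "case c of (U, \<phi>) \<Rightarrow> \<forall>(V, \<psi>)\<in>charts (open_submanifold M W).
      \<forall>p\<in>U \<inter> V. chart_smooth_at U \<phi> V \<psi> (\<lambda>x. x) p"
    by (auto simp: c)
qed

lemma smooth_at_open_submanifold:
  assumes M: "atlas M" and W: "openin (manifold_topology M) W" and p: "p \<in> W"
  shows "smooth_at (open_submanifold M W) N p f \<longleftrightarrow> smooth_at M N p f"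
proof
  assume "smooth_at (open_submanifold M W) N p f"
  then obtain U \<phi> V \<psi> where c: "(U, \<phi>) \<in> charts M" "p \<in> U" "(V, \<psi>) \<in> charts N" "f p \<in> V"
    "chart_smooth_at (U \<inter> W) \<phi> V \<psi> f p"
    unfolding smooth_at_def by (auto simp: charts_open_submanifold)
  show "smooth_at M N p f"
    using chart_smooth_at_compose[OF chart_smooth_at_open[OF M W c(1,2) p] c(5,2)] c(4)
    by (intro smooth_atI[OF c(1-3)]) simp_all
next
  assume "smooth_at M N p f"
  then obtain U \<phi> V \<psi> where c: "(U, \<phi>) \<in> charts M" "p \<in> U" "(V, \<psi>) \<in> charts N" "f p \<in> V"
    "chart_smooth_at U \<phi> V \<psi> f p"
    unfolding smooth_at_def by blast
  show "smooth_at (open_submanifold M W) N p f"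
    by (rule smooth_atI[of "U \<inter> W" \<phi> _ _ V \<psi>])
      (use c p chart_smooth_at_restrict[OF c(5)] in \<open>auto simp: charts_open_submanifold\<close>)
qed

lemma smooth_near_iff:
  assumes M: "atlas M"
  shows "smooth_near M p f \<longleftrightarrow> smooth_at M euclid p f"
proof
  assume "smooth_near M p f"
  then obtain W where W: "openin (manifold_topology M) W" "p \<in> W"
    "smooth_map (open_submanifold M W) euclid f"
    unfolding smooth_near_def real_line_eq_euclid by blast
  then have "smooth_at (open_submanifold M W) euclid p f"
    by (simp add: smooth_map_iff_smooth_at[OF atlas_open_submanifold[OF M]])
  then show "smooth_at M euclid p f" by (simp add: smooth_at_open_submanifold[OF M W(1,2)])
next
  assume "smooth_at M euclid p f"
  then obtain W where W: "openin (manifold_topology M) W" "p \<in> W"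
    "\<And>q. q \<in> W \<Longrightarrow> smooth_at M euclid q f"
    by (rule smooth_at_open[OF M atlas_euclid]) blast
  then have "smooth_map (open_submanifold M W) euclid f"
    by (simp add: smooth_map_iff_smooth_at[OF atlas_open_submanifold[OF M]]
        smooth_at_open_submanifold[OF M])
  then show "smooth_near M p f" unfolding smooth_near_def real_line_eq_euclid using W by blast
qed

lemma smooth_curve_iff:
  assumes M: "atlas M"
  shows "smooth_curve M c \<longleftrightarrow> smooth_at euclid M 0 c"
proof -
  have iff: "smooth_map (open_submanifold euclid {-\<epsilon><..<\<epsilon>}) M c \<longleftrightarrow>
      (\<forall>t\<in>{-\<epsilon><..<\<epsilon>}. smooth_at euclid M t c)" for \<epsilon> :: real
    by (simp add: smooth_map_iff_smooth_at[OF atlas_open_submanifold[OF atlas_euclid] M]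
        smooth_at_open_submanifold[OF atlas_euclid])
  show ?thesis
  proof
    assume "smooth_curve M c"
    then show "smooth_at euclid M 0 c"
      by (auto simp: smooth_curve_def real_line_eq_euclid iff)
  next
    assume "smooth_at euclid M 0 c"
    then obtain W where W: "open W" "0 \<in> W" "\<And>t. t \<in> W \<Longrightarrow> smooth_at euclid M t c"
      by (rule smooth_at_open[OF atlas_euclid M]) simp
    then obtain \<epsilon> where "\<epsilon> > 0" "ball 0 \<epsilon> \<subseteq> W" using openE by blast
    then show "smooth_curve M c"
      unfolding smooth_curve_def real_line_eq_euclid iff using W(3)
      by (intro exI[of _ \<epsilon>]) (auto simp: subset_iff dist_real_def)
  qed
qed

section \<open>Partial and mixed derivatives\<close>

lemma has_derivative_smooth_at:
  assumes "smooth_at euclid euclid p f"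
  shows "(f has_derivative frechet_derivative f (at p)) (at p)"
proof -
  obtain A where "p \<in> A" "\<And>k. Ck_open k f A"
    using assms by (auto simp: smooth_at_euclid_iff)
  then show ?thesis by (intro Ck_open_Suc_derivative)
qed

lemma has_real_derivative_smooth_at:
  fixes f :: "real \<Rightarrow> real"
  assumes "smooth_at euclid euclid p f"
  shows "(f has_real_derivative deriv f p) (at p)"
  using has_derivative_smooth_at[OF assms]
  by (metis DERIV_deriv_iff_real_differentiable differentiable_def)

lemma deriv_diagonal:
  fixes f :: "real \<times> real \<Rightarrow> real"
  assumes "smooth_at euclid euclid (0, 0) f"
  shows "deriv (\<lambda>t. f (t, t)) 0 = deriv (\<lambda>t. f (t, 0)) 0 + deriv (\<lambda>t. f (0, t)) 0"
proof -
  let ?D = "frechet_derivative f (at (0, 0))"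
  have D: "(f has_derivative ?D) (at (0, 0))" by (rule has_derivative_smooth_at[OF assms])
  then have lin: "linear ?D" by (rule has_derivative_linear)
  have "((\<lambda>t. f (t, t)) has_real_derivative ?D (1, 1)) (at 0)"
    by (rule has_real_derivative_along) (use D in \<open>auto intro!: derivative_eq_intros\<close>)
  moreover have "?D (1, 1) = ?D (1, 0) + ?D (0, 1)"
    using linear_add[OF lin, of "(1, 0)" "(0, 1)"] by simp
  ultimately show ?thesis
    using has_derivative_partial_real[OF D] by (simp add: DERIV_imp_deriv)
qed

text \<open>A derivative with respect to a parameter is a directional derivative in coordinates, and
  directional derivatives of smooth functions are smooth.\<close>

lemma smooth_at_parameter_deriv:
  assumes M: "atlas M" and f: "smooth_at (manifold_prod M euclid) euclid (p, 0 :: real) f"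
  shows "smooth_at M euclid p (\<lambda>q. deriv (\<lambda>t. f (q, t)) 0 :: real)"
proof -
  note ME = atlas_prod[OF M atlas_euclid]
  have "p \<in> points M" using smooth_at_points(1)[OF ME atlas_euclid f] by simp
  then obtain U \<phi> where U: "(U, \<phi>) \<in> charts M" "p \<in> U" by (rule chart_exists[OF M])
  have e: "(UNIV, \<lambda>x. x) \<in> charts euclid" by (simp add: euclid_def)
  have "chart_smooth_at (U \<times> UNIV) (map_prod \<phi> (\<lambda>x. x)) UNIV (\<lambda>x. x) f (p, 0)"
    by (rule smooth_atD[OF ME atlas_euclid f charts_prodI[OF U(1) e] _ e]) (use U in auto)
  then obtain A g where A: "open A" "(\<phi> p, 0) \<in> A" "\<And>k. Ck_open k g A"
    "\<And>r. r \<in> U \<times> UNIV \<Longrightarrow> map_prod \<phi> (\<lambda>x. x) r \<in> A \<Longrightarrow> g (map_prod \<phi> (\<lambda>x. x) r) = f r"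
    by (rule chart_smooth_atE) (simp, blast)
  have g: "g (\<phi> q, t) = f (q, t)" if "q \<in> U" "(\<phi> q, t) \<in> A" for q t
    using A(4)[of "(q, t)"] that by simp
  \<comment> \<open>The derivative at \<open>t = 0\<close> is read along the inclusion of the coordinates at parameter 0.\<close>
  define i where "i = (\<lambda>y :: 'b. (y, 0 :: real))"
  have i: "continuous_on UNIV i" "\<And>k S. open S \<Longrightarrow> Ck_open k i S"
    unfolding i_def
    by (auto intro!: Ck_open_linear bounded_linear_Pair bounded_linear_ident bounded_linear_zero
        continuous_intros)
  define A' where "A' = i -` A"
  have "open A'" using open_vimage[OF A(1) i(1)] by (simp add: A'_def)
  have d: "deriv (\<lambda>t. f (q, t)) 0 = frechet_derivative g (at (\<phi> q, 0)) (0, 1)"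
    if q: "q \<in> U" "(\<phi> q, 0) \<in> A" for q
  proof -
    let ?D = "frechet_derivative g (at (\<phi> q, 0))"
    have D: "(g has_derivative ?D) (at (\<phi> q, 0))" by (rule Ck_open_Suc_derivative[OF A(3) q(2)])
    have "((\<lambda>t. g (\<phi> q, t)) has_real_derivative ?D (0, 1)) (at 0)"
      by (rule has_real_derivative_along) (use D in \<open>auto intro!: derivative_eq_intros\<close>)
    then have "deriv (\<lambda>t. g (\<phi> q, t)) 0 = ?D (0, 1)" by (rule DERIV_imp_deriv)
    moreover have "deriv (\<lambda>t. g (\<phi> q, t)) 0 = deriv (\<lambda>t. f (q, t)) 0"
    proof (rule deriv_cong_ev)
      have "open ((\<lambda>t. (\<phi> q, t)) -` A)"
        by (rule open_vimage[OF A(1)]) (auto intro: continuous_intros)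
      then have "eventually (\<lambda>t. t \<in> (\<lambda>t. (\<phi> q, t)) -` A) (nhds 0)"
        by (rule eventually_nhds_in_open) (use q in simp)
      then show "eventually (\<lambda>t. g (\<phi> q, t) = f (q, t)) (nhds 0)"
        by eventually_elim (use g q in auto)
    qed simp
    ultimately show ?thesis by simp
  qed
  have "chart_smooth_at U \<phi> UNIV (\<lambda>x. x) (\<lambda>q. deriv (\<lambda>t. f (q, t)) 0) p"
  proof (rule chart_smooth_atI[OF \<open>open A'\<close>])
    show "Ck_open k (\<lambda>y. frechet_derivative g (at (i y)) (0, 1)) A'" for k
    proof (rule Ck_open_compose[OF \<open>open A'\<close> A(1) _ i(2)[OF \<open>open A'\<close>]])
      show "Ck_open k (\<lambda>z. frechet_derivative g (at z) (0, 1)) A" using A(3)[of "Suc k"] by simp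
    qed (auto simp: A'_def)
  qed (use A U d in \<open>auto simp: A'_def i_def\<close>)
  then show ?thesis by (rule smooth_atI[OF U e UNIV_I])
qed

definition mixed_deriv :: "(real \<Rightarrow> real \<Rightarrow> real) \<Rightarrow> real" where
  "mixed_deriv F = deriv (\<lambda>s. deriv (\<lambda>t. F s t) 0) 0"

lemma smooth_at_partial_deriv:
  fixes F :: "'a::euclidean_space \<Rightarrow> real \<Rightarrow> real"
  assumes "smooth_at euclid euclid (p, 0) (\<lambda>(s, t). F s t)"
  shows "smooth_at euclid euclid p (\<lambda>s. deriv (F s) 0)"
  using smooth_at_parameter_deriv[OF atlas_euclid, of p "\<lambda>(s, t). F s t"] assms
  by (simp add: manifold_prod_euclid)

lemma has_derivative_mixed_deriv:
  assumes "smooth_at euclid euclid (0, 0) (\<lambda>(s, t). F s t)"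
  shows "((\<lambda>s. deriv (\<lambda>t. F s t) 0) has_real_derivative mixed_deriv F) (at 0)"
  unfolding mixed_deriv_def
  by (rule has_real_derivative_smooth_at) (use smooth_at_partial_deriv[OF assms] in simp)

lemma mixed_deriv_commute:
  assumes "smooth_at euclid euclid (0, 0) (\<lambda>(s, t). F s t)"
  shows "mixed_deriv F = mixed_deriv (\<lambda>t s. F s t)"
proof -
  define f where "f = (\<lambda>(s, t). F s t)"
  obtain A where A: "open A" "(0, 0) \<in> A" "\<And>k. Ck_open k f A"
    using assms by (auto simp: smooth_at_euclid_iff f_def)
  define f1 where "f1 = (\<lambda>x. frechet_derivative f (at x) (1, 0))"
  define f2 where "f2 = (\<lambda>x. frechet_derivative f (at x) (0, 1))"
  define f12 where "f12 = (\<lambda>x. frechet_derivative f1 (at x) (0, 1))"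
  define f21 where "f21 = (\<lambda>x. frechet_derivative f2 (at x) (1, 0))"
  have Ck: "Ck_open k f1 A" "Ck_open k f2 A" for k
    using A(3)[of "Suc k"] by (auto simp: f1_def f2_def)
  have Ck2: "Ck_open k f12 A" "Ck_open k f21 A" for k
    using Ck(1)[of "Suc k"] Ck(2)[of "Suc k"] by (auto simp: f12_def f21_def)
  note D = Ck_open_Suc_derivative[THEN has_derivative_partial_real(1)]
    Ck_open_Suc_derivative[THEN has_derivative_partial_real(2)]
  have f: "((\<lambda>s. f (s, t)) has_real_derivative f1 (s, t)) (at s)"
    "((\<lambda>t. f (s, t)) has_real_derivative f2 (s, t)) (at t)"
    "((\<lambda>t. f1 (s, t)) has_real_derivative f12 (s, t)) (at t)"
    "((\<lambda>s. f2 (s, t)) has_real_derivative f21 (s, t)) (at s)" if "(s, t) \<in> A" for s t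
    using D(1)[OF A(3) that] D(2)[OF A(3) that] D(2)[OF Ck(1) that] D(1)[OF Ck(2) that]
    by (simp_all add: f1_def f2_def f12_def f21_def)
  have "f12 (0, 0) = f21 (0, 0)"
    by (rule mixed_partials_commute[OF A(1,2) f Ck_open_continuous[OF Ck2(1)]
          Ck_open_continuous[OF Ck2(2)]])
  moreover have "mixed_deriv F = f21 (0, 0)"
  proof -
    have "open ((\<lambda>s. (s, 0 :: real)) -` A)"
      by (rule open_vimage[OF A(1)]) (auto intro: continuous_intros)
    then have "eventually (\<lambda>s. s \<in> (\<lambda>s. (s, 0 :: real)) -` A) (nhds 0)"
      by (rule eventually_nhds_in_open) (use A in simp)
    then have "eventually (\<lambda>s. deriv (F s) 0 = f2 (s, 0)) (nhds 0)"
    proof eventually_elim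
      case (elim s)
      then show ?case using f(2)[of s 0] by (intro DERIV_imp_deriv) (simp add: f_def)
    qed
    then have "mixed_deriv F = deriv (\<lambda>s. f2 (s, 0)) 0"
      unfolding mixed_deriv_def by (rule deriv_cong_ev) simp
    then show ?thesis using f(4)[OF A(2)] by (simp add: DERIV_imp_deriv)
  qed
  moreover have "mixed_deriv (\<lambda>t s. F s t) = f12 (0, 0)"
  proof -
    have "open ((\<lambda>s. (0 :: real, s)) -` A)"
      by (rule open_vimage[OF A(1)]) (auto intro: continuous_intros)
    then have "eventually (\<lambda>s. s \<in> (\<lambda>s. (0 :: real, s)) -` A) (nhds 0)"
      by (rule eventually_nhds_in_open) (use A in simp)
    then have "eventually (\<lambda>t. deriv (\<lambda>s. F s t) 0 = f1 (0, t)) (nhds 0)"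
    proof eventually_elim
      case (elim t)
      then show ?case using f(1)[of 0 t] by (intro DERIV_imp_deriv) (simp add: f_def)
    qed
    then have "mixed_deriv (\<lambda>t s. F s t) = deriv (\<lambda>t. f1 (0, t)) 0"
      unfolding mixed_deriv_def by (rule deriv_cong_ev) simp
    then show ?thesis using f(3)[OF A(2)] by (simp add: DERIV_imp_deriv)
  qed
  ultimately show ?thesis by simp
qed

lemma mixed_deriv_cong:
  assumes "open A" "(0, 0) \<in> A" "\<And>s t. (s, t) \<in> A \<Longrightarrow> F s t = G s t"
  shows "mixed_deriv F = mixed_deriv G"
proof -
  obtain S T where ST: "open S" "open T" "0 \<in> S" "0 \<in> T" "S \<times> T \<subseteq> A"
    using assms(1,2) by (metis open_prod_elim mem_Sigma_iff)
  have S: "eventually (\<lambda>s. s \<in> S) (nhds 0)" and T: "eventually (\<lambda>t. t \<in> T) (nhds 0)"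
    using ST by (auto intro: eventually_nhds_in_open)
  have "deriv (F s) 0 = deriv (G s) 0" if "s \<in> S" for s
    by (rule deriv_cong_ev[OF eventually_mono[OF T]]) (use assms(3) ST that in auto)
  then show ?thesis
    unfolding mixed_deriv_def by (rule deriv_cong_ev[OF eventually_mono[OF S]]) simp_all
qed

lemma mixed_deriv_const [simp]:
  "mixed_deriv (\<lambda>s t. f s) = 0" "mixed_deriv (\<lambda>s t. f t) = 0"
  by (simp_all add: mixed_deriv_def)

text \<open>The chain rule in each of the two slots of \<open>f\<close>; it is the bilinearity of the mixed second
  derivative in the two directions.\<close>

lemma mixed_deriv_diagonal:
  fixes f :: "(real \<times> real) \<times> (real \<times> real) \<Rightarrow> real"
  assumes f: "smooth_at euclid euclid ((0, 0), (0, 0)) f"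
  shows "mixed_deriv (\<lambda>s t. f ((s, s), (t, t))) =
    mixed_deriv (\<lambda>s t. f ((s, 0), (t, 0))) + mixed_deriv (\<lambda>s t. f ((s, 0), (0, t))) +
    mixed_deriv (\<lambda>s t. f ((0, s), (t, 0))) + mixed_deriv (\<lambda>s t. f ((0, s), (0, t)))"
proof -
  define g1 where "g1 = (\<lambda>x. deriv (\<lambda>t. f (x, (t, 0))) 0)"
  define g2 where "g2 = (\<lambda>x. deriv (\<lambda>t. f (x, (0, t))) 0)"
  have sm: "smooth_at euclid euclid (0, 0) (\<lambda>x. deriv (\<lambda>t. f (x, j t)) 0)"
    if j: "bounded_linear j" for j :: "real \<Rightarrow> real \<times> real"
  proof (rule smooth_at_partial_deriv)
    have "bounded_linear (\<lambda>z :: (real \<times> real) \<times> real. (fst z, j (snd z)))"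
      by (intro bounded_linear_Pair bounded_linear_fst
          bounded_linear_compose[OF j bounded_linear_snd])
    from smooth_at_linear[OF this, of "((0, 0), 0)"]
    have "smooth_at euclid euclid ((0, 0), 0) (\<lambda>z :: (real \<times> real) \<times> real. f (fst z, j (snd z)))"
      by (rule smooth_at_compose[OF atlas_euclid atlas_euclid atlas_euclid])
        (use f linear_0[OF bounded_linear.linear[OF j]] in \<open>simp add: zero_prod_def\<close>)
    then show "smooth_at euclid euclid ((0, 0), 0) (\<lambda>(x, t). f (x, j t))"
      by (simp add: case_prod_unfold)
  qed
  have g1: "smooth_at euclid euclid (0, 0) g1" and g2: "smooth_at euclid euclid (0, 0) g2"
    unfolding g1_def g2_def
    by (rule sm; intro bounded_linear_Pair bounded_linear_ident bounded_linear_zero)+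
  obtain W where W: "open W" "((0, 0), (0, 0)) \<in> W" "\<And>z. z \<in> W \<Longrightarrow> smooth_at euclid euclid z f"
    using smooth_at_open[OF atlas_euclid atlas_euclid f] by (metis openin_euclid)
  have inner: "deriv (\<lambda>t. f ((s, s), (t, t))) 0 = g1 (s, s) + g2 (s, s)"
    if s: "((s, s), (0, 0)) \<in> W" for s
  proof -
    have "smooth_at euclid euclid (0, 0) (\<lambda>z :: real \<times> real. ((s, s), z))"
      using smooth_at_Pair[OF atlas_euclid atlas_euclid atlas_euclid
          smooth_at_const[OF atlas_euclid _ atlas_euclid] smooth_at_ident[OF atlas_euclid],
          of "(0, 0)" "(s, s)"] by (simp add: manifold_prod_euclid)
    then have "smooth_at euclid euclid (0, 0) (\<lambda>z. f ((s, s), z))"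
      by (rule smooth_at_compose[OF atlas_euclid atlas_euclid atlas_euclid]) (rule W(3)[OF s])
    from deriv_diagonal[OF this] show ?thesis by (simp add: g1_def g2_def)
  qed
  have "open ((\<lambda>s. ((s, s), (0 :: real, 0 :: real))) -` W)"
    by (rule open_vimage[OF W(1)]) (auto intro!: continuous_intros)
  then have "eventually (\<lambda>s. s \<in> (\<lambda>s. ((s, s), (0 :: real, 0 :: real))) -` W) (nhds 0)"
    by (rule eventually_nhds_in_open) (use W in simp)
  then have "mixed_deriv (\<lambda>s t. f ((s, s), (t, t))) = deriv (\<lambda>s. g1 (s, s) + g2 (s, s)) 0"
    unfolding mixed_deriv_def by (intro deriv_cong_ev) (auto elim: eventually_mono dest: inner)
  also have "\<dots> = deriv (\<lambda>s. g1 (s, s)) 0 + deriv (\<lambda>s. g2 (s, s)) 0"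
  proof -
    have dg: "bounded_linear (\<lambda>s :: real. (s, s))"
      by (intro bounded_linear_Pair bounded_linear_ident)
    have "smooth_at euclid euclid 0 (\<lambda>s. g1 (s, s))" "smooth_at euclid euclid 0 (\<lambda>s. g2 (s, s))"
      by (rule smooth_at_compose[OF atlas_euclid atlas_euclid atlas_euclid smooth_at_linear[OF dg]];
          simp add: g1 g2)+
    then show ?thesis
      by (intro DERIV_imp_deriv DERIV_add has_real_derivative_smooth_at)
  qed
  finally show ?thesis
    unfolding deriv_diagonal[OF g1] deriv_diagonal[OF g2]
    by (simp add: g1_def g2_def mixed_deriv_def)
qed

section \<open>Velocities\<close>

lemma velocity_apply:
  assumes "atlas M"
  shows "velocity M c f = (if smooth_at M euclid (c 0) f then deriv (\<lambda>t. f (c t)) 0 else 0)"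
  by (simp add: velocity_def smooth_near_iff[OF assms])

lemma tangent_map_apply:
  assumes "atlas N"
  shows "tangent_map N f p v h = (if smooth_at N euclid (f p) h then v (\<lambda>x. h (f x)) else 0)"
  by (simp add: tangent_map_def smooth_near_iff[OF assms])

lemma tangent_space_iff:
  assumes "atlas M"
  shows "v \<in> tangent_space M p \<longleftrightarrow> (\<exists>c. smooth_at euclid M 0 c \<and> c 0 = p \<and> v = velocity M c)"
  by (auto simp: tangent_space_def smooth_curve_iff[OF assms])

lemma tangent_map_velocity:
  fixes M :: "('m, 'e::euclidean_space) manifold" and N :: "('n, 'f::euclidean_space) manifold"
  assumes M: "atlas M" and N: "atlas N"
    and f: "smooth_at M N (c 0) f" and p: "c 0 = p"
  shows "tangent_map N f p (velocity M c) = velocity N (\<lambda>t. f (c t))"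
proof
  fix h :: "'n \<Rightarrow> real"
  have "smooth_at N euclid (f p) h \<Longrightarrow> smooth_at M euclid (c 0) (\<lambda>x. h (f x))"
    using f p by (auto intro: smooth_at_compose[OF M N atlas_euclid])
  then show "tangent_map N f p (velocity M c) h = velocity N (\<lambda>t. f (c t)) h"
    by (simp add: tangent_map_apply[OF N] velocity_apply[OF M] velocity_apply[OF N] p)
qed

text \<open>A curve stays in an open set for small times, so its velocity only depends on germs of
  functions.\<close>

lemma velocity_cong:
  assumes M: "atlas M" and c: "smooth_at euclid M 0 c"
    and W: "openin (manifold_topology M) W" "c 0 \<in> W" and eq: "\<And>q. q \<in> W \<Longrightarrow> f q = g q"
  shows "velocity M c f = velocity M c g"
proof -
  have "smooth_at M euclid (c 0) f \<longleftrightarrow> smooth_at M euclid (c 0) g"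
    using smooth_at_cong_open[OF M _ W, of euclid] eq by metis
  moreover have "deriv (\<lambda>t. f (c t)) 0 = deriv (\<lambda>t. g (c t)) 0"
  proof (rule deriv_cong_ev)
    obtain V where V: "open V" "0 \<in> V" "\<And>t. t \<in> V \<Longrightarrow> c t \<in> W"
      by (rule smooth_at_open_preimage[OF atlas_euclid M c W]) simp
    show "eventually (\<lambda>t. f (c t) = g (c t)) (nhds 0)"
      using eventually_nhds_in_open[OF V(1,2)] by (rule eventually_mono) (use V eq in auto)
  qed simp
  ultimately show ?thesis by (simp add: velocity_apply[OF M])
qed

lemma velocity_cong_points:
  assumes M: "atlas M" and c: "smooth_at euclid M 0 c" and eq: "\<And>q. q \<in> points M \<Longrightarrow> f q = g q"
  shows "velocity M c f = velocity M c g"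
  by (rule velocity_cong[OF M c openin_points[OF M]])
    (use eq smooth_at_points(2)[OF atlas_euclid M c] in auto)

lemma velocity_Pair:
  assumes M: "atlas M" and N: "atlas N"
    and c: "smooth_at euclid M 0 c" and d: "smooth_at euclid N 0 d"
    and f: "smooth_at (manifold_prod M N) euclid (c 0, d 0) f"
  shows "velocity (manifold_prod M N) (\<lambda>t. (c t, d t)) f =
    velocity M c (\<lambda>x. f (x, d 0)) + velocity N d (\<lambda>y. f (c 0, y))"
proof -
  note MN = atlas_prod[OF M N]
  have p: "c 0 \<in> points M" "d 0 \<in> points N"
    using smooth_at_points(2)[OF atlas_euclid M c] smooth_at_points(2)[OF atlas_euclid N d] by auto
  have "smooth_at M (manifold_prod M N) (c 0) (\<lambda>x. (x, d 0))"
    by (intro smooth_at_Pair M N smooth_at_ident smooth_at_const p)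
  then have "smooth_at M euclid (c 0) (\<lambda>x. f (x, d 0))"
    by (rule smooth_at_compose[OF M MN atlas_euclid]) (rule f)
  moreover have "smooth_at N (manifold_prod M N) (d 0) (\<lambda>y. (c 0, y))"
    by (intro smooth_at_Pair M N smooth_at_ident smooth_at_const p)
  then have "smooth_at N euclid (d 0) (\<lambda>y. f (c 0, y))"
    by (rule smooth_at_compose[OF N MN atlas_euclid]) (rule f)
  moreover have "deriv (\<lambda>t. f (c t, d t)) 0 = deriv (\<lambda>t. f (c t, d 0)) 0 + deriv (\<lambda>t. f (c 0, d t)) 0"
  proof -
    have "smooth_at euclid M (0, 0) (\<lambda>z :: real \<times> real. c (fst z))"
      "smooth_at euclid N (0, 0) (\<lambda>z :: real \<times> real. d (snd z))"
      using smooth_at_compose[OF atlas_euclid atlas_euclid M smooth_at_linear[OF bounded_linear_fst], of "(0, 0)" c]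
        smooth_at_compose[OF atlas_euclid atlas_euclid N smooth_at_linear[OF bounded_linear_snd], of "(0, 0)" d]
        c d by auto
    then have "smooth_at euclid (manifold_prod M N) (0, 0) (\<lambda>z :: real \<times> real. (c (fst z), d (snd z)))"
      by (intro smooth_at_Pair M N atlas_euclid)
    then have "smooth_at euclid euclid (0, 0) (\<lambda>z :: real \<times> real. f (c (fst z), d (snd z)))"
      by (rule smooth_at_compose[OF atlas_euclid MN atlas_euclid]) (simp add: f)
    from deriv_diagonal[OF this] show ?thesis by simp
  qed
  ultimately show ?thesis
    using f by (simp add: velocity_apply[OF M] velocity_apply[OF N] velocity_apply[OF MN])
qed

section \<open>Lie groups\<close>

lemma lie_groupD:
  assumes "lie_group G"
  shows "group G" "smooth_manifold (mfd G)" "atlas (mfd G)" "points (mfd G) = carrier G"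
    "x \<in> carrier G \<Longrightarrow> y \<in> carrier G
      \<Longrightarrow> smooth_at (manifold_prod (mfd G) (mfd G)) (mfd G) (x, y) (\<lambda>(x, y). x \<otimes>\<^bsub>G\<^esub> y)"
    "x \<in> carrier G \<Longrightarrow> smooth_at (mfd G) (mfd G) x (m_inv G)"
  using assms
  by (auto simp: lie_group_def smooth_manifold_iff_atlas smooth_map_iff_smooth_at atlas_prod)

lemma smooth_at_mult:
  assumes G: "lie_group G" and M: "atlas M"
    and f: "smooth_at M (mfd G) p f" and g: "smooth_at M (mfd G) p g"
  shows "smooth_at M (mfd G) p (\<lambda>x. f x \<otimes>\<^bsub>G\<^esub> g x)"
proof -
  note A = lie_groupD(3)[OF G]
  have "f p \<in> carrier G" "g p \<in> carrier G"
    using smooth_at_points(2)[OF M A f] smooth_at_points(2)[OF M A g] lie_groupD(4)[OF G] by auto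
  then show ?thesis
    using smooth_at_compose[OF M atlas_prod[OF A A] A smooth_at_Pair[OF M A A f g]]
      lie_groupD(5)[OF G] by fastforce
qed

lemma smooth_at_m_inv:
  assumes G: "lie_group G" and M: "atlas M" and f: "smooth_at M (mfd G) p f"
  shows "smooth_at M (mfd G) p (\<lambda>x. inv\<^bsub>G\<^esub> f x)"
proof -
  note A = lie_groupD(3)[OF G]
  have "f p \<in> carrier G" using smooth_at_points(2)[OF M A f] lie_groupD(4)[OF G] by auto
  then show ?thesis
    using smooth_at_compose[OF M A A f] lie_groupD(6)[OF G] by blast
qed

text \<open>The inner derivative in \<open>u(Y f)\<close> is \<open>g \<mapsto> v(x \<mapsto> f(g x))\<close>, which is again smooth, so that
  the outer velocity is a derivative along its curve. Hence both terms of the bracket are mixed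
  second derivatives along products of curves.\<close>

lemma lie_bracket_velocity:
  assumes G: "lie_group G"
    and c: "smooth_at euclid (mfd G) 0 c" "c 0 = \<one>\<^bsub>G\<^esub>"
    and d: "smooth_at euclid (mfd G) 0 d" "d 0 = \<one>\<^bsub>G\<^esub>"
    and f: "smooth_at (mfd G) euclid \<one>\<^bsub>G\<^esub> f"
  shows "lie_bracket G (velocity (mfd G) c) (velocity (mfd G) d) f =
    mixed_deriv (\<lambda>s t. f (c s \<otimes>\<^bsub>G\<^esub> d t)) - mixed_deriv (\<lambda>s t. f (d s \<otimes>\<^bsub>G\<^esub> c t))"
proof -
  note A = lie_groupD(3)[OF G]
  interpret group G by (rule lie_groupD(1)[OF G])
  have "velocity (mfd G) c (\<lambda>g. left_invariant_field G (velocity (mfd G) d) g f) =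
      mixed_deriv (\<lambda>s t. f (c s \<otimes>\<^bsub>G\<^esub> d t))"
    if c: "smooth_at euclid (mfd G) 0 c" "c 0 = \<one>\<^bsub>G\<^esub>"
      and d: "smooth_at euclid (mfd G) 0 d" "d 0 = \<one>\<^bsub>G\<^esub>" for c d
  proof -
    let ?Y = "\<lambda>g. deriv (\<lambda>t. f (g \<otimes>\<^bsub>G\<^esub> d t)) 0"
    obtain W where W: "openin (manifold_topology (mfd G)) W" "\<one>\<^bsub>G\<^esub> \<in> W"
      "\<And>q. q \<in> W \<Longrightarrow> smooth_at (mfd G) euclid q f"
      by (rule smooth_at_open[OF A atlas_euclid f]) blast
    have field: "left_invariant_field G (velocity (mfd G) d) g f = ?Y g" if g: "g \<in> W" for g
    proof -
      have gG: "g \<in> carrier G"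
        using smooth_at_points(1)[OF A atlas_euclid W(3)[OF g]] lie_groupD(4)[OF G] by simp
      then have "smooth_at (mfd G) (mfd G) \<one>\<^bsub>G\<^esub> (\<lambda>x. g \<otimes>\<^bsub>G\<^esub> x)"
        using lie_groupD(4)[OF G] by (intro smooth_at_mult G A smooth_at_const smooth_at_ident) auto
      then have "smooth_at (mfd G) euclid \<one>\<^bsub>G\<^esub> (\<lambda>x. f (g \<otimes>\<^bsub>G\<^esub> x))"
        by (rule smooth_at_compose[OF A A atlas_euclid]) (use gG W(3)[OF g] in simp)
      then show ?thesis
        using W(3)[OF g] gG d
        by (simp add: left_invariant_field_def tangent_map_apply[OF A] velocity_apply[OF A])
    qed
    have "smooth_at (mfd G) euclid \<one>\<^bsub>G\<^esub> ?Y"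
    proof -
      note GE = atlas_prod[OF A atlas_euclid]
      have pt: "(\<one>\<^bsub>G\<^esub>, 0 :: real) \<in> points (mfd G) \<times> points euclid"
        using lie_groupD(4)[OF G] by simp
      have "smooth_at (manifold_prod (mfd G) euclid) (mfd G) (\<one>\<^bsub>G\<^esub>, 0) (\<lambda>z. d (snd z))"
        by (rule smooth_at_compose[OF GE atlas_euclid A smooth_at_prod_snd[OF A atlas_euclid pt]])
          (simp add: d)
      from smooth_at_mult[OF G GE smooth_at_prod_fst[OF A atlas_euclid pt] this]
      have "smooth_at (manifold_prod (mfd G) euclid) euclid (\<one>\<^bsub>G\<^esub>, 0)
          (\<lambda>z. f (fst z \<otimes>\<^bsub>G\<^esub> d (snd z)))"
        by (rule smooth_at_compose[OF GE A atlas_euclid]) (simp add: d f)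
      from smooth_at_parameter_deriv[OF A this] show ?thesis by simp
    qed
    then have "velocity (mfd G) c ?Y = mixed_deriv (\<lambda>s t. f (c s \<otimes>\<^bsub>G\<^esub> d t))"
      using c by (simp add: velocity_apply[OF A] mixed_deriv_def)
    then show ?thesis
      using velocity_cong[OF A c(1) W(1) _ field] W(2) c(2) by simp
  qed
  from this[OF c d] this[OF d c] show ?thesis
    using f by (simp add: lie_bracket_def smooth_near_iff[OF A])
qed

lemma lie_iff:
  assumes "lie_group G"
  shows "v \<in> lie G \<longleftrightarrow>
    (\<exists>c. smooth_at euclid (mfd G) 0 c \<and> c 0 = \<one>\<^bsub>G\<^esub> \<and> v = velocity (mfd G) c)"
  by (simp add: lie_def tangent_space_iff[OF lie_groupD(3)[OF assms]])

subsection \<open>Direct products\<close>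

lemma lie_group_prod_simps [simp]:
  "carrier (lie_group_prod G H) = carrier G \<times> carrier H"
  "\<one>\<^bsub>lie_group_prod G H\<^esub> = (\<one>\<^bsub>G\<^esub>, \<one>\<^bsub>H\<^esub>)"
  "mfd (lie_group_prod G H) = manifold_prod (mfd G) (mfd H)"
  "x \<otimes>\<^bsub>lie_group_prod G H\<^esub> y = (fst x \<otimes>\<^bsub>G\<^esub> fst y, snd x \<otimes>\<^bsub>H\<^esub> snd y)"
  by (simp_all add: lie_group_prod_def DirProd_def case_prod_beta)

lemma group_lie_group_prod:
  assumes "group G" "group H" shows "group (lie_group_prod G H)"
proof -
  interpret G: group G by fact
  interpret H: group H by fact
  show ?thesis
  proof (rule groupI)
    fix x assume x: "x \<in> carrier (lie_group_prod G H)"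
    show "\<exists>y\<in>carrier (lie_group_prod G H). y \<otimes>\<^bsub>lie_group_prod G H\<^esub> x = \<one>\<^bsub>lie_group_prod G H\<^esub>"
      by (rule bexI[of _ "(inv\<^bsub>G\<^esub> (fst x), inv\<^bsub>H\<^esub> (snd x))"]) (use x in auto)
  qed (auto simp: G.m_assoc H.m_assoc)
qed

lemma inv_lie_group_prod:
  assumes "group G" "group H" "x \<in> carrier G" "y \<in> carrier H"
  shows "inv\<^bsub>lie_group_prod G H\<^esub> (x, y) = (inv\<^bsub>G\<^esub> x, inv\<^bsub>H\<^esub> y)"
  using assms
  by (intro group.inv_equality[OF group_lie_group_prod]) (auto simp: group.l_inv)

lemma lie_group_prod:
  assumes G: "lie_group G" and H: "lie_group H"
  shows "lie_group (lie_group_prod G H)"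
proof -
  note A = lie_groupD(3)[OF G] and B = lie_groupD(3)[OF H]
  note AB = atlas_prod[OF A B]
  note ABAB = atlas_prod[OF AB AB]
  let ?M = "manifold_prod (mfd G) (mfd H)"
  have "smooth_at (manifold_prod ?M ?M) ?M r
      (\<lambda>r. (fst (fst r) \<otimes>\<^bsub>G\<^esub> fst (snd r), snd (fst r) \<otimes>\<^bsub>H\<^esub> snd (snd r)))"
    if r: "r \<in> points ?M \<times> points ?M" for r
  proof -
    note f = smooth_at_prod_fst[OF AB AB r] smooth_at_prod_snd[OF AB AB r]
    show ?thesis
      by (intro smooth_at_Pair ABAB A B smooth_at_mult G H smooth_at_fst[OF ABAB A B] f
          smooth_at_snd[OF ABAB A B])
  qed
  note prod = this
  have "smooth_map (manifold_prod ?M ?M) ?M (\<lambda>(x, y). x \<otimes>\<^bsub>lie_group_prod G H\<^esub> y)"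
    unfolding smooth_map_iff_smooth_at[OF ABAB AB]
  proof
    fix r assume "r \<in> points (manifold_prod ?M ?M)"
    then have "r \<in> points ?M \<times> points ?M" by (simp only: points_manifold_prod)
    from prod[OF this] show "smooth_at (manifold_prod ?M ?M) ?M r
        (\<lambda>(x, y). x \<otimes>\<^bsub>lie_group_prod G H\<^esub> y)"
      by (simp add: case_prod_unfold)
  qed
  moreover have "smooth_at ?M ?M x (m_inv (lie_group_prod G H))" if x: "x \<in> points ?M" for x
  proof -
    note f = smooth_at_prod_fst[OF A B x[simplified]] smooth_at_prod_snd[OF A B x[simplified]]
    have "smooth_at ?M ?M x (\<lambda>x. (inv\<^bsub>G\<^esub> (fst x), inv\<^bsub>H\<^esub> (snd x)))"
      by (intro smooth_at_Pair AB A B smooth_at_m_inv G H f)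
    then show ?thesis
      using inv_lie_group_prod[OF lie_groupD(1)[OF G] lie_groupD(1)[OF H]]
        lie_groupD(4)[OF G] lie_groupD(4)[OF H]
      by (subst smooth_at_cong[OF AB x, where g="\<lambda>x. (inv\<^bsub>G\<^esub> (fst x), inv\<^bsub>H\<^esub> (snd x))"]) auto
  qed
  then have "smooth_map ?M ?M (m_inv (lie_group_prod G H))"
    by (simp add: smooth_map_iff_smooth_at[OF AB AB])
  ultimately show ?thesis
    using G H group_lie_group_prod smooth_manifold_prod by (auto simp: lie_group_def)
qed

text \<open>Expanding the mixed derivative in the two factors leaves two cross terms in each half of the
  bracket. As elements of different factors commute, the cross terms of both halves are mixed
  derivatives of the same functions of two variables, taken in opposite orders, and they cancel.\<close>

lemma lie_bracket_prod:
  assumes G: "lie_group G" and H: "lie_group H"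
    and c: "smooth_at euclid (mfd G) 0 c" "c 0 = \<one>\<^bsub>G\<^esub>"
    and d: "smooth_at euclid (mfd G) 0 d" "d 0 = \<one>\<^bsub>G\<^esub>"
    and c': "smooth_at euclid (mfd H) 0 c'" "c' 0 = \<one>\<^bsub>H\<^esub>"
    and d': "smooth_at euclid (mfd H) 0 d'" "d' 0 = \<one>\<^bsub>H\<^esub>"
    and f: "smooth_at (manifold_prod (mfd G) (mfd H)) euclid (\<one>\<^bsub>G\<^esub>, \<one>\<^bsub>H\<^esub>) f"
  shows "lie_bracket (lie_group_prod G H)
      (velocity (manifold_prod (mfd G) (mfd H)) (\<lambda>t. (c t, c' t)))
      (velocity (manifold_prod (mfd G) (mfd H)) (\<lambda>t. (d t, d' t))) f =
    lie_bracket G (velocity (mfd G) c) (velocity (mfd G) d) (\<lambda>x. f (x, \<one>\<^bsub>H\<^esub>)) +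
    lie_bracket H (velocity (mfd H) c') (velocity (mfd H) d') (\<lambda>y. f (\<one>\<^bsub>G\<^esub>, y))"
proof -
  note A = lie_groupD(3)[OF G] and B = lie_groupD(3)[OF H]
  note AB = atlas_prod[OF A B] and K = lie_group_prod[OF G H]
  interpret G: group G by (rule lie_groupD(1)[OF G])
  interpret H: group H by (rule lie_groupD(1)[OF H])
  have one: "\<one>\<^bsub>G\<^esub> \<in> points (mfd G)" "\<one>\<^bsub>H\<^esub> \<in> points (mfd H)"
    using lie_groupD(4)[OF G] lie_groupD(4)[OF H] by auto
  have expand: "mixed_deriv (\<lambda>s t. f (c s \<otimes>\<^bsub>G\<^esub> d t, c' s \<otimes>\<^bsub>H\<^esub> d' t)) =
      mixed_deriv (\<lambda>s t. f (c s \<otimes>\<^bsub>G\<^esub> d t, \<one>\<^bsub>H\<^esub>)) + mixed_deriv (\<lambda>s t. f (c s, d' t)) +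
      mixed_deriv (\<lambda>s t. f (d t, c' s)) + mixed_deriv (\<lambda>s t. f (\<one>\<^bsub>G\<^esub>, c' s \<otimes>\<^bsub>H\<^esub> d' t))"
    if c: "smooth_at euclid (mfd G) 0 c" "c 0 = \<one>\<^bsub>G\<^esub>"
      and d: "smooth_at euclid (mfd G) 0 d" "d 0 = \<one>\<^bsub>G\<^esub>"
      and c': "smooth_at euclid (mfd H) 0 c'" "c' 0 = \<one>\<^bsub>H\<^esub>"
      and d': "smooth_at euclid (mfd H) 0 d'" "d' 0 = \<one>\<^bsub>H\<^esub>" for c d c' d'
  proof -
    define g where "g = (\<lambda>z :: (real \<times> real) \<times> (real \<times> real).
      (c (fst (fst z)) \<otimes>\<^bsub>G\<^esub> d (fst (snd z)), c' (snd (fst z)) \<otimes>\<^bsub>H\<^esub> d' (snd (snd z))))"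
    have "smooth_at euclid (mfd G) ((0, 0), (0, 0))
        (\<lambda>z :: (real \<times> real) \<times> (real \<times> real). c (fst (fst z)))"
      by (rule smooth_at_compose[OF atlas_euclid atlas_euclid A smooth_at_linear])
        (auto intro: bounded_linear_compose bounded_linear_fst simp: c)
    moreover have "smooth_at euclid (mfd G) ((0, 0), (0, 0))
        (\<lambda>z :: (real \<times> real) \<times> (real \<times> real). d (fst (snd z)))"
      by (rule smooth_at_compose[OF atlas_euclid atlas_euclid A smooth_at_linear])
        (auto intro: bounded_linear_compose bounded_linear_fst bounded_linear_snd simp: d)
    moreover have "smooth_at euclid (mfd H) ((0, 0), (0, 0))
        (\<lambda>z :: (real \<times> real) \<times> (real \<times> real). c' (snd (fst z)))"
      by (rule smooth_at_compose[OF atlas_euclid atlas_euclid B smooth_at_linear])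
        (auto intro: bounded_linear_compose bounded_linear_fst bounded_linear_snd simp: c')
    moreover have "smooth_at euclid (mfd H) ((0, 0), (0, 0))
        (\<lambda>z :: (real \<times> real) \<times> (real \<times> real). d' (snd (snd z)))"
      by (rule smooth_at_compose[OF atlas_euclid atlas_euclid B smooth_at_linear])
        (auto intro: bounded_linear_compose bounded_linear_snd simp: d')
    ultimately have "smooth_at euclid (manifold_prod (mfd G) (mfd H)) ((0, 0), (0, 0)) g"
      unfolding g_def
      by (intro smooth_at_Pair atlas_euclid A B smooth_at_mult G H)
    then have "smooth_at euclid euclid ((0, 0), (0, 0)) (\<lambda>z. f (g z))"
      by (rule smooth_at_compose[OF atlas_euclid AB atlas_euclid]) (simp add: g_def c d c' d' f)
    from mixed_deriv_diagonal[OF this]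
    have "mixed_deriv (\<lambda>s t. f (c s \<otimes>\<^bsub>G\<^esub> d t, c' s \<otimes>\<^bsub>H\<^esub> d' t)) =
        mixed_deriv (\<lambda>s t. f (c s \<otimes>\<^bsub>G\<^esub> d t, \<one>\<^bsub>H\<^esub>)) +
        mixed_deriv (\<lambda>s t. f (c s \<otimes>\<^bsub>G\<^esub> \<one>\<^bsub>G\<^esub>, \<one>\<^bsub>H\<^esub> \<otimes>\<^bsub>H\<^esub> d' t)) +
        mixed_deriv (\<lambda>s t. f (\<one>\<^bsub>G\<^esub> \<otimes>\<^bsub>G\<^esub> d t, c' s \<otimes>\<^bsub>H\<^esub> \<one>\<^bsub>H\<^esub>)) +
        mixed_deriv (\<lambda>s t. f (\<one>\<^bsub>G\<^esub>, c' s \<otimes>\<^bsub>H\<^esub> d' t))"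
      by (simp add: g_def c d c' d')
    moreover
    \<comment> \<open>The factors of \<open>\<one>\<close> can only be dropped where the curves take values in the groups.\<close>
    have near: "\<exists>V. open V \<and> 0 \<in> V \<and> (\<forall>t\<in>V. e t \<in> carrier G)"
      if "smooth_at euclid (mfd G) 0 e" for e :: "real \<Rightarrow> 'a"
      using smooth_at_open_preimage[OF atlas_euclid A that openin_points[OF A]]
        smooth_at_points(2)[OF atlas_euclid A that] lie_groupD(4)[OF G] by (metis openin_euclid)
    have near': "\<exists>V. open V \<and> 0 \<in> V \<and> (\<forall>t\<in>V. e t \<in> carrier H)"
      if "smooth_at euclid (mfd H) 0 e" for e :: "real \<Rightarrow> 'c"
      using smooth_at_open_preimage[OF atlas_euclid B that openin_points[OF B]]
        smooth_at_points(2)[OF atlas_euclid B that] lie_groupD(4)[OF H] by (metis openin_euclid)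
    obtain V1 V2 V3 V4 where V: "open V1" "0 \<in> V1" "\<And>t. t \<in> V1 \<Longrightarrow> c t \<in> carrier G"
      "open V2" "0 \<in> V2" "\<And>t. t \<in> V2 \<Longrightarrow> d t \<in> carrier G"
      "open V3" "0 \<in> V3" "\<And>t. t \<in> V3 \<Longrightarrow> c' t \<in> carrier H"
      "open V4" "0 \<in> V4" "\<And>t. t \<in> V4 \<Longrightarrow> d' t \<in> carrier H"
      using near[OF c(1)] near[OF d(1)] near'[OF c'(1)] near'[OF d'(1)] by metis
    have "mixed_deriv (\<lambda>s t. f (c s \<otimes>\<^bsub>G\<^esub> \<one>\<^bsub>G\<^esub>, \<one>\<^bsub>H\<^esub> \<otimes>\<^bsub>H\<^esub> d' t)) = mixed_deriv (\<lambda>s t. f (c s, d' t))"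
      by (rule mixed_deriv_cong[of "V1 \<times> V4"]) (use V in \<open>auto intro: open_Times\<close>)
    moreover have "mixed_deriv (\<lambda>s t. f (\<one>\<^bsub>G\<^esub> \<otimes>\<^bsub>G\<^esub> d t, c' s \<otimes>\<^bsub>H\<^esub> \<one>\<^bsub>H\<^esub>)) =
        mixed_deriv (\<lambda>s t. f (d t, c' s))"
      by (rule mixed_deriv_cong[of "V3 \<times> V2"]) (use V in \<open>auto intro: open_Times\<close>)
    ultimately show ?thesis by simp
  qed
  have cross: "mixed_deriv (\<lambda>s t. f (e s, e' t)) = mixed_deriv (\<lambda>s t. f (e t, e' s))"
    if e: "smooth_at euclid (mfd G) 0 e" "e 0 = \<one>\<^bsub>G\<^esub>"
      and e': "smooth_at euclid (mfd H) 0 e'" "e' 0 = \<one>\<^bsub>H\<^esub>" for e e'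
  proof (rule mixed_deriv_commute)
    have "smooth_at euclid (mfd G) (0, 0) (\<lambda>z :: real \<times> real. e (fst z))"
      by (rule smooth_at_compose[OF atlas_euclid atlas_euclid A smooth_at_linear])
        (auto intro: bounded_linear_fst simp: e)
    moreover have "smooth_at euclid (mfd H) (0, 0) (\<lambda>z :: real \<times> real. e' (snd z))"
      by (rule smooth_at_compose[OF atlas_euclid atlas_euclid B smooth_at_linear])
        (auto intro: bounded_linear_snd simp: e')
    ultimately have "smooth_at euclid (manifold_prod (mfd G) (mfd H)) (0, 0)
        (\<lambda>z :: real \<times> real. (e (fst z), e' (snd z)))"
      by (intro smooth_at_Pair atlas_euclid A B)
    then have "smooth_at euclid euclid (0, 0) (\<lambda>z :: real \<times> real. f (e (fst z), e' (snd z)))"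
      by (rule smooth_at_compose[OF atlas_euclid AB atlas_euclid]) (simp add: e e' f)
    then show "smooth_at euclid euclid (0, 0) (\<lambda>(s, t). f (e s, e' t))"
      by (simp add: case_prod_unfold)
  qed
  have "smooth_at (mfd G) (manifold_prod (mfd G) (mfd H)) \<one>\<^bsub>G\<^esub> (\<lambda>x. (x, \<one>\<^bsub>H\<^esub>))"
    by (intro smooth_at_Pair A B smooth_at_ident smooth_at_const one)
  then have f1: "smooth_at (mfd G) euclid \<one>\<^bsub>G\<^esub> (\<lambda>x. f (x, \<one>\<^bsub>H\<^esub>))"
    by (rule smooth_at_compose[OF A AB atlas_euclid]) (rule f)
  have "smooth_at (mfd H) (manifold_prod (mfd G) (mfd H)) \<one>\<^bsub>H\<^esub> (\<lambda>y. (\<one>\<^bsub>G\<^esub>, y))"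
    by (intro smooth_at_Pair A B smooth_at_ident smooth_at_const one)
  then have f2: "smooth_at (mfd H) euclid \<one>\<^bsub>H\<^esub> (\<lambda>y. f (\<one>\<^bsub>G\<^esub>, y))"
    by (rule smooth_at_compose[OF B AB atlas_euclid]) (rule f)
  have "smooth_at euclid (manifold_prod (mfd G) (mfd H)) 0 (\<lambda>t. (c t, c' t))"
    "smooth_at euclid (manifold_prod (mfd G) (mfd H)) 0 (\<lambda>t. (d t, d' t))"
    by (intro smooth_at_Pair atlas_euclid A B c d c' d')+
  then show ?thesis
    using lie_bracket_velocity[OF K, of "\<lambda>t. (c t, c' t)" "\<lambda>t. (d t, d' t)" f]
      lie_bracket_velocity[OF G c d f1] lie_bracket_velocity[OF H c' d' f2]
      expand[OF c d c' d'] expand[OF d c d' c'] cross[OF c d'] cross[OF d c'] c d c' d' f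
    by simp
qed

section \<open>Images of sections of smooth retractions\<close>

lemma continuous_map_smooth_at:
  assumes "atlas M" "atlas N" "\<And>p. p \<in> points M \<Longrightarrow> smooth_at M N p f"
  shows "continuous_map (manifold_topology M) (manifold_topology N) f"
proof -
  have "smooth_map M N f" using assms by (simp add: smooth_map_iff_smooth_at)
  then show ?thesis unfolding smooth_map_def by blast
qed

text \<open>If \<open>r \<circ> F\<close> is the identity of \<open>M\<close>, then \<open>F\<close> embeds \<open>M\<close> into \<open>K\<close>, and the charts of \<open>M\<close> become
  charts of the image by composition with \<open>r\<close>. The second component 0 only serves to give the image
  the same type of coordinates as \<open>K\<close>.\<close>

definition image_manifold ::
  "('m, 'e) manifold \<Rightarrow> ('m \<Rightarrow> 'h) \<Rightarrow> ('h \<Rightarrow> 'm) \<Rightarrow> ('h, 'e::euclidean_space \<times> 'f::euclidean_space) manifold"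
  where
  "image_manifold M F r = \<lparr>points = F ` points M, model = model M \<times> {0},
     charts = (\<lambda>(U, \<phi>). (F ` U, \<lambda>k. (\<phi> (r k), 0))) ` charts M\<rparr>"

locale retract_embedding =
  fixes M :: "('m, 'e::euclidean_space) manifold"
    and K :: "('h, 'e \<times> 'f::euclidean_space) manifold"
    and F :: "'m \<Rightarrow> 'h" and r :: "'h \<Rightarrow> 'm"
  assumes smooth_M: "smooth_manifold M" and smooth_K: "smooth_manifold K"
    and smooth_F: "p \<in> points M \<Longrightarrow> smooth_at M K p F"
    and smooth_r: "k \<in> points K \<Longrightarrow> smooth_at K M k r"
    and retract: "p \<in> points M \<Longrightarrow> r (F p) = p"
begin

abbreviation "P \<equiv> image_manifold M F r :: ('h, 'e \<times> 'f) manifold"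

lemma M: "atlas M" and K: "atlas K"
  using smooth_M smooth_K by (auto simp: smooth_manifold_iff_atlas)

lemma points_P: "points P = F ` points M"
  by (simp add: image_manifold_def)

lemma F_r: "q \<in> points P \<Longrightarrow> F (r q) = q" "q \<in> points P \<Longrightarrow> r q \<in> points M"
  by (auto simp: points_P retract)

lemma points_P_subset: "points P \<subseteq> points K"
  using smooth_at_points(2)[OF M K smooth_F] by (auto simp: points_P)

lemma chart_r:
  assumes "(U, \<phi>) \<in> charts M" "q \<in> F ` U"
  shows "r q \<in> U" "F (r q) = q"
  using assms atlasD(5)[OF M assms(1)] retract by auto

lemma charts_P:
  "(X, \<theta>) \<in> charts P \<longleftrightarrow> (\<exists>U \<phi>. (U, \<phi>) \<in> charts M \<and> X = F ` U \<and> \<theta> = (\<lambda>k. (\<phi> (r k), 0)))"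
  by (auto simp: image_manifold_def)

lemma chart_smooth_at_F:
  assumes "(U, \<phi>) \<in> charts M"
  shows "chart_smooth_at U \<phi> (F ` U) (\<lambda>k. (\<phi> (r k), 0 :: 'f)) F p"
proof (rule chart_smooth_atI[of UNIV _ _ "\<lambda>y. (y, 0)"])
  show "Ck_open k (\<lambda>y :: 'e. (y, 0 :: 'f)) UNIV" for k
    by (intro Ck_open_linear bounded_linear_Pair bounded_linear_ident bounded_linear_zero open_UNIV)
qed (use retract atlasD(5)[OF M assms] in auto)

lemma chart_smooth_at_r:
  assumes "(U, \<phi>) \<in> charts M"
  shows "chart_smooth_at (F ` U) (\<lambda>k. (\<phi> (r k), 0 :: 'f)) U \<phi> r q"
  by (rule chart_smooth_atI[of UNIV _ _ fst])
    (use chart_r[OF assms] in \<open>auto intro!: Ck_open_linear bounded_linear_fst\<close>)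

lemma atlas_P: "atlas P"
  unfolding atlas_def
proof (intro conjI ballI)
  show "subspace (model P)"
    using M by (simp add: image_manifold_def atlas_def subspace_Times)
  show "points P = (\<Union>(U, \<phi>)\<in>charts P. U)"
    using atlasD(1)[OF M] by (auto simp: image_manifold_def)
next
  fix c assume "c \<in> charts P"
  moreover obtain X \<theta> where c: "c = (X, \<theta>)" by (cases c)
  ultimately obtain U \<phi> where U: "(U, \<phi>) \<in> charts M" "X = F ` U" "\<theta> = (\<lambda>k. (\<phi> (r k), 0))"
    by (auto simp: charts_P)
  have "inj_on \<theta> X"
  proof (rule inj_onI)
    fix x y assume xy: "x \<in> X" "y \<in> X" "\<theta> x = \<theta> y"
    then have "r x = r y"
      using chart_r[OF U(1)] atlasD(2)[OF M U(1)] by (auto simp: U(2,3) dest: inj_onD)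
    then show "x = y" using chart_r(2)[OF U(1)] xy U(2) by metis
  qed
  moreover have "\<theta> ` X = \<phi> ` U \<times> {0}"
  proof -
    have "\<theta> ` X = (\<lambda>p. (\<phi> p, 0)) ` U"
      unfolding U(2,3) image_image using atlasD(5)[OF M U(1)] retract by (intro image_cong) auto
    then show ?thesis by auto
  qed
  then have "openin (top_of_set (model P)) (\<theta> ` X)"
    using atlasD(3)[OF M U(1)] by (auto simp: image_manifold_def intro: openin_Times)
  ultimately show "case c of (U, \<phi>) \<Rightarrow> inj_on \<phi> U \<and> openin (top_of_set (model P)) (\<phi> ` U)"
    by (simp add: c)
  have "chart_smooth_at X \<theta> X' \<theta>' (\<lambda>x. x) q"
    if X': "(X', \<theta>') \<in> charts P" and q: "q \<in> X" "q \<in> X'" for X' \<theta>' q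
  proof -
    obtain U' \<phi>' where U': "(U', \<phi>') \<in> charts M" "X' = F ` U'" "\<theta>' = (\<lambda>k. (\<phi>' (r k), 0))"
      using X' by (auto simp: charts_P)
    have "r q \<in> U" "r q \<in> U'" using chart_r U U' q by auto
    then have "chart_smooth_at X \<theta> U' \<phi>' r q"
      using chart_smooth_at_compose[OF chart_smooth_at_r[OF U(1)] atlasD(4)[OF M U(1) U'(1)]] U q
      by simp
    from chart_smooth_at_compose[OF this chart_smooth_at_F[OF U'(1)] q(1)]
    have "chart_smooth_at X \<theta> X' \<theta>' (\<lambda>k. F (r k)) q" by (simp add: U')
    then show ?thesis
      using chart_r(2)[OF U(1)] unfolding chart_smooth_at_def by (simp add: U(2))
  qed
  then show "case c of (U, \<phi>) \<Rightarrow>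
      \<forall>(V, \<psi>)\<in>charts P. \<forall>p\<in>U \<inter> V. chart_smooth_at U \<phi> V \<psi> (\<lambda>x. x) p"
    by (auto simp: c)
qed

lemma smooth_at_F:
  assumes "p \<in> points M" shows "smooth_at M P p F"
proof -
  obtain U \<phi> where U: "(U, \<phi>) \<in> charts M" "p \<in> U" using chart_exists[OF M assms] .
  have c: "(F ` U, \<lambda>k. (\<phi> (r k), 0)) \<in> charts P" using U(1) charts_P by blast
  show ?thesis by (rule smooth_atI[OF U c]) (use U chart_smooth_at_F in auto)
qed

lemma smooth_at_r:
  assumes "q \<in> points P" shows "smooth_at P M q r"
proof -
  obtain U \<phi> where U: "(U, \<phi>) \<in> charts M" "r q \<in> U"
    using chart_exists[OF M F_r(2)[OF assms]] .
  have c: "(F ` U, \<lambda>k. (\<phi> (r k), 0)) \<in> charts P" using U(1) charts_P by blast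
  have q: "q \<in> F ` U" using F_r(1)[OF assms] U(2) by (metis image_eqI)
  show ?thesis by (rule smooth_atI[OF c q U(1)]) (use U chart_smooth_at_r in auto)
qed

lemma smooth_at_inclusion:
  assumes q: "q \<in> points P" shows "smooth_at P K q (\<lambda>x. x)"
proof -
  have "smooth_at P K q (\<lambda>x. F (r x))"
    by (rule smooth_at_compose[OF atlas_P M K smooth_at_r[OF q] smooth_F[OF F_r(2)[OF q]]])
  then show ?thesis by (subst smooth_at_cong[OF atlas_P q, of _ "\<lambda>x. F (r x)"]) (auto simp: F_r)
qed

text \<open>On maps with values in the image, \<open>F \<circ> r\<close> acts as the identity, and it is smooth as a map
  from \<open>K\<close> to the image.\<close>

lemma smooth_at_into_image:
  assumes L: "atlas L" and f: "smooth_at L K p f" and im: "\<And>x. x \<in> points L \<Longrightarrow> f x \<in> points P"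
  shows "smooth_at L P p f"
proof -
  have p: "p \<in> points L" using smooth_at_points(1)[OF L K f] .
  have fp: "f p \<in> points P" by (rule im[OF p])
  have "smooth_at L M p (\<lambda>x. r (f x))"
    by (rule smooth_at_compose[OF L K M f]) (use fp points_P_subset in \<open>auto intro: smooth_r\<close>)
  then have "smooth_at L P p (\<lambda>x. F (r (f x)))"
    by (rule smooth_at_compose[OF L M atlas_P]) (rule smooth_at_F[OF F_r(2)[OF fp]])
  then show ?thesis by (subst smooth_at_cong[OF L p, of _ "\<lambda>x. F (r (f x))"]) (auto simp: F_r im)
qed

lemma smooth_at_extension:
  assumes q: "q \<in> points P" and h: "smooth_at P N q h" and N: "atlas N"
  shows "smooth_at K N q (\<lambda>k. h (F (r k)))"
proof -
  have "smooth_at K M q r" using q points_P_subset by (auto intro: smooth_r)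
  then have "smooth_at K P q (\<lambda>k. F (r k))"
    by (rule smooth_at_compose[OF K M atlas_P]) (rule smooth_at_F[OF F_r(2)[OF q]])
  then show ?thesis by (rule smooth_at_compose[OF K atlas_P N]) (simp add: F_r q h)
qed

text \<open>An open set of the image is the trace on the image of its preimage under \<open>F \<circ> r\<close>.\<close>

lemma manifold_topology_P: "manifold_topology P = subtopology (manifold_topology K) (points P)"
proof -
  have incl: "continuous_map (manifold_topology P) (manifold_topology K) (\<lambda>x. x)"
    by (rule continuous_map_smooth_at[OF atlas_P K smooth_at_inclusion])
  have "continuous_map (manifold_topology K) (manifold_topology M) r"
    by (rule continuous_map_smooth_at[OF K M smooth_r])
  moreover have "continuous_map (manifold_topology M) (manifold_topology P) F"
    by (rule continuous_map_smooth_at[OF M atlas_P smooth_at_F])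
  ultimately have ret: "continuous_map (manifold_topology K) (manifold_topology P) (F \<circ> r)"
    by (rule continuous_map_compose)
  have "openin (manifold_topology P) W \<longleftrightarrow> openin (subtopology (manifold_topology K) (points P)) W" for W
  proof
    assume W: "openin (manifold_topology P) W"
    have "openin (manifold_topology K) {k \<in> points K. F (r k) \<in> W}"
      using openin_continuous_map_preimage[OF ret W] by (simp add: topspace_manifold_topology[OF K])
    moreover have "W = {k \<in> points K. F (r k) \<in> W} \<inter> points P"
      using openin_subset[OF W] points_P_subset
      by (auto simp: topspace_manifold_topology[OF atlas_P] F_r subset_iff)
    ultimately show "openin (subtopology (manifold_topology K) (points P)) W"
      by (auto simp: openin_subtopology)
  next
    assume "openin (subtopology (manifold_topology K) (points P)) W"
    then obtain T where T: "openin (manifold_topology K) T" "W = T \<inter> points P"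
      by (auto simp: openin_subtopology)
    have "{x \<in> points P. x \<in> T} = W" using T(2) by auto
    then show "openin (manifold_topology P) W"
      using openin_continuous_map_preimage[OF incl T(1)]
      by (simp add: topspace_manifold_topology[OF atlas_P])
  qed
  then show ?thesis by (simp add: topology_eq)
qed

lemma smooth_manifold_P: "smooth_manifold P"
  using smooth_K atlas_P
  by (simp add: smooth_manifold_iff_atlas manifold_topology_P Hausdorff_space_subtopology
      second_countable_subtopology)

text \<open>A function smooth near \<open>q\<close> on the image is the restriction of its composite with \<open>F \<circ> r\<close>, so a
  tangent vector of the image is determined by its values on restrictions.\<close>

lemma inj_on_tangent_inclusion:
  assumes q: "q \<in> points P"
  shows "inj_on (tangent_map K (\<lambda>x. x) q) (tangent_space P q)"
proof (rule inj_onI)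
  fix u v assume u: "u \<in> tangent_space P q" and v: "v \<in> tangent_space P q"
    and eq: "tangent_map K (\<lambda>x. x) q u = tangent_map K (\<lambda>x. x) q v"
  obtain c where c: "smooth_at euclid P 0 c" "c 0 = q" "u = velocity P c"
    using u by (auto simp: tangent_space_iff[OF atlas_P])
  obtain d where d: "smooth_at euclid P 0 d" "d 0 = q" "v = velocity P d"
    using v by (auto simp: tangent_space_iff[OF atlas_P])
  show "u = v"
  proof
    fix h :: "'h \<Rightarrow> real"
    show "u h = v h"
    proof (cases "smooth_at P euclid q h")
      case True
      have "u h = u (\<lambda>k. h (F (r k)))" "v h = v (\<lambda>k. h (F (r k)))"
        unfolding c(3) d(3) using c d by (auto intro!: velocity_cong_points[OF atlas_P] simp: F_r)
      moreover have "u (\<lambda>k. h (F (r k))) = v (\<lambda>k. h (F (r k)))"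
        using fun_cong[OF eq, of "\<lambda>k. h (F (r k))"] smooth_at_extension[OF q True atlas_euclid]
        by (simp add: tangent_map_apply[OF K])
      ultimately show ?thesis by simp
    qed (use c d in \<open>simp add: velocity_apply[OF atlas_P]\<close>)
  qed
qed

lemma bij_betw_tangent_map:
  assumes p: "p \<in> points M"
  shows "bij_betw (tangent_map P F p) (tangent_space M p) (tangent_space P (F p))"
proof (rule bij_betw_byWitness[of _ "tangent_map M r (F p)"])
  have q: "F p \<in> points P" using p by (simp add: points_P)
  have F: "tangent_map P F p (velocity M c) = velocity P (\<lambda>t. F (c t))" if "c 0 = p" for c
    using that smooth_at_F[OF p] by (intro tangent_map_velocity[OF M atlas_P]) auto
  have r: "tangent_map M r (F p) (velocity P c) = velocity M (\<lambda>t. r (c t))" if "c 0 = F p" for c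
    using that smooth_at_r[OF q] by (intro tangent_map_velocity[OF atlas_P M]) auto
  have cF: "smooth_at euclid P 0 (\<lambda>t. F (c t))" if "smooth_at euclid M 0 c" "c 0 = p" for c
    using smooth_at_compose[OF atlas_euclid M atlas_P that(1)] smooth_at_F[OF p] that(2) by simp
  have cr: "smooth_at euclid M 0 (\<lambda>t. r (c t))" if "smooth_at euclid P 0 c" "c 0 = F p" for c
    using smooth_at_compose[OF atlas_euclid atlas_P M that(1)] smooth_at_r[OF q] that(2) by simp
  show "tangent_map P F p ` tangent_space M p \<subseteq> tangent_space P (F p)"
  proof (clarsimp simp: tangent_space_iff[OF M] tangent_space_iff[OF atlas_P])
    fix c assume c: "smooth_at euclid M (0 :: real) c" "p = c 0"
    show "\<exists>d. smooth_at euclid P (0 :: real) d \<and> d 0 = F (c 0) \<and>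
        tangent_map P F (c 0) (velocity M c) = velocity P d"
      using F[of c] cF[of c] c by (intro exI[of _ "\<lambda>t. F (c t)"]) simp
  qed
  show "tangent_map M r (F p) ` tangent_space P (F p) \<subseteq> tangent_space M p"
  proof safe
    fix v assume "v \<in> tangent_space P (F p)"
    then obtain c where c: "smooth_at euclid P 0 c" "c 0 = F p" "v = velocity P c"
      by (auto simp: tangent_space_iff[OF atlas_P])
    show "tangent_map M r (F p) v \<in> tangent_space M p"
      unfolding tangent_space_iff[OF M]
      using r[of c] cr[of c] c p by (intro exI[of _ "\<lambda>t. r (c t)"]) (simp add: retract)
  qed
  show "\<forall>v\<in>tangent_space M p. tangent_map M r (F p) (tangent_map P F p v) = v"
  proof
    fix v assume "v \<in> tangent_space M p"
    then obtain c where c: "smooth_at euclid M 0 c" "c 0 = p" "v = velocity M c"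
      by (auto simp: tangent_space_iff[OF M])
    have "tangent_map M r (F p) (tangent_map P F p v) h = v h" for h
    proof -
      have "v (\<lambda>x. h (r (F x))) = v h"
        unfolding c(3) by (rule velocity_cong_points[OF M c(1)]) (simp add: retract)
      moreover have "smooth_at P euclid (F p) (\<lambda>x. h (r x))" if "smooth_at M euclid p h"
        using that p by (intro smooth_at_compose[OF atlas_P M atlas_euclid smooth_at_r[OF q]]) (simp add: retract)
      moreover have "v h = 0" if "\<not> smooth_at M euclid p h"
        using that c by (simp add: velocity_apply[OF M])
      ultimately show ?thesis
        using p by (simp add: tangent_map_apply[OF M] tangent_map_apply[OF atlas_P] retract)
    qed
    then show "tangent_map M r (F p) (tangent_map P F p v) = v" by (rule ext)
  qed
  show "\<forall>v\<in>tangent_space P (F p). tangent_map P F p (tangent_map M r (F p) v) = v"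
  proof
    fix v assume "v \<in> tangent_space P (F p)"
    then obtain c where c: "smooth_at euclid P 0 c" "c 0 = F p" "v = velocity P c"
      by (auto simp: tangent_space_iff[OF atlas_P])
    have "tangent_map P F p (tangent_map M r (F p) v) h = v h" for h
    proof -
      have "v (\<lambda>x. h (F (r x))) = v h"
        unfolding c(3) by (rule velocity_cong_points[OF atlas_P c(1)]) (simp add: F_r)
      moreover have "smooth_at M euclid p (\<lambda>x. h (F x))" if "smooth_at P euclid (F p) h"
        using that by (intro smooth_at_compose[OF M atlas_P atlas_euclid smooth_at_F[OF p]])
      moreover have "v h = 0" if "\<not> smooth_at P euclid (F p) h"
        using that c by (simp add: velocity_apply[OF atlas_P])
      ultimately show ?thesis
        using p by (simp add: tangent_map_apply[OF M] tangent_map_apply[OF atlas_P] retract)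
    qed
    then show "tangent_map P F p (tangent_map M r (F p) v) = v" by (rule ext)
  qed
qed

end

definition embedded_group ::
  "('h, 'e::euclidean_space \<times> 'f::euclidean_space) lie_group_struct \<Rightarrow> ('m, 'e) manifold
    \<Rightarrow> ('m \<Rightarrow> 'h) \<Rightarrow> ('h \<Rightarrow> 'm) \<Rightarrow> ('h, 'e \<times> 'f) lie_group_struct" where
  "embedded_group K M F r = K\<lparr>carrier := F ` points M, mfd := image_manifold M F r\<rparr>"

lemma embedded_group_simps [simp]:
  "carrier (embedded_group K M F r) = F ` points M"
  "mfd (embedded_group K M F r) = image_manifold M F r"
  "\<one>\<^bsub>embedded_group K M F r\<^esub> = \<one>\<^bsub>K\<^esub>"
  "x \<otimes>\<^bsub>embedded_group K M F r\<^esub> y = x \<otimes>\<^bsub>K\<^esub> y"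
  by (simp_all add: embedded_group_def)

lemma lie_subgroup_embedded_group:
  assumes KG: "lie_group K" and emb: "retract_embedding M (mfd K) F r"
    and sub: "subgroup (F ` points M) K"
  shows "lie_subgroup (embedded_group K M F r) K"
proof -
  interpret retract_embedding M "mfd K" F r by (rule emb)
  interpret K: group K by (rule lie_groupD(1)[OF KG])
  interpret sub: subgroup "F ` points M" K by (rule sub)
  let ?E = "embedded_group K M F r"
  note PP = atlas_prod[OF atlas_P atlas_P]
  have grp: "group ?E"
  proof (rule groupI)
    fix x assume "x \<in> carrier ?E"
    then show "\<exists>y\<in>carrier ?E. y \<otimes>\<^bsub>?E\<^esub> x = \<one>\<^bsub>?E\<^esub>"
      using sub.m_inv_closed[of x] sub.mem_carrier[of x]
      by (intro bexI[of _ "inv\<^bsub>K\<^esub> x"]) (simp_all add: K.l_inv)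
  qed (simp_all add: sub.m_closed sub.one_closed sub.mem_carrier K.m_assoc)
  have inv: "inv\<^bsub>?E\<^esub> x = inv\<^bsub>K\<^esub> x" if "x \<in> F ` points M" for x
    using sub.m_inv_closed[of x] sub.mem_carrier[of x] that
    by (intro group.inv_equality[OF grp]) (simp_all add: K.l_inv)
  have mult: "smooth_at (manifold_prod P P) P z (\<lambda>(x, y). x \<otimes>\<^bsub>?E\<^esub> y)"
    if z: "z \<in> points P \<times> points P" for z
  proof -
    have f: "smooth_at (manifold_prod P P) (mfd K) z (\<lambda>z. fst z)"
      by (rule smooth_at_compose[OF PP atlas_P lie_groupD(3)[OF KG] smooth_at_prod_fst[OF atlas_P atlas_P z]])
        (use z smooth_at_inclusion in auto)
    have s: "smooth_at (manifold_prod P P) (mfd K) z (\<lambda>z. snd z)"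
      by (rule smooth_at_compose[OF PP atlas_P lie_groupD(3)[OF KG] smooth_at_prod_snd[OF atlas_P atlas_P z]])
        (use z smooth_at_inclusion in auto)
    have "smooth_at (manifold_prod P P) P z (\<lambda>z. fst z \<otimes>\<^bsub>K\<^esub> snd z)"
      by (rule smooth_at_into_image[OF PP smooth_at_mult[OF KG PP f s]])
        (auto simp: points_P sub.m_closed)
    then show ?thesis by (simp add: case_prod_unfold)
  qed
  have inv_smooth: "smooth_at P P x (m_inv ?E)" if x: "x \<in> points P" for x
  proof -
    have "smooth_at P P x (\<lambda>x. inv\<^bsub>K\<^esub> x)"
      by (rule smooth_at_into_image[OF atlas_P smooth_at_m_inv[OF KG atlas_P smooth_at_inclusion[OF x]]])
        (auto simp: points_P)
    then show ?thesis
      by (subst smooth_at_cong[OF atlas_P x, of _ "m_inv K"]) (auto simp: points_P inv)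
  qed
  have "smooth_map (manifold_prod P P) P (\<lambda>(x, y). x \<otimes>\<^bsub>?E\<^esub> y)"
    unfolding smooth_map_iff_smooth_at[OF PP atlas_P]
  proof
    fix z assume "z \<in> points (manifold_prod P P)"
    then show "smooth_at (manifold_prod P P) P z (\<lambda>(x, y). x \<otimes>\<^bsub>?E\<^esub> y)"
      by (intro mult) (simp only: points_manifold_prod)
  qed
  moreover have "smooth_map P P (m_inv ?E)"
    unfolding smooth_map_iff_smooth_at[OF atlas_P atlas_P] using inv_smooth by blast
  ultimately have "lie_group ?E"
    using grp smooth_manifold_P points_P by (simp add: lie_group_def)
  moreover have "smooth_map P (mfd K) (\<lambda>x. x)"
    unfolding smooth_map_iff_smooth_at[OF atlas_P lie_groupD(3)[OF KG]] using smooth_at_inclusion by blast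
  moreover have "?E = K\<lparr>carrier := carrier ?E, mfd := mfd ?E\<rparr>" by (simp add: embedded_group_def)
  ultimately show ?thesis
    using KG sub inj_on_tangent_inclusion manifold_topology_P points_P
    by (simp add: lie_subgroup_def)
qed

section \<open>Matched pairs from factorizations\<close>

text \<open>A factorization \<open>K = Q P\<close> is recorded by its component \<open>\<pi>\<close> in \<open>Q\<close>; the component in \<open>P\<close> is
  \<open>\<pi>(k)\<^sup>-\<^sup>1 k\<close>. The order \<open>Q P\<close> is the one in which the actions decompose a product \<open>p q\<close>.\<close>

locale group_factorization =
  fixes K :: "('h, 'e) lie_group_struct" (structure) and P Q :: "'h set" and \<pi> :: "'h \<Rightarrow> 'h"
  assumes group_K: "group K" and subgroup_P: "subgroup P K" and subgroup_Q: "subgroup Q K"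
    and proj_in_Q: "k \<in> carrier K \<Longrightarrow> \<pi> k \<in> Q"
    and coproj_in_P: "k \<in> carrier K \<Longrightarrow> inv (\<pi> k) \<otimes> k \<in> P"
    and proj_mult: "q \<in> Q \<Longrightarrow> p \<in> P \<Longrightarrow> \<pi> (q \<otimes> p) = q"
begin

sublocale group K by (rule group_K)
sublocale P: subgroup P K by (rule subgroup_P)
sublocale Q: subgroup Q K by (rule subgroup_Q)

definition coproj :: "'h \<Rightarrow> 'h" where "coproj k = inv (\<pi> k) \<otimes> k"

lemma coproj_mult: "q \<in> Q \<Longrightarrow> p \<in> P \<Longrightarrow> coproj (q \<otimes> p) = p"
  by (simp add: coproj_def proj_mult m_assoc[symmetric])

lemma coproj_closed: "k \<in> carrier K \<Longrightarrow> coproj k \<in> P"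
  by (simp add: coproj_def coproj_in_P)

lemma proj_coproj: "k \<in> carrier K \<Longrightarrow> \<pi> k \<otimes> coproj k = k"
  using Q.mem_carrier[OF proj_in_Q] by (simp add: coproj_def m_assoc[symmetric])

lemma proj_on_Q: "q \<in> Q \<Longrightarrow> \<pi> q = q"
  using proj_mult[of q \<one>] by simp

lemma proj_on_P: "p \<in> P \<Longrightarrow> \<pi> p = \<one>"
  using proj_mult[of \<one> p] by simp

lemma coproj_on_P: "p \<in> P \<Longrightarrow> coproj p = p"
  by (simp add: coproj_def proj_on_P)

lemma coproj_on_Q: "q \<in> Q \<Longrightarrow> coproj q = \<one>"
  by (simp add: coproj_def proj_on_Q)

lemma factors_eqI:
  assumes "p \<in> P" "q \<in> Q" "q' \<in> Q" "p' \<in> P" "p \<otimes> q = q' \<otimes> p'"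
  shows "factor_lact K P Q p q = q'" "factor_ract K P Q p q = p'"
proof -
  have uniq: "q'' = q' \<and> p'' = p'" if "q'' \<in> Q" "p'' \<in> P" "p \<otimes> q = q'' \<otimes> p''" for q'' p''
    using that assms proj_mult coproj_mult by metis
  show "factor_lact K P Q p q = q'"
    unfolding factor_lact_def by (rule the_equality) (use assms uniq in blast)+
  show "factor_ract K P Q p q = p'"
    unfolding factor_ract_def by (rule the_equality) (use assms uniq in blast)+
qed

abbreviation "lact \<equiv> factor_lact K P Q"
abbreviation "ract \<equiv> factor_ract K P Q"

lemma lact_eq: "p \<in> P \<Longrightarrow> q \<in> Q \<Longrightarrow> lact p q = \<pi> (p \<otimes> q)"
  and ract_eq: "p \<in> P \<Longrightarrow> q \<in> Q \<Longrightarrow> ract p q = coproj (p \<otimes> q)"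
  using factors_eqI[of p q "\<pi> (p \<otimes> q)" "coproj (p \<otimes> q)"]
  by (simp_all add: proj_in_Q coproj_closed proj_coproj)

lemma lact_closed: "p \<in> P \<Longrightarrow> q \<in> Q \<Longrightarrow> lact p q \<in> Q"
  and ract_closed: "p \<in> P \<Longrightarrow> q \<in> Q \<Longrightarrow> ract p q \<in> P"
  by (simp_all add: lact_eq ract_eq proj_in_Q coproj_closed)

lemma lact_ract: "p \<in> P \<Longrightarrow> q \<in> Q \<Longrightarrow> p \<otimes> q = lact p q \<otimes> ract p q"
  by (simp add: lact_eq ract_eq proj_coproj)

lemma lact_one: "q \<in> Q \<Longrightarrow> lact \<one> q = q"
  and ract_one: "p \<in> P \<Longrightarrow> ract p \<one> = p"
  and lact_one_right: "p \<in> P \<Longrightarrow> lact p \<one> = \<one>"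
  and ract_one_left: "q \<in> Q \<Longrightarrow> ract \<one> q = \<one>"
  using factors_eqI[of \<one> q q \<one>] factors_eqI[of p \<one> \<one> p] by simp_all

lemma lact_ract_mult_left:
  assumes "p1 \<in> P" "p2 \<in> P" "q \<in> Q"
  shows "lact (p1 \<otimes> p2) q = lact p1 (lact p2 q)"
    "ract (p1 \<otimes> p2) q = ract p1 (lact p2 q) \<otimes> ract p2 q"
proof -
  note c = lact_closed ract_closed
  have "p1 \<otimes> p2 \<otimes> q = p1 \<otimes> (lact p2 q \<otimes> ract p2 q)"
    using assms lact_ract[OF assms(2,3)] by (simp add: m_assoc)
  also have "\<dots> = (p1 \<otimes> lact p2 q) \<otimes> ract p2 q"
    using assms c by (simp add: m_assoc)
  also have "\<dots> = lact p1 (lact p2 q) \<otimes> ract p1 (lact p2 q) \<otimes> ract p2 q"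
    using assms c lact_ract[of p1 "lact p2 q"] by simp
  finally have "p1 \<otimes> p2 \<otimes> q = lact p1 (lact p2 q) \<otimes> (ract p1 (lact p2 q) \<otimes> ract p2 q)"
    using assms c by (simp add: m_assoc)
  from factors_eqI[OF _ _ _ _ this] show "lact (p1 \<otimes> p2) q = lact p1 (lact p2 q)"
    "ract (p1 \<otimes> p2) q = ract p1 (lact p2 q) \<otimes> ract p2 q"
    using assms c by simp_all
qed

lemma lact_ract_mult_right:
  assumes "p \<in> P" "q1 \<in> Q" "q2 \<in> Q"
  shows "ract p (q1 \<otimes> q2) = ract (ract p q1) q2"
    "lact p (q1 \<otimes> q2) = lact p q1 \<otimes> lact (ract p q1) q2"
proof -
  note c = lact_closed ract_closed
  have "p \<otimes> (q1 \<otimes> q2) = (lact p q1 \<otimes> ract p q1) \<otimes> q2"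
    using assms lact_ract[OF assms(1,2)] by (simp add: m_assoc[symmetric])
  also have "\<dots> = lact p q1 \<otimes> (ract p q1 \<otimes> q2)"
    using assms c by (simp add: m_assoc)
  also have "\<dots> = lact p q1 \<otimes> (lact (ract p q1) q2 \<otimes> ract (ract p q1) q2)"
    using assms c lact_ract[of "ract p q1" q2] by simp
  finally have "p \<otimes> (q1 \<otimes> q2) = (lact p q1 \<otimes> lact (ract p q1) q2) \<otimes> ract (ract p q1) q2"
    using assms c by (simp add: m_assoc)
  from factors_eqI[OF _ _ _ _ this] show "ract p (q1 \<otimes> q2) = ract (ract p q1) q2"
    "lact p (q1 \<otimes> q2) = lact p q1 \<otimes> lact (ract p q1) q2"
    using assms c by simp_all
qed

text \<open>Inverting \<open>k\<^sup>-\<^sup>1 = \<pi>(k\<^sup>-\<^sup>1) coproj(k\<^sup>-\<^sup>1)\<close> factors \<open>k\<close> in the order \<open>P Q\<close>.\<close>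

definition split :: "'h \<Rightarrow> 'h \<times> 'h" where
  "split k = (inv (coproj (inv k)), inv (\<pi> (inv k)))"

lemma split_mult: "p \<in> P \<Longrightarrow> q \<in> Q \<Longrightarrow> split (p \<otimes> q) = (p, q)"
  by (simp add: split_def inv_mult_group proj_mult coproj_mult)

lemma split_closed: "k \<in> carrier K \<Longrightarrow> split k \<in> P \<times> Q"
  by (simp add: split_def proj_in_Q coproj_closed)

lemma mult_split: "k \<in> carrier K \<Longrightarrow> (case split k of (p, q) \<Rightarrow> p \<otimes> q) = k"
  using proj_coproj[of "inv k"]
  by (simp add: split_def inv_mult_group[symmetric] proj_in_Q coproj_closed)

lemma bij_betw_mult: "bij_betw (\<lambda>(p, q). p \<otimes> q) (P \<times> Q) (carrier K)"
  by (rule bij_betw_byWitness[of _ split]) 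
    (use split_closed mult_split in \<open>auto simp: split_mult image_subset_iff\<close>)

end

lemma lie_subgroupD:
  assumes "lie_subgroup P K"
  shows "lie_group K" "lie_group P" "subgroup (carrier P) K"
    "\<one>\<^bsub>P\<^esub> = \<one>\<^bsub>K\<^esub>" "x \<otimes>\<^bsub>P\<^esub> y = x \<otimes>\<^bsub>K\<^esub> y"
    "x \<in> carrier P \<Longrightarrow> inv\<^bsub>P\<^esub> x = inv\<^bsub>K\<^esub> x"
    "x \<in> carrier P \<Longrightarrow> smooth_at (mfd P) (mfd K) x (\<lambda>x. x)"
proof -
  show L: "lie_group K" "lie_group P" "subgroup (carrier P) K"
    using assms by (auto simp: lie_subgroup_def)
  have eq: "P = K\<lparr>carrier := carrier P, mfd := mfd P\<rparr>"
    using assms unfolding lie_subgroup_def by blast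
  show one: "\<one>\<^bsub>P\<^esub> = \<one>\<^bsub>K\<^esub>" and mult: "\<And>x y. x \<otimes>\<^bsub>P\<^esub> y = x \<otimes>\<^bsub>K\<^esub> y"
    by (subst eq, simp)+
  interpret K: group K by (rule lie_groupD(1)[OF L(1)])
  interpret P: group P by (rule lie_groupD(1)[OF L(2)])
  interpret S: subgroup "carrier P" K by (rule L(3))
  show "inv\<^bsub>P\<^esub> x = inv\<^bsub>K\<^esub> x" if "x \<in> carrier P"
    using that by (intro P.inv_equality) (simp_all add: one mult)
  show "x \<in> carrier P \<Longrightarrow> smooth_at (mfd P) (mfd K) x (\<lambda>x. x)"
    using assms lie_groupD(3,4)[OF L(1)] lie_groupD(3,4)[OF L(2)]
    by (simp add: lie_subgroup_def smooth_map_iff_smooth_at)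
qed

locale lie_group_factorization =
  group_factorization K "carrier P" "carrier Q" \<pi>
  for K P Q :: "('h, 'e::euclidean_space) lie_group_struct" and \<pi> +
  assumes sub_P: "lie_subgroup P K" and sub_Q: "lie_subgroup Q K"
    and smooth_proj: "k \<in> carrier K \<Longrightarrow> smooth_at (mfd K) (mfd Q) k \<pi>"
    and smooth_coproj: "k \<in> carrier K \<Longrightarrow> smooth_at (mfd K) (mfd P) k (\<lambda>k. inv\<^bsub>K\<^esub> (\<pi> k) \<otimes>\<^bsub>K\<^esub> k)"
begin

lemmas LK = lie_subgroupD(1)[OF sub_P] and LP = lie_subgroupD(2)[OF sub_P]
  and LQ = lie_subgroupD(2)[OF sub_Q]
lemmas AK = lie_groupD(3)[OF LK] and AP = lie_groupD(3)[OF LP] and AQ = lie_groupD(3)[OF LQ]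
lemmas pK [simp] = lie_groupD(4)[OF LK] and pP [simp] = lie_groupD(4)[OF LP]
  and pQ [simp] = lie_groupD(4)[OF LQ]
lemmas opP [simp] = lie_subgroupD(4,5)[OF sub_P] and opQ [simp] = lie_subgroupD(4,5)[OF sub_Q]
lemmas APQ = atlas_prod[OF AP AQ]

lemma smooth_at_coproj: "k \<in> carrier K \<Longrightarrow> smooth_at (mfd K) (mfd P) k coproj"
  using smooth_coproj unfolding coproj_def .

lemma smooth_at_mult_PQ:
  assumes "z \<in> carrier P \<times> carrier Q"
  shows "smooth_at (manifold_prod (mfd P) (mfd Q)) (mfd K) z (\<lambda>z. fst z \<otimes>\<^bsub>K\<^esub> snd z)"
proof (rule smooth_at_mult[OF LK APQ])
  have z: "z \<in> points (mfd P) \<times> points (mfd Q)" using assms by simp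
  show "smooth_at (manifold_prod (mfd P) (mfd Q)) (mfd K) z fst"
    using smooth_at_compose[OF APQ AP AK smooth_at_prod_fst[OF AP AQ z] lie_subgroupD(7)[OF sub_P]]
      assms by (auto simp: mem_Times_iff)
  show "smooth_at (manifold_prod (mfd P) (mfd Q)) (mfd K) z snd"
    using smooth_at_compose[OF APQ AQ AK smooth_at_prod_snd[OF AP AQ z] lie_subgroupD(7)[OF sub_Q]]
      assms by (auto simp: mem_Times_iff)
qed

lemma smooth_at_lact:
  assumes "z \<in> carrier P \<times> carrier Q"
  shows "smooth_at (manifold_prod (mfd P) (mfd Q)) (mfd Q) z (\<lambda>(p, q). lact p q)"
proof -
  have "smooth_at (manifold_prod (mfd P) (mfd Q)) (mfd Q) z (\<lambda>z. \<pi> (fst z \<otimes>\<^bsub>K\<^esub> snd z))"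
    by (rule smooth_at_compose[OF APQ AK AQ smooth_at_mult_PQ[OF assms]])
      (use assms in \<open>auto intro: smooth_proj\<close>)
  then show ?thesis
    using assms
    by (subst smooth_at_cong[OF APQ, of _ _ "\<lambda>z. \<pi> (fst z \<otimes>\<^bsub>K\<^esub> snd z)"]) (auto simp: lact_eq)
qed

lemma smooth_at_ract:
  assumes "z \<in> carrier P \<times> carrier Q"
  shows "smooth_at (manifold_prod (mfd P) (mfd Q)) (mfd P) z (\<lambda>(p, q). ract p q)"
proof -
  have "smooth_at (manifold_prod (mfd P) (mfd Q)) (mfd P) z (\<lambda>z. coproj (fst z \<otimes>\<^bsub>K\<^esub> snd z))"
    by (rule smooth_at_compose[OF APQ AK AP smooth_at_mult_PQ[OF assms]])
      (use assms in \<open>auto intro: smooth_at_coproj\<close>)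
  then show ?thesis
    using assms
    by (subst smooth_at_cong[OF APQ, of _ _ "\<lambda>z. coproj (fst z \<otimes>\<^bsub>K\<^esub> snd z)"]) (auto simp: ract_eq)
qed

lemma matched_pair_groups: "matched_pair_lie_groups P Q lact ract"
proof -
  have "smooth_map (manifold_prod (mfd P) (mfd Q)) (mfd Q) (\<lambda>(p, q). lact p q)"
    "smooth_map (manifold_prod (mfd P) (mfd Q)) (mfd P) (\<lambda>(p, q). ract p q)"
    unfolding smooth_map_iff_smooth_at[OF APQ AQ] smooth_map_iff_smooth_at[OF APQ AP]
    by (intro ballI smooth_at_lact smooth_at_ract; simp only: points_manifold_prod pP pQ)+
  then show ?thesis
    using LP LQ
    by (simp add: matched_pair_lie_groups_def lact_one ract_one lact_ract_mult_left
        lact_ract_mult_right)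
qed

lemma smooth_at_split:
  assumes k: "k \<in> carrier K"
  shows "smooth_at (mfd K) (manifold_prod (mfd P) (mfd Q)) k split"
proof -
  have i: "smooth_at (mfd K) (mfd K) k (\<lambda>k. inv\<^bsub>K\<^esub> k)" by (rule lie_groupD(6)[OF LK k])
  have "smooth_at (mfd K) (mfd P) k (\<lambda>k. coproj (inv\<^bsub>K\<^esub> k))"
    by (rule smooth_at_compose[OF AK AK AP i]) (use k in \<open>auto intro: smooth_at_coproj\<close>)
  then have "smooth_at (mfd K) (mfd P) k (\<lambda>k. inv\<^bsub>P\<^esub> (coproj (inv\<^bsub>K\<^esub> k)))"
    by (rule smooth_at_m_inv[OF LP AK])
  moreover have "smooth_at (mfd K) (mfd Q) k (\<lambda>k. \<pi> (inv\<^bsub>K\<^esub> k))"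
    by (rule smooth_at_compose[OF AK AK AQ i]) (use k in \<open>auto intro: smooth_proj\<close>)
  then have "smooth_at (mfd K) (mfd Q) k (\<lambda>k. inv\<^bsub>Q\<^esub> (\<pi> (inv\<^bsub>K\<^esub> k)))"
    by (rule smooth_at_m_inv[OF LQ AK])
  ultimately have "smooth_at (mfd K) (manifold_prod (mfd P) (mfd Q)) k
      (\<lambda>k. (inv\<^bsub>P\<^esub> (coproj (inv\<^bsub>K\<^esub> k)), inv\<^bsub>Q\<^esub> (\<pi> (inv\<^bsub>K\<^esub> k))))"
    by (rule smooth_at_Pair[OF AK AP AQ])
  then show ?thesis
    using k
    by (subst smooth_at_cong[OF AK, of _ _
          "\<lambda>k. (inv\<^bsub>P\<^esub> (coproj (inv\<^bsub>K\<^esub> k)), inv\<^bsub>Q\<^esub> (\<pi> (inv\<^bsub>K\<^esub> k)))"])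
      (auto simp: split_def lie_subgroupD(6)[OF sub_P] lie_subgroupD(6)[OF sub_Q]
        coproj_closed proj_in_Q)
qed

lemma diffeomorphism_mult:
  "diffeomorphism (manifold_prod (mfd P) (mfd Q)) (mfd K) (\<lambda>(p, q). p \<otimes>\<^bsub>K\<^esub> q)"
proof -
  let ?f = "\<lambda>(p, q). p \<otimes>\<^bsub>K\<^esub> q"
  have bij: "bij_betw ?f (carrier P \<times> carrier Q) (carrier K)" by (rule bij_betw_mult)
  have "smooth_map (manifold_prod (mfd P) (mfd Q)) (mfd K) ?f"
    unfolding smooth_map_iff_smooth_at[OF APQ AK] case_prod_unfold
    by (intro ballI smooth_at_mult_PQ) (simp only: points_manifold_prod pP pQ)
  moreover have "smooth_map (mfd K) (manifold_prod (mfd P) (mfd Q))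
      (inv_into (carrier P \<times> carrier Q) ?f)"
    unfolding smooth_map_iff_smooth_at[OF AK APQ] pK
  proof
    fix k assume k: "k \<in> carrier K"
    have "inv_into (carrier P \<times> carrier Q) ?f k = split k" if "k \<in> carrier K" for k
      using bij_betw_imp_inj_on[OF bij] mult_split[OF that] split_closed[OF that]
      by (intro inv_into_f_eq) auto
    then show "smooth_at (mfd K) (manifold_prod (mfd P) (mfd Q)) k
        (inv_into (carrier P \<times> carrier Q) ?f)"
      using smooth_at_split[OF k] k by (subst smooth_at_cong[OF AK, of _ _ split]) auto
  qed
  ultimately show ?thesis using bij by (simp add: diffeomorphism_def)
qed

end

section \<open>Splittings of Lie algebras\<close>

text \<open>Finite dimension passes to subspaces: a maximal independent subset is no larger than a spanning
  set of the whole space.\<close>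

lemma lie_subalgebra_lie_algebra:
  assumes "lie_subalgebra T S br" shows "lie_algebra T br"
proof -
  have S: "lie_algebra S br" and T: "T \<subseteq> S" "subspace T" "\<And>x y. x \<in> T \<Longrightarrow> y \<in> T \<Longrightarrow> br x y \<in> T"
    using assms by (auto simp: lie_subalgebra_def)
  obtain X where X: "finite X" "span X = S" using S by (auto simp: lie_algebra_def)
  obtain C where C: "C \<subseteq> T" "independent C" "T \<subseteq> span C" using maximal_independent_subset by blast
  have "finite C"
    using independent_span_bound[OF X(1) C(2)] C(1) T(1) X(2) by blast
  moreover have "span C = T" using C T(2) span_minimal[of C T] by blast
  ultimately have "\<exists>X. finite X \<and> span X = T" by blast
  moreover have "linear_on T f" if "linear_on S f" for f :: "'a \<Rightarrow> 'a"
    using that T(1) unfolding linear_on_def by blast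
  ultimately show ?thesis
    using S T unfolding lie_algebra_def by (auto simp: subset_iff)
qed

locale lie_splitting =
  fixes S \<pp> \<qq> :: "'a::real_vector set" and br :: "'a \<Rightarrow> 'a \<Rightarrow> 'a"
  assumes sub_\<pp>: "lie_subalgebra \<pp> S br" and sub_\<qq>: "lie_subalgebra \<qq> S br"
    and complementary: "complementary_subspaces S \<pp> \<qq>"
begin

abbreviation "\<rho> \<equiv> splitting_rho \<pp> \<qq> br"
abbreviation "\<mu> \<equiv> splitting_mu \<pp> \<qq> br"

lemma subspaces: "subspace S" "subspace \<pp>" "subspace \<qq>" "\<pp> \<subseteq> S" "\<qq> \<subseteq> S"
  using sub_\<pp> sub_\<qq> by (auto simp: lie_subalgebra_def lie_algebra_def)

lemma bracket:
  "x \<in> S \<Longrightarrow> y \<in> S \<Longrightarrow> br x y \<in> S"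
  "x \<in> S \<Longrightarrow> y \<in> S \<Longrightarrow> z \<in> S \<Longrightarrow> br x (y + z) = br x y + br x z"
  "x \<in> S \<Longrightarrow> y \<in> S \<Longrightarrow> z \<in> S \<Longrightarrow> br (x + y) z = br x z + br y z"
  "x \<in> S \<Longrightarrow> y \<in> S \<Longrightarrow> br x (c *\<^sub>R y) = c *\<^sub>R br x y"
  "x \<in> S \<Longrightarrow> y \<in> S \<Longrightarrow> br (c *\<^sub>R x) y = c *\<^sub>R br x y"
  "x \<in> S \<Longrightarrow> br x x = 0"
  "x \<in> S \<Longrightarrow> y \<in> S \<Longrightarrow> z \<in> S \<Longrightarrow> br x (br y z) + br y (br z x) + br z (br x y) = 0"
  using sub_\<pp> unfolding lie_subalgebra_def lie_algebra_def linear_on_def by blast+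

lemma bracket_diff:
  assumes "x \<in> S" "y \<in> S" "z \<in> S"
  shows "br x (y - z) = br x y - br x z" "br (x - y) z = br x z - br y z"
proof -
  have "br x ((y - z) + z) = br x (y - z) + br x z" "br ((x - y) + y) z = br (x - y) z + br y z"
    using assms subspace_diff[OF subspaces(1)] by (intro bracket; simp)+
  then show "br x (y - z) = br x y - br x z" "br (x - y) z = br x z - br y z" by simp_all
qed

lemma bracket_anti:
  assumes "x \<in> S" "y \<in> S" shows "br x y = - br y x"
proof -
  have "0 = br (x + y) (x + y)" using assms subspace_add[OF subspaces(1)] by (simp add: bracket)
  also have "\<dots> = br x y + br y x"
    using assms subspace_add[OF subspaces(1)] bracket(3)[of x y "x + y"] bracket(2)[of x x y]
      bracket(2)[of y x y] by (simp add: bracket(6))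
  finally show ?thesis by (simp add: eq_neg_iff_add_eq_0)
qed

lemma jacobi:
  assumes "x \<in> S" "y \<in> S" "z \<in> S"
  shows "br (br x y) z = br x (br y z) - br y (br x z)"
proof -
  have "br z (br x y) = - br (br x y) z" "br y (br z x) = - br y (br x z)"
    using assms bracket_anti[of z "br x y"] bracket_anti[of z x] bracket(1)
      bracket(4)[of y "br x z" "-1"] by auto
  then show ?thesis using bracket(7)[OF assms] by (simp add: algebra_simps)
qed

lemma in_sub:
  "x \<in> \<pp> \<Longrightarrow> x \<in> S" "\<xi> \<in> \<qq> \<Longrightarrow> \<xi> \<in> S"
  "x \<in> \<pp> \<Longrightarrow> y \<in> \<pp> \<Longrightarrow> br x y \<in> \<pp>" "\<xi> \<in> \<qq> \<Longrightarrow> \<eta> \<in> \<qq> \<Longrightarrow> br \<xi> \<eta> \<in> \<qq>"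
  using sub_\<pp> sub_\<qq> by (auto simp: lie_subalgebra_def)

lemma components_unique:
  assumes "\<xi> \<in> \<qq>" "x \<in> \<pp>" "\<eta> \<in> \<qq>" "y \<in> \<pp>" "\<xi> - x = \<eta> - y"
  shows "\<xi> = \<eta>" "x = y"
proof -
  have "\<xi> - \<eta> = x - y" using assms(5) by (simp add: algebra_simps)
  moreover have "\<xi> - \<eta> \<in> \<qq>" "x - y \<in> \<pp>"
    using assms by (auto intro: subspace_diff[OF subspaces(2)] subspace_diff[OF subspaces(3)])
  ultimately have "\<xi> - \<eta> \<in> \<pp> \<inter> \<qq>" by simp
  moreover have "\<pp> \<inter> \<qq> = {0}"
    using complementary unfolding complementary_subspaces_def by (elim conjE)
  ultimately have "\<xi> - \<eta> = 0" by blast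
  then show "\<xi> = \<eta>" "x = y" using assms(5) by auto
qed

lemma components_exist:
  assumes "z \<in> S" obtains \<xi> x where "\<xi> \<in> \<qq>" "x \<in> \<pp>" "z = \<xi> - x"
proof -
  have "z \<in> {x + y | x y. x \<in> \<pp> \<and> y \<in> \<qq>}"
    using complementary assms unfolding complementary_subspaces_def by simp
  then obtain x y where "x \<in> \<pp>" "y \<in> \<qq>" "z = x + y" by blast
  then have "y \<in> \<qq>" "- x \<in> \<pp>" "z = y - (- x)" using subspace_neg[OF subspaces(2)] by auto
  then show ?thesis using that by blast
qed

lemma \<rho>\<mu>_eqI:
  assumes "x \<in> \<pp>" "\<xi> \<in> \<qq>" "\<eta> \<in> \<qq>" "y \<in> \<pp>" "br x \<xi> = \<eta> - y"
  shows "\<rho> x \<xi> = \<eta>" "\<mu> \<xi> x = y"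
proof -
  show "\<rho> x \<xi> = \<eta>"
    unfolding splitting_rho_def
    by (rule the_equality) (use assms components_unique in metis)+
  show "\<mu> \<xi> x = y"
    unfolding splitting_mu_def
    by (rule the_equality) (use assms components_unique in metis)+
qed

lemma \<rho>\<mu>:
  assumes "x \<in> \<pp>" "\<xi> \<in> \<qq>"
  shows "\<rho> x \<xi> \<in> \<qq>" "\<mu> \<xi> x \<in> \<pp>" "br x \<xi> = \<rho> x \<xi> - \<mu> \<xi> x"
proof -
  have "br x \<xi> \<in> S" using assms by (intro bracket in_sub)
  then obtain \<eta> y where "\<eta> \<in> \<qq>" "y \<in> \<pp>" "br x \<xi> = \<eta> - y" by (rule components_exist)
  moreover from this have "\<rho> x \<xi> = \<eta>" "\<mu> \<xi> x = y" using \<rho>\<mu>_eqI assms by blast+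
  ultimately show "\<rho> x \<xi> \<in> \<qq>" "\<mu> \<xi> x \<in> \<pp>" "br x \<xi> = \<rho> x \<xi> - \<mu> \<xi> x" by auto
qed

lemma \<rho>\<mu>_linear:
  assumes "x \<in> \<pp>" "\<xi> \<in> \<qq>"
  shows "y \<in> \<pp> \<Longrightarrow> \<rho> (x + y) \<xi> = \<rho> x \<xi> + \<rho> y \<xi> \<and> \<mu> \<xi> (x + y) = \<mu> \<xi> x + \<mu> \<xi> y"
    and "\<eta> \<in> \<qq> \<Longrightarrow> \<rho> x (\<xi> + \<eta>) = \<rho> x \<xi> + \<rho> x \<eta> \<and> \<mu> (\<xi> + \<eta>) x = \<mu> \<xi> x + \<mu> \<eta> x"
    and "\<rho> (c *\<^sub>R x) \<xi> = c *\<^sub>R \<rho> x \<xi> \<and> \<mu> \<xi> (c *\<^sub>R x) = c *\<^sub>R \<mu> \<xi> x"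
    and "\<rho> x (c *\<^sub>R \<xi>) = c *\<^sub>R \<rho> x \<xi> \<and> \<mu> (c *\<^sub>R \<xi>) x = c *\<^sub>R \<mu> \<xi> x"
proof -
  note sp = subspace_add[OF subspaces(2)] subspace_add[OF subspaces(3)]
    subspace_scale[OF subspaces(2)] subspace_scale[OF subspaces(3)]
  note \<rho>\<mu>_closed = \<rho>\<mu>(1,2)
  show "\<rho> (x + y) \<xi> = \<rho> x \<xi> + \<rho> y \<xi> \<and> \<mu> \<xi> (x + y) = \<mu> \<xi> x + \<mu> \<xi> y" if y: "y \<in> \<pp>"
  proof -
    have "br (x + y) \<xi> = (\<rho> x \<xi> + \<rho> y \<xi>) - (\<mu> \<xi> x + \<mu> \<xi> y)"
      using assms y by (simp add: bracket in_sub \<rho>\<mu>(3))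
    from \<rho>\<mu>_eqI[OF _ _ _ _ this] show ?thesis
      using assms y by (simp add: sp \<rho>\<mu>_closed)
  qed
  show "\<rho> x (\<xi> + \<eta>) = \<rho> x \<xi> + \<rho> x \<eta> \<and> \<mu> (\<xi> + \<eta>) x = \<mu> \<xi> x + \<mu> \<eta> x" if y: "\<eta> \<in> \<qq>"
  proof -
    have "br x (\<xi> + \<eta>) = (\<rho> x \<xi> + \<rho> x \<eta>) - (\<mu> \<xi> x + \<mu> \<eta> x)"
      using assms y by (simp add: bracket in_sub \<rho>\<mu>(3))
    from \<rho>\<mu>_eqI[OF _ _ _ _ this] show ?thesis
      using assms y by (simp add: sp \<rho>\<mu>_closed)
  qed
  have eq: "br (c *\<^sub>R x) \<xi> = c *\<^sub>R \<rho> x \<xi> - c *\<^sub>R \<mu> \<xi> x" "br x (c *\<^sub>R \<xi>) = c *\<^sub>R \<rho> x \<xi> - c *\<^sub>R \<mu> \<xi> x"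
    using assms by (simp_all add: bracket in_sub \<rho>\<mu>(3) scaleR_diff_right)
  from \<rho>\<mu>_eqI[OF _ _ _ _ eq(1)] \<rho>\<mu>_eqI[OF _ _ _ _ eq(2)]
  show "\<rho> (c *\<^sub>R x) \<xi> = c *\<^sub>R \<rho> x \<xi> \<and> \<mu> \<xi> (c *\<^sub>R x) = c *\<^sub>R \<mu> \<xi> x"
    "\<rho> x (c *\<^sub>R \<xi>) = c *\<^sub>R \<rho> x \<xi> \<and> \<mu> (c *\<^sub>R \<xi>) x = c *\<^sub>R \<mu> \<xi> x"
    using assms by (simp_all add: sp \<rho>\<mu>_closed)
qed

text \<open>Comparing the components of the Jacobi identity for two elements of \<open>\<pp>\<close> and one of \<open>\<qq>\<close>
  shows that \<open>\<rho>\<close> is a representation and gives the compatibility condition for \<open>\<mu>\<close>. With one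
  element of \<open>\<pp>\<close> and two of \<open>\<qq>\<close> the components are the other two conditions.\<close>

lemma jacobi_components_\<pp>:
  assumes "x \<in> \<pp>" "y \<in> \<pp>" "\<xi> \<in> \<qq>"
  shows "\<rho> (br x y) \<xi> = \<rho> x (\<rho> y \<xi>) - \<rho> y (\<rho> x \<xi>)"
    and "\<mu> \<xi> (br x y) = br (\<mu> \<xi> x) y + br x (\<mu> \<xi> y) + \<mu> (\<rho> y \<xi>) x - \<mu> (\<rho> x \<xi>) y"
proof -
  note c = \<rho>\<mu>(1,2) in_sub
  have "br (br x y) \<xi> = br x (\<rho> y \<xi> - \<mu> \<xi> y) - br y (\<rho> x \<xi> - \<mu> \<xi> x)"
    using assms c by (simp add: jacobi flip: \<rho>\<mu>(3))
  also have "\<dots> = br x (\<rho> y \<xi>) - br x (\<mu> \<xi> y) - (br y (\<rho> x \<xi>) - br y (\<mu> \<xi> x))"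
    using assms c by (simp add: bracket_diff)
  also have "\<dots> = (\<rho> x (\<rho> y \<xi>) - \<rho> y (\<rho> x \<xi>)) -
      (br (\<mu> \<xi> x) y + br x (\<mu> \<xi> y) + \<mu> (\<rho> y \<xi>) x - \<mu> (\<rho> x \<xi>) y)"
    using assms c bracket_anti[of "\<mu> \<xi> x" y] by (simp add: \<rho>\<mu>(3))
  finally have eq: "br (br x y) \<xi> = \<dots>" .
  have "\<rho> x (\<rho> y \<xi>) - \<rho> y (\<rho> x \<xi>) \<in> \<qq>"
    "br (\<mu> \<xi> x) y + br x (\<mu> \<xi> y) + \<mu> (\<rho> y \<xi>) x - \<mu> (\<rho> x \<xi>) y \<in> \<pp>"
    using assms
    by (auto intro!: subspace_add[OF subspaces(2)] subspace_diff[OF subspaces(2)]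
        subspace_diff[OF subspaces(3)] c)
  from \<rho>\<mu>_eqI[OF in_sub(3)[OF assms(1,2)] assms(3) this eq]
  show "\<rho> (br x y) \<xi> = \<rho> x (\<rho> y \<xi>) - \<rho> y (\<rho> x \<xi>)"
    "\<mu> \<xi> (br x y) = br (\<mu> \<xi> x) y + br x (\<mu> \<xi> y) + \<mu> (\<rho> y \<xi>) x - \<mu> (\<rho> x \<xi>) y" .
qed

lemma jacobi_components_\<qq>:
  assumes "x \<in> \<pp>" "\<xi> \<in> \<qq>" "\<eta> \<in> \<qq>"
  shows "\<rho> x (br \<xi> \<eta>) = br (\<rho> x \<xi>) \<eta> + br \<xi> (\<rho> x \<eta>) + \<rho> (\<mu> \<eta> x) \<xi> - \<rho> (\<mu> \<xi> x) \<eta>"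
    and "\<mu> (br \<xi> \<eta>) x = \<mu> \<xi> (\<mu> \<eta> x) - \<mu> \<eta> (\<mu> \<xi> x)"
proof -
  note c = \<rho>\<mu>(1,2) in_sub
  have "br x (br \<xi> \<eta>) = br (br x \<xi>) \<eta> + br \<xi> (br x \<eta>)"
    using assms c by (simp add: jacobi)
  also have "\<dots> = br (\<rho> x \<xi> - \<mu> \<xi> x) \<eta> + br \<xi> (\<rho> x \<eta> - \<mu> \<eta> x)"
    using assms by (simp add: \<rho>\<mu>(3))
  also have "\<dots> = br (\<rho> x \<xi>) \<eta> - br (\<mu> \<xi> x) \<eta> + (br \<xi> (\<rho> x \<eta>) - br \<xi> (\<mu> \<eta> x))"
    using assms c by (simp add: bracket_diff)
  also have "\<dots> = (br (\<rho> x \<xi>) \<eta> + br \<xi> (\<rho> x \<eta>) + \<rho> (\<mu> \<eta> x) \<xi> - \<rho> (\<mu> \<xi> x) \<eta>) -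
      (\<mu> \<xi> (\<mu> \<eta> x) - \<mu> \<eta> (\<mu> \<xi> x))"
    using assms c bracket_anti[of \<xi> "\<mu> \<eta> x"] by (simp add: \<rho>\<mu>(3))
  finally have eq: "br x (br \<xi> \<eta>) = \<dots>" .
  have "br (\<rho> x \<xi>) \<eta> + br \<xi> (\<rho> x \<eta>) + \<rho> (\<mu> \<eta> x) \<xi> - \<rho> (\<mu> \<xi> x) \<eta> \<in> \<qq>"
    "\<mu> \<xi> (\<mu> \<eta> x) - \<mu> \<eta> (\<mu> \<xi> x) \<in> \<pp>"
    using assms
    by (auto intro!: subspace_add[OF subspaces(3)] subspace_diff[OF subspaces(2)]
        subspace_diff[OF subspaces(3)] c)
  from \<rho>\<mu>_eqI[OF assms(1) in_sub(4)[OF assms(2,3)] this eq]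
  show "\<rho> x (br \<xi> \<eta>) = br (\<rho> x \<xi>) \<eta> + br \<xi> (\<rho> x \<eta>) + \<rho> (\<mu> \<eta> x) \<xi> - \<rho> (\<mu> \<xi> x) \<eta>"
    "\<mu> (br \<xi> \<eta>) x = \<mu> \<xi> (\<mu> \<eta> x) - \<mu> \<eta> (\<mu> \<xi> x)" .
qed

lemma matched_pair_algebras: "matched_pair_lie_algebras \<pp> br \<qq> br \<rho> \<mu>"
proof -
  have "lie_representation \<pp> br \<qq> \<rho>"
    unfolding lie_representation_def linear_on_def
    using \<rho>\<mu>(1) \<rho>\<mu>_linear jacobi_components_\<pp>(1) by auto
  moreover have "lie_representation \<qq> br \<pp> \<mu>"
    unfolding lie_representation_def linear_on_def
    using \<rho>\<mu>(2) \<rho>\<mu>_linear jacobi_components_\<qq>(2) by auto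
  ultimately show ?thesis
    using lie_subalgebra_lie_algebra[OF sub_\<pp>] lie_subalgebra_lie_algebra[OF sub_\<qq>]
      jacobi_components_\<pp>(2) jacobi_components_\<qq>(1)
    unfolding matched_pair_lie_algebras_def by blast
qed

end

section \<open>Differentiation of a matched pair\<close>

text \<open>Differentiating the linear action on the tangent space at a fixed point \<open>e\<close>, along a curve of
  transformations \<open>A t\<close>, amounts to a mixed second derivative. For functions that are not smooth near
  \<open>e\<close> every tangent vector at \<open>e\<close> takes the default value 0.\<close>

lemma tangent_action_derivative:
  fixes R :: "('m, 'e::euclidean_space) manifold" and A :: "real \<Rightarrow> 'm \<Rightarrow> 'm"
  assumes R: "atlas R" and d: "smooth_at euclid R 0 d" "d 0 = e"
    and V: "open V" "0 \<in> V" "\<And>t. t \<in> V \<Longrightarrow> smooth_at R R e (A t)" "\<And>t. t \<in> V \<Longrightarrow> A t e = e"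
    and A: "smooth_at euclid R (0, 0) (\<lambda>(t, s). A t (d s))"
  shows "((\<lambda>t. tangent_map R (A t) e (velocity R d) h) has_real_derivative
    (if smooth_at R euclid e h then mixed_deriv (\<lambda>t s. h (A t (d s))) else 0)) (at 0)"
proof -
  let ?F = "\<lambda>t. if smooth_at R euclid e h then deriv (\<lambda>s. h (A t (d s))) 0 else 0"
  have "tangent_map R (A t) e (velocity R d) h = ?F t" if "t \<in> V" for t
    using tangent_map_velocity[OF R R, of d "A t" e] V(3,4)[OF that] d
    by (simp add: velocity_apply[OF R])
  then have ev: "eventually (\<lambda>t. tangent_map R (A t) e (velocity R d) h = ?F t) (nhds 0)"
    using eventually_nhds_in_open[OF V(1,2)] by (auto elim: eventually_mono)
  have "(?F has_real_derivative
      (if smooth_at R euclid e h then mixed_deriv (\<lambda>t s. h (A t (d s))) else 0)) (at 0)"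
  proof (cases "smooth_at R euclid e h")
    case True
    have "smooth_at euclid euclid (0, 0) (\<lambda>z. h (case z of (t, s) \<Rightarrow> A t (d s)))"
      by (rule smooth_at_compose[OF atlas_euclid R atlas_euclid A]) (use True d V in simp)
    then have "smooth_at euclid euclid (0, 0) (\<lambda>(t, s). h (A t (d s)))"
      by (simp add: case_prod_unfold)
    from has_derivative_mixed_deriv[OF this] True show ?thesis by simp
  qed simp
  then show ?thesis using DERIV_cong_ev[OF refl ev refl] by simp
qed

lemma near_carrier:
  assumes G: "lie_group G" and c: "smooth_at euclid (mfd G) 0 c"
  obtains V :: "real set" where "open V" "0 \<in> V" "\<And>t. t \<in> V \<Longrightarrow> c t \<in> carrier G"
proof -
  note A = lie_groupD(3)[OF G]
  have "c 0 \<in> points (mfd G)" by (rule smooth_at_points(2)[OF atlas_euclid A c])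
  then show ?thesis
    using smooth_at_open_preimage[OF atlas_euclid A c openin_points[OF A]] that
    by (metis openin_euclid lie_groupD(4)[OF G])
qed

lemma subgroup_curve:
  assumes sub: "lie_subgroup R K" and c: "smooth_at euclid (mfd R) 0 c"
  shows "smooth_at euclid (mfd K) 0 c"
proof -
  note AR = lie_groupD(3)[OF lie_subgroupD(2)[OF sub]] and AK = lie_groupD(3)[OF lie_subgroupD(1)[OF sub]]
  have "c 0 \<in> carrier R"
    using smooth_at_points(2)[OF atlas_euclid AR c] lie_groupD(4)[OF lie_subgroupD(2)[OF sub]] by simp
  then show ?thesis
    using smooth_at_compose[OF atlas_euclid AR AK c lie_subgroupD(7)[OF sub]] by simp
qed

lemma velocity_inclusion:
  assumes sub: "lie_subgroup R K" and c: "smooth_at euclid (mfd R) 0 c" "c 0 = \<one>\<^bsub>K\<^esub>"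
  shows "tangent_map (mfd K) (\<lambda>k. k) \<one>\<^bsub>K\<^esub> (velocity (mfd R) c) = velocity (mfd K) c"
proof -
  note AR = lie_groupD(3)[OF lie_subgroupD(2)[OF sub]] and AK = lie_groupD(3)[OF lie_subgroupD(1)[OF sub]]
  have "c 0 \<in> carrier R"
    using smooth_at_points(2)[OF atlas_euclid AR c(1)] lie_groupD(4)[OF lie_subgroupD(2)[OF sub]] by simp
  then show ?thesis
    using tangent_map_velocity[OF AR AK, of c "\<lambda>k. k"] lie_subgroupD(7)[OF sub] c(2) by simp
qed

text \<open>Composition with a retraction \<open>\<tau>\<close> of \<open>K\<close> onto a subgroup, smooth at the identity, extends germs
  of functions from the subgroup to \<open>K\<close>. The bracket of the subgroup is computed on products of
  elements of the subgroup, where \<open>\<tau>\<close> is the identity, and so agrees with that of \<open>K\<close> on the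
  extensions.\<close>

locale subgroup_retraction =
  fixes K R :: "('h, 'e::euclidean_space) lie_group_struct" and \<tau> :: "'h \<Rightarrow> 'h"
  assumes sub_R: "lie_subgroup R K"
    and smooth_\<tau>: "smooth_at (mfd K) (mfd R) \<one>\<^bsub>K\<^esub> \<tau>"
    and retract: "x \<in> carrier R \<Longrightarrow> \<tau> x = x"
begin

lemmas LK = lie_subgroupD(1)[OF sub_R] and LR = lie_subgroupD(2)[OF sub_R]
lemmas AK = lie_groupD(3)[OF LK] and AR = lie_groupD(3)[OF LR]

lemma one_R: "\<one>\<^bsub>K\<^esub> \<in> carrier R"
  using subgroup.one_closed[OF lie_subgroupD(3)[OF sub_R]] .

lemma extension: "smooth_at (mfd R) euclid \<one>\<^bsub>K\<^esub> h \<Longrightarrow> smooth_at (mfd K) euclid \<one>\<^bsub>K\<^esub> (\<lambda>k. h (\<tau> k))"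
  using smooth_\<tau> by (auto intro: smooth_at_compose[OF AK AR atlas_euclid] simp: retract one_R)

lemma lie_R_iff:
  "v \<in> lie R \<longleftrightarrow> (\<exists>c. smooth_at euclid (mfd R) 0 c \<and> c 0 = \<one>\<^bsub>K\<^esub> \<and> v = velocity (mfd R) c)"
  using lie_iff[OF LR] lie_subgroupD(4)[OF sub_R] by simp

lemma lie_R_apply:
  assumes v: "v \<in> lie R" and h: "smooth_at (mfd R) euclid \<one>\<^bsub>K\<^esub> h"
  shows "v h = tangent_map (mfd K) (\<lambda>k. k) \<one>\<^bsub>K\<^esub> v (\<lambda>k. h (\<tau> k))"
proof -
  obtain c where c: "smooth_at euclid (mfd R) 0 c" "c 0 = \<one>\<^bsub>K\<^esub>" "v = velocity (mfd R) c"
    using v by (auto simp: lie_R_iff)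
  have "v h = v (\<lambda>k. h (\<tau> k))"
    unfolding c(3) by (rule velocity_cong_points[OF AR c(1)]) (simp add: lie_groupD(4)[OF LR] retract)
  then show ?thesis using extension[OF h] by (simp add: tangent_map_apply[OF AK])
qed

lemma lie_R_not_smooth:
  assumes "v \<in> lie R" "\<not> smooth_at (mfd R) euclid \<one>\<^bsub>K\<^esub> h" shows "v h = 0"
  using assms by (auto simp: lie_R_iff velocity_apply[OF AR])

lemma lie_bracket_R:
  assumes c: "smooth_at euclid (mfd R) 0 c" "c 0 = \<one>\<^bsub>K\<^esub>"
    and d: "smooth_at euclid (mfd R) 0 d" "d 0 = \<one>\<^bsub>K\<^esub>"
    and h: "smooth_at (mfd R) euclid \<one>\<^bsub>K\<^esub> h"
  shows "lie_bracket R (velocity (mfd R) c) (velocity (mfd R) d) h =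
    lie_bracket K (velocity (mfd K) c) (velocity (mfd K) d) (\<lambda>k. h (\<tau> k))"
proof -
  note op = lie_subgroupD(4,5)[OF sub_R]
  have eq: "mixed_deriv (\<lambda>s t. h (c s \<otimes>\<^bsub>K\<^esub> d t)) = mixed_deriv (\<lambda>s t. h (\<tau> (c s \<otimes>\<^bsub>K\<^esub> d t)))"
    if c: "smooth_at euclid (mfd R) 0 c" and d: "smooth_at euclid (mfd R) 0 d" for c d
  proof -
    obtain V :: "real set" where V: "open V" "0 \<in> V" "\<And>t. t \<in> V \<Longrightarrow> c t \<in> carrier R"
      by (rule near_carrier[OF LR c]) blast
    obtain W :: "real set" where W: "open W" "0 \<in> W" "\<And>t. t \<in> W \<Longrightarrow> d t \<in> carrier R"
      by (rule near_carrier[OF LR d]) blast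
    show ?thesis
      by (rule mixed_deriv_cong[of "V \<times> W"])
        (use V W subgroup.m_closed[OF lie_subgroupD(3)[OF sub_R]] in \<open>auto simp: retract open_Times\<close>)
  qed
  show ?thesis
    using lie_bracket_velocity[OF LR c(1) _ d(1), of h] c d h
      lie_bracket_velocity[OF LK subgroup_curve[OF sub_R c(1)] c(2)
        subgroup_curve[OF sub_R d(1)] d(2) extension[OF h]]
      eq[OF c(1) d(1)] eq[OF d(1) c(1)]
    by (simp add: op)
qed

lemma lie_algebra_iso_R:
  assumes closed: "\<And>x y. x \<in> \<rr> \<Longrightarrow> y \<in> \<rr> \<Longrightarrow> br x y \<in> \<rr>"
    and bracket: "\<And>x y. x \<in> \<rr> \<Longrightarrow> y \<in> \<rr> \<Longrightarrow> lie_bracket K (\<Lambda> x) (\<Lambda> y) = \<Lambda> (br x y)"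
    and lin: "linear_on \<rr> \<alpha>" and bij: "bij_betw \<alpha> \<rr> (lie R)"
    and incl: "\<And>x. x \<in> \<rr> \<Longrightarrow> tangent_map (mfd K) (\<lambda>k. k) \<one>\<^bsub>K\<^esub> (\<alpha> x) = \<Lambda> x"
  shows "lie_algebra_iso \<rr> br (lie R) (lie_bracket R) \<alpha>"
proof -
  have mem: "\<alpha> x \<in> lie R" if "x \<in> \<rr>" for x using bij that by (auto simp: bij_betw_def)
  have "\<alpha> (br x y) h = lie_bracket R (\<alpha> x) (\<alpha> y) h" if xy: "x \<in> \<rr>" "y \<in> \<rr>" for x y h
  proof (cases "smooth_at (mfd R) euclid \<one>\<^bsub>K\<^esub> h")
    case True
    obtain c where c: "smooth_at euclid (mfd R) 0 c" "c 0 = \<one>\<^bsub>K\<^esub>" "\<alpha> x = velocity (mfd R) c"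
      using mem[OF xy(1)] by (auto simp: lie_R_iff)
    obtain d where d: "smooth_at euclid (mfd R) 0 d" "d 0 = \<one>\<^bsub>K\<^esub>" "\<alpha> y = velocity (mfd R) d"
      using mem[OF xy(2)] by (auto simp: lie_R_iff)
    have "lie_bracket R (\<alpha> x) (\<alpha> y) h = lie_bracket K (\<Lambda> x) (\<Lambda> y) (\<lambda>k. h (\<tau> k))"
      using lie_bracket_R[OF c(1,2) d(1,2) True] velocity_inclusion[OF sub_R c(1,2)]
        velocity_inclusion[OF sub_R d(1,2)] incl[OF xy(1)] incl[OF xy(2)] c(3) d(3) by simp
    also have "\<dots> = tangent_map (mfd K) (\<lambda>k. k) \<one>\<^bsub>K\<^esub> (\<alpha> (br x y)) (\<lambda>k. h (\<tau> k))"
      using bracket[OF xy] incl[OF closed[OF xy]] by simp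
    also have "\<dots> = \<alpha> (br x y) h" using lie_R_apply[OF mem[OF closed[OF xy]] True] by simp
    finally show ?thesis by simp
  next
    case False
    then show ?thesis
      using lie_R_not_smooth[OF mem[OF closed[OF xy]] False]
      by (simp add: lie_bracket_def smooth_near_iff[OF AR] lie_subgroupD(4)[OF sub_R])
  qed
  then show ?thesis using lin bij by (auto simp: lie_algebra_iso_def fun_eq_iff)
qed

end

text \<open>Here \<open>\<Lambda>\<close> realizes \<open>S\<close>, compatibly with brackets, by tangent vectors of \<open>K\<close>, and \<open>\<alpha>\<close>, \<open>\<beta>\<close> are its
  restrictions to the two subalgebras, read in the Lie algebras of \<open>P\<close> and \<open>Q\<close>.

  For \<open>h\<close> on \<open>Q\<close> the function \<open>f = h \<circ> \<pi>\<close> on \<open>K\<close> satisfies \<open>f(p q) = h(p \<triangleright> q)\<close> and \<open>f(q p) = h(q)\<close>.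
  Hence the mixed derivative of \<open>h(c(t) \<triangleright> d(s))\<close> equals \<open>[x, \<xi>] f\<close>: of the two mixed derivatives in
  the bracket the one of \<open>f(d(s) c(t)) = h(d(s))\<close> vanishes. As \<open>f\<close> is constant on \<open>P\<close>, only the
  component \<open>\<rho>(x)\<xi>\<close> of \<open>[x, \<xi>]\<close> contributes. The other action is treated in the same way with the
  projection to \<open>P\<close>.\<close>

locale differentiated_factorization =
  lie_group_factorization K P Q \<pi> + lie_splitting S \<pp> \<qq> br
  for K P Q :: "('h, 'e::euclidean_space) lie_group_struct" and \<pi>
    and S \<pp> \<qq> :: "'a::real_vector set" and br +
  fixes \<Lambda> \<alpha> \<beta> :: "'a \<Rightarrow> 'h tangent"
  assumes \<Lambda>_linear: "linear_on S \<Lambda>"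
    and \<Lambda>_bracket: "x \<in> S \<Longrightarrow> y \<in> S \<Longrightarrow> lie_bracket K (\<Lambda> x) (\<Lambda> y) = \<Lambda> (br x y)"
    and \<alpha>_linear: "linear_on \<pp> \<alpha>" and \<alpha>_bij: "bij_betw \<alpha> \<pp> (lie P)"
    and \<alpha>_incl: "x \<in> \<pp> \<Longrightarrow> tangent_map (mfd K) (\<lambda>k. k) \<one>\<^bsub>K\<^esub> (\<alpha> x) = \<Lambda> x"
    and \<beta>_linear: "linear_on \<qq> \<beta>" and \<beta>_bij: "bij_betw \<beta> \<qq> (lie Q)"
    and \<beta>_incl: "\<xi> \<in> \<qq> \<Longrightarrow> tangent_map (mfd K) (\<lambda>k. k) \<one>\<^bsub>K\<^esub> (\<beta> \<xi>) = \<Lambda> \<xi>"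
begin

lemma retraction_P: "subgroup_retraction K P coproj"
  by unfold_locales (auto simp: sub_P coproj_on_P intro: smooth_at_coproj)

lemma retraction_Q: "subgroup_retraction K Q \<pi>"
  by unfold_locales (auto simp: sub_Q proj_on_Q intro: smooth_proj)

lemmas lie_P_iff = subgroup_retraction.lie_R_iff[OF retraction_P]
  and lie_Q_iff = subgroup_retraction.lie_R_iff[OF retraction_Q]

lemma \<alpha>_mem: "x \<in> \<pp> \<Longrightarrow> \<alpha> x \<in> lie P" and \<beta>_mem: "\<xi> \<in> \<qq> \<Longrightarrow> \<beta> \<xi> \<in> lie Q"
  using \<alpha>_bij \<beta>_bij by (auto simp: bij_betw_def)

lemma \<Lambda>_split:
  assumes "x \<in> \<pp>" "\<xi> \<in> \<qq>"
  shows "\<Lambda> (br x \<xi>) f = \<Lambda> (\<rho> x \<xi>) f - \<Lambda> (\<mu> \<xi> x) f"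
proof -
  have "\<rho> x \<xi> \<in> S" "\<mu> \<xi> x \<in> S" using \<rho>\<mu>[OF assms] in_sub by auto
  moreover have "- 1 *\<^sub>R \<mu> \<xi> x \<in> S" using calculation(2) by (rule subspace_scale[OF subspaces(1)])
  ultimately have "\<Lambda> (\<rho> x \<xi> + (- 1) *\<^sub>R \<mu> \<xi> x) = \<Lambda> (\<rho> x \<xi>) + (- 1) *\<^sub>R \<Lambda> (\<mu> \<xi> x)"
    using \<Lambda>_linear unfolding linear_on_def by metis
  then show ?thesis using \<rho>\<mu>(3)[OF assms] by (simp add: fun_eq_iff)
qed

lemma \<Lambda>_constant:
  assumes sub: "lie_subgroup R K" and v: "v \<in> lie R"
    and f: "\<And>k. k \<in> carrier R \<Longrightarrow> f k = c"
  shows "tangent_map (mfd K) (\<lambda>k. k) \<one>\<^bsub>K\<^esub> v f = 0"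
proof -
  note LR = lie_subgroupD(2)[OF sub]
  note AR = lie_groupD(3)[OF LR]
  obtain d where d: "smooth_at euclid (mfd R) 0 d" "d 0 = \<one>\<^bsub>R\<^esub>" "v = velocity (mfd R) d"
    using v by (auto simp: lie_iff[OF LR])
  have "v f = v (\<lambda>_. c)"
    unfolding d(3) by (rule velocity_cong_points[OF AR d(1)]) (simp add: f lie_groupD(4)[OF LR])
  also have "\<dots> = 0" by (simp add: d(3) velocity_apply[OF AR])
  finally show ?thesis by (simp add: tangent_map_apply[OF AK])
qed

lemma smooth_at_action_curves:
  assumes c: "smooth_at euclid (mfd P) 0 c" "c 0 = \<one>\<^bsub>K\<^esub>"
    and d: "smooth_at euclid (mfd Q) 0 d" "d 0 = \<one>\<^bsub>K\<^esub>"
    and a: "smooth_at euclid euclid z a" "a z = (0 :: real)"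
    and b: "smooth_at euclid euclid z b" "b z = (0 :: real)"
  shows "smooth_at euclid (mfd Q) z (\<lambda>x. lact (c (a x)) (d (b x)))"
    "smooth_at euclid (mfd P) z (\<lambda>x. ract (c (a x)) (d (b x)))"
proof -
  have "smooth_at euclid (mfd P) z (\<lambda>x. c (a x))" "smooth_at euclid (mfd Q) z (\<lambda>x. d (b x))"
    using smooth_at_compose[OF atlas_euclid atlas_euclid AP a(1), of c]
      smooth_at_compose[OF atlas_euclid atlas_euclid AQ b(1), of d] a b c d by auto
  then have cd: "smooth_at euclid (manifold_prod (mfd P) (mfd Q)) z (\<lambda>x. (c (a x), d (b x)))"
    by (rule smooth_at_Pair[OF atlas_euclid AP AQ])
  have m: "(c (a z), d (b z)) \<in> carrier P \<times> carrier Q" using a b c d by simp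
  show "smooth_at euclid (mfd Q) z (\<lambda>x. lact (c (a x)) (d (b x)))"
    using smooth_at_compose[OF atlas_euclid APQ AQ cd smooth_at_lact[OF m]] by simp
  show "smooth_at euclid (mfd P) z (\<lambda>x. ract (c (a x)) (d (b x)))"
    using smooth_at_compose[OF atlas_euclid APQ AP cd smooth_at_ract[OF m]] by simp
qed

lemma mixed_deriv_actions:
  assumes c: "smooth_at euclid (mfd P) 0 c" "c 0 = \<one>\<^bsub>K\<^esub>"
    and d: "smooth_at euclid (mfd Q) 0 d" "d 0 = \<one>\<^bsub>K\<^esub>"
  shows "smooth_at (mfd Q) euclid \<one>\<^bsub>K\<^esub> h \<Longrightarrow> mixed_deriv (\<lambda>t s. h (lact (c t) (d s))) =
      lie_bracket K (velocity (mfd K) c) (velocity (mfd K) d) (\<lambda>k. h (\<pi> k))"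
    and "smooth_at (mfd P) euclid \<one>\<^bsub>K\<^esub> h \<Longrightarrow> mixed_deriv (\<lambda>t s. h (ract (c t) (d s))) =
      lie_bracket K (velocity (mfd K) c) (velocity (mfd K) d) (\<lambda>k. h (coproj k))"
proof -
  obtain V :: "real set" where V: "open V" "0 \<in> V" "\<And>t. t \<in> V \<Longrightarrow> c t \<in> carrier P"
    by (rule near_carrier[OF LP c(1)]) blast
  obtain W :: "real set" where W: "open W" "0 \<in> W" "\<And>t. t \<in> W \<Longrightarrow> d t \<in> carrier Q"
    by (rule near_carrier[OF LQ d(1)]) blast
  note VW = open_Times[OF V(1) W(1)] and WV = open_Times[OF W(1) V(1)]
  note cK = subgroup_curve[OF sub_P c(1)] and dK = subgroup_curve[OF sub_Q d(1)]
  {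
    assume h: "smooth_at (mfd Q) euclid \<one>\<^bsub>K\<^esub> h"
    have "mixed_deriv (\<lambda>t s. h (lact (c t) (d s))) = mixed_deriv (\<lambda>t s. h (\<pi> (c t \<otimes>\<^bsub>K\<^esub> d s)))"
      by (rule mixed_deriv_cong[OF VW]) (use V W in \<open>auto simp: lact_eq\<close>)
    moreover have "mixed_deriv (\<lambda>s t. h (\<pi> (d s \<otimes>\<^bsub>K\<^esub> c t))) = mixed_deriv (\<lambda>s t. h (d s))"
      by (rule mixed_deriv_cong[OF WV]) (use V W in \<open>auto simp: proj_mult\<close>)
    ultimately show "mixed_deriv (\<lambda>t s. h (lact (c t) (d s))) =
        lie_bracket K (velocity (mfd K) c) (velocity (mfd K) d) (\<lambda>k. h (\<pi> k))"
      using lie_bracket_velocity[OF LK cK c(2) dK d(2)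
          subgroup_retraction.extension[OF retraction_Q h]] by simp
  next
    assume h: "smooth_at (mfd P) euclid \<one>\<^bsub>K\<^esub> h"
    have "mixed_deriv (\<lambda>t s. h (ract (c t) (d s))) = mixed_deriv (\<lambda>t s. h (coproj (c t \<otimes>\<^bsub>K\<^esub> d s)))"
      by (rule mixed_deriv_cong[OF VW]) (use V W in \<open>auto simp: ract_eq\<close>)
    moreover have "mixed_deriv (\<lambda>s t. h (coproj (d s \<otimes>\<^bsub>K\<^esub> c t))) = mixed_deriv (\<lambda>s t. h (c t))"
      by (rule mixed_deriv_cong[OF WV]) (use V W in \<open>auto simp: coproj_mult\<close>)
    ultimately show "mixed_deriv (\<lambda>t s. h (ract (c t) (d s))) =
        lie_bracket K (velocity (mfd K) c) (velocity (mfd K) d) (\<lambda>k. h (coproj k))"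
      using lie_bracket_velocity[OF LK cK c(2) dK d(2)
          subgroup_retraction.extension[OF retraction_P h]] by simp
  }
qed

lemma derivative_lact:
  assumes x: "x \<in> \<pp>" and \<xi>: "\<xi> \<in> \<qq>"
    and c: "smooth_at euclid (mfd P) 0 c" "c 0 = \<one>\<^bsub>K\<^esub>" "velocity (mfd P) c = \<alpha> x"
  shows "((\<lambda>t. tangent_map (mfd Q) (lact (c t)) \<one>\<^bsub>K\<^esub> (\<beta> \<xi>) h)
    has_real_derivative \<beta> (\<rho> x \<xi>) h) (at 0)"
proof -
  obtain d where d: "smooth_at euclid (mfd Q) 0 d" "d 0 = \<one>\<^bsub>K\<^esub>" "\<beta> \<xi> = velocity (mfd Q) d"
    using \<beta>_mem[OF \<xi>] by (auto simp: lie_Q_iff)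
  obtain V :: "real set" where V: "open V" "0 \<in> V" "\<And>t. t \<in> V \<Longrightarrow> c t \<in> carrier P"
    by (rule near_carrier[OF LP c(1)]) blast
  have slice: "smooth_at (mfd Q) (mfd Q) \<one>\<^bsub>K\<^esub> (lact p)" if p: "p \<in> carrier P" for p
  proof -
    have "smooth_at (mfd Q) (manifold_prod (mfd P) (mfd Q)) \<one>\<^bsub>K\<^esub> (\<lambda>q. (p, q))"
      using p by (intro smooth_at_Pair AP AQ smooth_at_const smooth_at_ident) auto
    from smooth_at_compose[OF AQ APQ AQ this smooth_at_lact] p show ?thesis by simp
  qed
  have "smooth_at euclid (mfd Q) (0, 0) (\<lambda>(t, s). lact (c t) (d s))"
    using smooth_at_action_curves(1)[OF c(1,2) d(1,2), of "(0, 0)" fst snd]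
    by (simp add: smooth_at_linear bounded_linear_fst bounded_linear_snd case_prod_unfold)
  from tangent_action_derivative[OF AQ d(1,2) V(1,2) slice[OF V(3)] lact_one_right[OF V(3)] this]
  have D: "((\<lambda>t. tangent_map (mfd Q) (lact (c t)) \<one>\<^bsub>K\<^esub> (\<beta> \<xi>) h) has_real_derivative
      (if smooth_at (mfd Q) euclid \<one>\<^bsub>K\<^esub> h then mixed_deriv (\<lambda>t s. h (lact (c t) (d s))) else 0)) (at 0)"
    by (simp add: d(3))
  have vel: "velocity (mfd K) c = \<Lambda> x" "velocity (mfd K) d = \<Lambda> \<xi>"
    using velocity_inclusion[OF sub_P c(1,2)] velocity_inclusion[OF sub_Q d(1,2)]
    by (simp_all add: c(3) d(3) flip: \<alpha>_incl[OF x] \<beta>_incl[OF \<xi>])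
  have mem: "\<rho> x \<xi> \<in> \<qq>" "\<mu> \<xi> x \<in> \<pp>" using \<rho>\<mu>[OF x \<xi>] by auto
  have "(if smooth_at (mfd Q) euclid \<one>\<^bsub>K\<^esub> h then mixed_deriv (\<lambda>t s. h (lact (c t) (d s))) else 0) =
      \<beta> (\<rho> x \<xi>) h"
  proof (cases "smooth_at (mfd Q) euclid \<one>\<^bsub>K\<^esub> h")
    case True
    have "mixed_deriv (\<lambda>t s. h (lact (c t) (d s))) = \<Lambda> (br x \<xi>) (\<lambda>k. h (\<pi> k))"
      unfolding mixed_deriv_actions(1)[OF c(1,2) d(1,2) True] vel
      using \<Lambda>_bracket[OF in_sub(1)[OF x] in_sub(2)[OF \<xi>]] by simp
    also have "\<dots> = \<Lambda> (\<rho> x \<xi>) (\<lambda>k. h (\<pi> k)) - \<Lambda> (\<mu> \<xi> x) (\<lambda>k. h (\<pi> k))"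
      by (rule \<Lambda>_split[OF x \<xi>])
    also have "\<Lambda> (\<mu> \<xi> x) (\<lambda>k. h (\<pi> k)) = 0"
      using \<Lambda>_constant[OF sub_P \<alpha>_mem[OF mem(2)], of "\<lambda>k. h (\<pi> k)" "h \<one>\<^bsub>K\<^esub>"] \<alpha>_incl[OF mem(2)]
      by (simp add: proj_on_P)
    also have "\<Lambda> (\<rho> x \<xi>) (\<lambda>k. h (\<pi> k)) = \<beta> (\<rho> x \<xi>) h"
      using subgroup_retraction.lie_R_apply[OF retraction_Q \<beta>_mem[OF mem(1)] True] \<beta>_incl[OF mem(1)]
      by simp
    finally show ?thesis using True by simp
  next
    case False
    then show ?thesis
      using subgroup_retraction.lie_R_not_smooth[OF retraction_Q \<beta>_mem[OF mem(1)] False] by simp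
  qed
  then show ?thesis using D by simp
qed

lemma derivative_ract:
  assumes x: "x \<in> \<pp>" and \<xi>: "\<xi> \<in> \<qq>"
    and d: "smooth_at euclid (mfd Q) 0 d" "d 0 = \<one>\<^bsub>K\<^esub>" "velocity (mfd Q) d = \<beta> \<xi>"
  shows "((\<lambda>t. tangent_map (mfd P) (\<lambda>p. ract p (d t)) \<one>\<^bsub>K\<^esub> (\<alpha> x) h)
    has_real_derivative - \<alpha> (\<mu> \<xi> x) h) (at 0)"
proof -
  obtain c where c: "smooth_at euclid (mfd P) 0 c" "c 0 = \<one>\<^bsub>K\<^esub>" "\<alpha> x = velocity (mfd P) c"
    using \<alpha>_mem[OF x] by (auto simp: lie_P_iff)
  obtain V :: "real set" where V: "open V" "0 \<in> V" "\<And>t. t \<in> V \<Longrightarrow> d t \<in> carrier Q"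
    by (rule near_carrier[OF LQ d(1)]) blast
  have slice: "smooth_at (mfd P) (mfd P) \<one>\<^bsub>K\<^esub> (\<lambda>p. ract p q)" if q: "q \<in> carrier Q" for q
  proof -
    have "smooth_at (mfd P) (manifold_prod (mfd P) (mfd Q)) \<one>\<^bsub>K\<^esub> (\<lambda>p. (p, q))"
      using q by (intro smooth_at_Pair AP AQ smooth_at_const smooth_at_ident) auto
    from smooth_at_compose[OF AP APQ AP this smooth_at_ract] q show ?thesis by simp
  qed
  have sm: "smooth_at euclid (mfd P) (0, 0) (\<lambda>(t, s). ract (c s) (d t))"
    and sm': "smooth_at euclid (mfd P) (0, 0) (\<lambda>(s, t). ract (c s) (d t))"
    using smooth_at_action_curves(2)[OF c(1,2) d(1,2), of "(0, 0)" snd fst]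
      smooth_at_action_curves(2)[OF c(1,2) d(1,2), of "(0, 0)" fst snd]
    by (simp_all add: smooth_at_linear bounded_linear_fst bounded_linear_snd case_prod_unfold)
  from tangent_action_derivative[OF AP c(1,2) V(1,2) slice[OF V(3)] ract_one_left[OF V(3)] sm]
  have D: "((\<lambda>t. tangent_map (mfd P) (\<lambda>p. ract p (d t)) \<one>\<^bsub>K\<^esub> (\<alpha> x) h) has_real_derivative
      (if smooth_at (mfd P) euclid \<one>\<^bsub>K\<^esub> h then mixed_deriv (\<lambda>t s. h (ract (c s) (d t))) else 0)) (at 0)"
    by (simp add: c(3))
  have vel: "velocity (mfd K) c = \<Lambda> x" "velocity (mfd K) d = \<Lambda> \<xi>"
    using velocity_inclusion[OF sub_P c(1,2)] velocity_inclusion[OF sub_Q d(1,2)]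
    by (simp_all add: c(3) d(3) flip: \<alpha>_incl[OF x] \<beta>_incl[OF \<xi>])
  have mem: "\<rho> x \<xi> \<in> \<qq>" "\<mu> \<xi> x \<in> \<pp>" using \<rho>\<mu>[OF x \<xi>] by auto
  have "(if smooth_at (mfd P) euclid \<one>\<^bsub>K\<^esub> h then mixed_deriv (\<lambda>t s. h (ract (c s) (d t))) else 0) =
      - \<alpha> (\<mu> \<xi> x) h"
  proof (cases "smooth_at (mfd P) euclid \<one>\<^bsub>K\<^esub> h")
    case True
    have "smooth_at euclid euclid (0, 0) (\<lambda>z. h (case z of (s, t) \<Rightarrow> ract (c s) (d t)))"
      by (rule smooth_at_compose[OF atlas_euclid AP atlas_euclid sm'])
        (use True c d ract_one in simp)
    then have "smooth_at euclid euclid (0, 0) (\<lambda>(s, t). h (ract (c s) (d t)))"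
      by (simp add: case_prod_unfold)
    \<comment> \<open>The outer variable \<open>t\<close> now belongs to the curve in \<open>Q\<close>, so the order of the derivatives is
      exchanged first.\<close>
    from mixed_deriv_commute[OF this]
    have "mixed_deriv (\<lambda>t s. h (ract (c s) (d t))) = mixed_deriv (\<lambda>s t. h (ract (c s) (d t)))"
      by simp
    also have "\<dots> = \<Lambda> (br x \<xi>) (\<lambda>k. h (coproj k))"
      unfolding mixed_deriv_actions(2)[OF c(1,2) d(1,2) True] vel
      using \<Lambda>_bracket[OF in_sub(1)[OF x] in_sub(2)[OF \<xi>]] by simp
    also have "\<dots> = \<Lambda> (\<rho> x \<xi>) (\<lambda>k. h (coproj k)) - \<Lambda> (\<mu> \<xi> x) (\<lambda>k. h (coproj k))"
      by (rule \<Lambda>_split[OF x \<xi>])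
    also have "\<Lambda> (\<rho> x \<xi>) (\<lambda>k. h (coproj k)) = 0"
      using \<Lambda>_constant[OF sub_Q \<beta>_mem[OF mem(1)], of "\<lambda>k. h (coproj k)" "h \<one>\<^bsub>K\<^esub>"] \<beta>_incl[OF mem(1)]
      by (simp add: coproj_on_Q)
    also have "\<Lambda> (\<mu> \<xi> x) (\<lambda>k. h (coproj k)) = \<alpha> (\<mu> \<xi> x) h"
      using subgroup_retraction.lie_R_apply[OF retraction_P \<alpha>_mem[OF mem(2)] True] \<alpha>_incl[OF mem(2)]
      by simp
    finally show ?thesis using True by simp
  next
    case False
    then show ?thesis
      using subgroup_retraction.lie_R_not_smooth[OF retraction_P \<alpha>_mem[OF mem(2)] False] by simp
  qed
  then show ?thesis using D by simp
qed

lemma differentiation: "is_differentiation P Q lact ract \<pp> br \<qq> br \<rho> \<mu> \<alpha> \<beta>"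
proof -
  have "lie_algebra_iso \<pp> br (lie P) (lie_bracket P) \<alpha>"
    by (rule subgroup_retraction.lie_algebra_iso_R[OF retraction_P _ _ \<alpha>_linear \<alpha>_bij \<alpha>_incl])
      (auto intro: in_sub \<Lambda>_bracket)
  moreover have "lie_algebra_iso \<qq> br (lie Q) (lie_bracket Q) \<beta>"
    by (rule subgroup_retraction.lie_algebra_iso_R[OF retraction_Q _ _ \<beta>_linear \<beta>_bij \<beta>_incl])
      (auto intro: in_sub \<Lambda>_bracket)
  ultimately show ?thesis
    unfolding is_differentiation_def has_tangent_derivative_def smooth_curve_iff[OF AP]
      smooth_curve_iff[OF AQ] opP opQ
    using derivative_lact derivative_ract by simp
qed

end

section \<open>The Lie algebra of a direct product\<close>

lemma tangent_map_add: "tangent_map N f p (u + v) = tangent_map N f p u + tangent_map N f p v"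
  and tangent_map_scaleR: "tangent_map N f p (a *\<^sub>R u) = a *\<^sub>R tangent_map N f p u"
  by (auto simp: tangent_map_def fun_eq_iff)

lemma lie_prod_pair_add:
  "lie_prod_pair G H (u + u', v + v') = lie_prod_pair G H (u, v) + lie_prod_pair G H (u', v')"
  and lie_prod_pair_scaleR:
  "lie_prod_pair G H (a *\<^sub>R u, a *\<^sub>R v) = a *\<^sub>R lie_prod_pair G H (u, v)"
  by (simp_all add: lie_prod_pair_def tangent_map_add tangent_map_scaleR algebra_simps)

lemma lie_prod_pair_velocity:
  assumes G: "lie_group G" and H: "lie_group H"
    and c: "smooth_at euclid (mfd G) 0 c" "c 0 = \<one>\<^bsub>G\<^esub>"
    and d: "smooth_at euclid (mfd H) 0 d" "d 0 = \<one>\<^bsub>H\<^esub>"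
  shows "lie_prod_pair G H (velocity (mfd G) c, velocity (mfd H) d) =
    velocity (manifold_prod (mfd G) (mfd H)) (\<lambda>t. (c t, d t))"
proof
  fix f :: "'a \<times> 'c \<Rightarrow> real"
  note A = lie_groupD(3)[OF G] and B = lie_groupD(3)[OF H]
  note AB = atlas_prod[OF A B]
  show "lie_prod_pair G H (velocity (mfd G) c, velocity (mfd H) d) f =
    velocity (manifold_prod (mfd G) (mfd H)) (\<lambda>t. (c t, d t)) f"
  proof (cases "smooth_at (manifold_prod (mfd G) (mfd H)) euclid (\<one>\<^bsub>G\<^esub>, \<one>\<^bsub>H\<^esub>) f")
    case True
    then show ?thesis
      using velocity_Pair[OF A B c(1) d(1), of f] c d
      by (simp add: lie_prod_pair_def tangent_map_apply[OF AB])
  next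
    case False
    then show ?thesis
      using c d by (simp add: lie_prod_pair_def tangent_map_apply[OF AB] velocity_apply[OF AB])
  qed
qed

lemma lie_bracket_lie_prod_pair:
  assumes G: "lie_group G" and H: "lie_group H"
    and u: "u \<in> lie G" "u' \<in> lie G" and v: "v \<in> lie H" "v' \<in> lie H"
  shows "lie_bracket (lie_group_prod G H) (lie_prod_pair G H (u, v)) (lie_prod_pair G H (u', v')) =
    lie_prod_pair G H (lie_bracket G u u', lie_bracket H v v')"
proof
  fix f :: "'a \<times> 'c \<Rightarrow> real"
  note AB = atlas_prod[OF lie_groupD(3)[OF G] lie_groupD(3)[OF H]]
  obtain c where c: "smooth_at euclid (mfd G) 0 c" "c 0 = \<one>\<^bsub>G\<^esub>" "u = velocity (mfd G) c"
    using u by (auto simp: lie_iff[OF G])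
  obtain c' where c': "smooth_at euclid (mfd G) 0 c'" "c' 0 = \<one>\<^bsub>G\<^esub>" "u' = velocity (mfd G) c'"
    using u by (auto simp: lie_iff[OF G])
  obtain d where d: "smooth_at euclid (mfd H) 0 d" "d 0 = \<one>\<^bsub>H\<^esub>" "v = velocity (mfd H) d"
    using v by (auto simp: lie_iff[OF H])
  obtain d' where d': "smooth_at euclid (mfd H) 0 d'" "d' 0 = \<one>\<^bsub>H\<^esub>" "v' = velocity (mfd H) d'"
    using v by (auto simp: lie_iff[OF H])
  show "lie_bracket (lie_group_prod G H) (lie_prod_pair G H (u, v)) (lie_prod_pair G H (u', v')) f =
    lie_prod_pair G H (lie_bracket G u u', lie_bracket H v v') f"
  proof (cases "smooth_at (manifold_prod (mfd G) (mfd H)) euclid (\<one>\<^bsub>G\<^esub>, \<one>\<^bsub>H\<^esub>) f")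
    case True
    have "lie_prod_pair G H (lie_bracket G u u', lie_bracket H v v') f =
        lie_bracket G u u' (\<lambda>x. f (x, \<one>\<^bsub>H\<^esub>)) + lie_bracket H v v' (\<lambda>y. f (\<one>\<^bsub>G\<^esub>, y))"
      using True by (simp add: lie_prod_pair_def tangent_map_apply[OF AB])
    then show ?thesis
      using lie_bracket_prod[OF G H c(1,2) c'(1,2) d(1,2) d'(1,2) True]
        lie_prod_pair_velocity[OF G H c(1,2) d(1,2)] lie_prod_pair_velocity[OF G H c'(1,2) d'(1,2)]
      by (simp add: c(3) c'(3) d(3) d'(3))
  next
    case False
    then show ?thesis
      by (simp add: lie_prod_pair_def tangent_map_apply[OF AB] lie_bracket_def smooth_near_iff[OF AB])
  qed
qed

text \<open>The derivative of the multiplication at the identity is addition.\<close>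

lemma velocity_mult:
  assumes G: "lie_group G"
    and c: "smooth_at euclid (mfd G) 0 c" "c 0 = \<one>\<^bsub>G\<^esub>"
    and d: "smooth_at euclid (mfd G) 0 d" "d 0 = \<one>\<^bsub>G\<^esub>"
  shows "velocity (mfd G) (\<lambda>t. c t \<otimes>\<^bsub>G\<^esub> d t) = velocity (mfd G) c + velocity (mfd G) d"
proof
  fix f :: "'a \<Rightarrow> real"
  interpret group G by (rule lie_groupD(1)[OF G])
  note A = lie_groupD(3)[OF G]
  note AA = atlas_prod[OF A A]
  have m: "smooth_at (manifold_prod (mfd G) (mfd G)) (mfd G) (c 0, d 0) (\<lambda>(x, y). x \<otimes>\<^bsub>G\<^esub> y)"
    using lie_groupD(5)[OF G] c d by simp
  show "velocity (mfd G) (\<lambda>t. c t \<otimes>\<^bsub>G\<^esub> d t) f = (velocity (mfd G) c + velocity (mfd G) d) f"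
  proof (cases "smooth_at (mfd G) euclid \<one>\<^bsub>G\<^esub> f")
    case True
    have "smooth_at (manifold_prod (mfd G) (mfd G)) euclid (c 0, d 0) (\<lambda>z. f (case z of (x, y) \<Rightarrow> x \<otimes>\<^bsub>G\<^esub> y))"
      by (rule smooth_at_compose[OF AA A atlas_euclid m]) (simp add: True c d)
    from velocity_Pair[OF A A c(1) d(1) this]
    have "velocity (manifold_prod (mfd G) (mfd G)) (\<lambda>t. (c t, d t)) (\<lambda>z. f (case z of (x, y) \<Rightarrow> x \<otimes>\<^bsub>G\<^esub> y)) =
      velocity (mfd G) c (\<lambda>x. f (x \<otimes>\<^bsub>G\<^esub> \<one>\<^bsub>G\<^esub>)) + velocity (mfd G) d (\<lambda>y. f (\<one>\<^bsub>G\<^esub> \<otimes>\<^bsub>G\<^esub> y))"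
      by (simp add: c d)
    also have "velocity (mfd G) c (\<lambda>x. f (x \<otimes>\<^bsub>G\<^esub> \<one>\<^bsub>G\<^esub>)) = velocity (mfd G) c f"
      by (rule velocity_cong_points[OF A c(1)]) (simp add: lie_groupD(4)[OF G])
    also have "velocity (mfd G) d (\<lambda>y. f (\<one>\<^bsub>G\<^esub> \<otimes>\<^bsub>G\<^esub> y)) = velocity (mfd G) d f"
      by (rule velocity_cong_points[OF A d(1)]) (simp add: lie_groupD(4)[OF G])
    finally show ?thesis
      using fun_cong[OF tangent_map_velocity[OF AA A, of "\<lambda>t. (c t, d t)", OF m refl], of f] True c d
      by (simp add: tangent_map_apply[OF A])
  next
    case False
    then show ?thesis using c d by (simp add: velocity_apply[OF A])
  qed
qed

text \<open>In general \<open>F\<close> is a diffeomorphism from \<open>G\<close> onto the embedded group but no homomorphism, so the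
  Lie algebra of the image is described as a vector space only; brackets are compared in \<open>K\<close>.\<close>

lemma embedded_group_lie_algebra:
  assumes G: "lie_group G" and KG: "lie_group K" and emb: "retract_embedding (mfd G) (mfd K) F r"
    and F1: "F \<one>\<^bsub>G\<^esub> = \<one>\<^bsub>K\<^esub>"
    and \<iota>: "linear_on \<gg> \<iota>" "bij_betw \<iota> \<gg> (lie G)"
    and j: "linear_on \<rr> j" "bij_betw j \<rr> \<gg>"
  defines "R \<equiv> embedded_group K (mfd G) F r"
  defines "\<alpha> \<equiv> \<lambda>z. tangent_map (mfd R) F \<one>\<^bsub>G\<^esub> (\<iota> (j z))"
  shows "linear_on \<rr> \<alpha>" "bij_betw \<alpha> \<rr> (lie R)"
    and "z \<in> \<rr> \<Longrightarrow> tangent_map (mfd K) (\<lambda>k. k) \<one>\<^bsub>K\<^esub> (\<alpha> z) = tangent_map (mfd K) F \<one>\<^bsub>G\<^esub> (\<iota> (j z))"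
proof -
  interpret retract_embedding "mfd G" "mfd K" F r by (rule emb)
  have one: "\<one>\<^bsub>G\<^esub> \<in> points (mfd G)"
    using group.is_monoid[OF lie_groupD(1)[OF G]] monoid.one_closed lie_groupD(4)[OF G] by metis
  have oneP: "\<one>\<^bsub>K\<^esub> \<in> points P" using imageI[OF one, of F] by (simp add: points_P F1)
  have mfdR: "mfd R = image_manifold (mfd G) F r" by (simp add: R_def)
  have jm: "j z \<in> \<gg>" if "z \<in> \<rr>" for z using j(2) that by (auto simp: bij_betw_def)
  show "linear_on \<rr> \<alpha>"
    using \<iota>(1) j(1) jm unfolding linear_on_def \<alpha>_def by (simp add: tangent_map_add tangent_map_scaleR)
  have "bij_betw (tangent_map (mfd R) F \<one>\<^bsub>G\<^esub>) (lie G) (lie R)"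
    using bij_betw_tangent_map[OF one] by (simp add: lie_def R_def F1)
  then have "bij_betw (tangent_map (mfd R) F \<one>\<^bsub>G\<^esub> \<circ> (\<iota> \<circ> j)) \<rr> (lie R)"
    by (intro bij_betw_trans[OF bij_betw_trans[OF j(2) \<iota>(2)]])
  then show "bij_betw \<alpha> \<rr> (lie R)" by (simp add: \<alpha>_def comp_def)
  show "tangent_map (mfd K) (\<lambda>k. k) \<one>\<^bsub>K\<^esub> (\<alpha> z) = tangent_map (mfd K) F \<one>\<^bsub>G\<^esub> (\<iota> (j z))" if "z \<in> \<rr>"
  proof -
    have "\<iota> (j z) \<in> lie G" using \<iota>(2) jm[OF that] by (auto simp: bij_betw_def)
    then obtain c where c: "smooth_at euclid (mfd G) 0 c" "c 0 = \<one>\<^bsub>G\<^esub>" "\<iota> (j z) = velocity (mfd G) c"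
      by (auto simp: lie_iff[OF G])
    have F: "tangent_map (mfd R) F \<one>\<^bsub>G\<^esub> (velocity (mfd G) c) = velocity (mfd R) (\<lambda>t. F (c t))"
      unfolding mfdR by (rule tangent_map_velocity[OF M atlas_P, where c=c])
        (use smooth_at_F[OF one] c in simp_all)
    have "tangent_map (mfd K) (\<lambda>k. k) \<one>\<^bsub>K\<^esub> (velocity (mfd R) (\<lambda>t. F (c t))) =
        velocity (mfd K) (\<lambda>t. F (c t))"
      unfolding mfdR
      by (rule tangent_map_velocity[OF atlas_P lie_groupD(3)[OF KG]])
        (use c smooth_at_inclusion[OF oneP] in \<open>simp_all add: F1\<close>)
    moreover have "tangent_map (mfd K) F \<one>\<^bsub>G\<^esub> (velocity (mfd G) c) = velocity (mfd K) (\<lambda>t. F (c t))"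
      by (rule tangent_map_velocity[OF M lie_groupD(3)[OF KG], where c=c])
        (use smooth_F[OF one] c in simp_all)
    ultimately show ?thesis by (simp add: \<alpha>_def c(3) F)
  qed
qed

section \<open>Rota-Baxter Lie groups\<close>

locale rota_baxter_group =
  fixes G :: "('g, 'e::euclidean_space) lie_group_struct" (structure) and \<B> :: "'g \<Rightarrow> 'g"
  assumes rota_baxter: "rota_baxter_lie_group G \<B>"
begin

lemma LG: "lie_group G"
  using rota_baxter by (simp add: rota_baxter_lie_group_def)

sublocale group G by (rule lie_groupD(1)[OF LG])

lemmas AG = lie_groupD(3)[OF LG] and pG [simp] = lie_groupD(4)[OF LG]

lemma smooth_\<B>: "g \<in> carrier G \<Longrightarrow> smooth_at (mfd G) (mfd G) g \<B>"
  using rota_baxter smooth_map_iff_smooth_at[OF AG AG] by (simp add: rota_baxter_lie_group_def)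

lemma \<B>_closed [simp]: "g \<in> carrier G \<Longrightarrow> \<B> g \<in> carrier G"
  using smooth_at_points(2)[OF AG AG smooth_\<B>] by simp

lemma \<B>_mult:
  "g \<in> carrier G \<Longrightarrow> h \<in> carrier G \<Longrightarrow> \<B> (g \<otimes> \<B> g \<otimes> h \<otimes> inv (\<B> g)) = \<B> g \<otimes> \<B> h"
  using rota_baxter by (simp add: rota_baxter_lie_group_def)

lemma \<B>_one [simp]: "\<B> \<one> = \<one>"
proof -
  have "\<B> \<one> \<otimes> \<B> \<one> = \<B> \<one>" using \<B>_mult[of \<one> \<one>] by simp
  then show ?thesis by (metis \<B>_closed one_closed r_cancel_one)
qed

lemma cancel_left:
  "x \<in> carrier G \<Longrightarrow> y \<in> carrier G \<Longrightarrow> inv x \<otimes> (x \<otimes> y) = y"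
  "x \<in> carrier G \<Longrightarrow> y \<in> carrier G \<Longrightarrow> x \<otimes> (inv x \<otimes> y) = y"
  by (simp_all flip: m_assoc)

text \<open>The inverse of \<open>g\<close> for the group law \<open>g * h = g \<B>(g) h \<B>(g)\<^sup>-\<^sup>1\<close>, for which \<open>\<B>\<close> is a
  homomorphism.\<close>

definition rb_inv :: "'g \<Rightarrow> 'g" where "rb_inv g = inv (\<B> g) \<otimes> inv g \<otimes> \<B> g"

lemma rb_inv_closed [simp]: "g \<in> carrier G \<Longrightarrow> rb_inv g \<in> carrier G"
  by (simp add: rb_inv_def)

lemma \<B>_rb_inv:
  assumes g: "g \<in> carrier G" shows "\<B> (rb_inv g) = inv (\<B> g)"
proof -
  have "g \<otimes> \<B> g \<otimes> rb_inv g \<otimes> inv (\<B> g) = \<one>"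
    using g by (simp add: rb_inv_def m_assoc[symmetric]) (simp add: m_assoc)
  then have "\<B> g \<otimes> \<B> (rb_inv g) = \<one>" using \<B>_mult[of g "rb_inv g"] g by simp
  then show ?thesis using g by (metis \<B>_closed inv_equality inv_inv rb_inv_closed inv_closed)
qed

abbreviation "K \<equiv> lie_group_prod G G"
abbreviation "graph g \<equiv> (\<B> g, g \<otimes> \<B> g)"
abbreviation "graph_retract k \<equiv> snd k \<otimes> inv (fst k)"
abbreviation "diag g \<equiv> (g, g)"

text \<open>If \<open>(a, b) = (h \<B>(g), h g \<B>(g))\<close>, then \<open>b\<^sup>-\<^sup>1 a = \<B>(g)\<^sup>-\<^sup>1 g\<^sup>-\<^sup>1 \<B>(g) = rb_inv g\<close>, whose image
  under \<open>\<B>\<close> is \<open>\<B>(g)\<^sup>-\<^sup>1\<close>. Hence \<open>h = a \<B>(b\<^sup>-\<^sup>1 a)\<close>.\<close>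

definition diag_proj :: "'g \<times> 'g \<Rightarrow> 'g \<times> 'g" where
  "diag_proj k = diag (fst k \<otimes> \<B> (inv (snd k) \<otimes> fst k))"

lemma LK: "lie_group K" and AK: "atlas (manifold_prod (mfd G) (mfd G))"
  using lie_group_prod[OF LG LG] atlas_prod[OF AG AG] by auto

lemma inv_K [simp]: "x \<in> carrier G \<Longrightarrow> y \<in> carrier G \<Longrightarrow> inv\<^bsub>K\<^esub> (x, y) = (inv x, inv y)"
  by (rule inv_lie_group_prod) unfold_locales

text \<open>The Rota-Baxter identity says that the graph is closed under multiplication.\<close>

lemma graph_mult:
  assumes "g \<in> carrier G" "h \<in> carrier G"
  shows "graph g \<otimes>\<^bsub>K\<^esub> graph h = graph (g \<otimes> \<B> g \<otimes> h \<otimes> inv (\<B> g))"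
proof -
  have "g \<otimes> \<B> g \<otimes> h \<otimes> inv (\<B> g) \<otimes> (\<B> g \<otimes> \<B> h) = g \<otimes> \<B> g \<otimes> (h \<otimes> \<B> h)"
    using assms by (simp add: m_assoc cancel_left)
  then show ?thesis using assms by (simp add: \<B>_mult)
qed

lemma graph_inv:
  assumes "g \<in> carrier G" shows "inv\<^bsub>K\<^esub> (graph g) = graph (rb_inv g)"
proof -
  have "rb_inv g \<otimes> inv (\<B> g) = inv (\<B> g) \<otimes> inv g"
    using assms by (simp add: rb_inv_def m_assoc)
  then show ?thesis using assms by (simp add: \<B>_rb_inv inv_mult_group)
qed

lemma subgroup_graph: "subgroup (graph ` carrier G) K"
proof (rule group.subgroupI[OF lie_groupD(1)[OF LK]])
  show "inv\<^bsub>K\<^esub> a \<in> graph ` carrier G" if "a \<in> graph ` carrier G" for a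
    using that graph_inv by auto
  show "a \<otimes>\<^bsub>K\<^esub> b \<in> graph ` carrier G" if "a \<in> graph ` carrier G" "b \<in> graph ` carrier G" for a b
    using that graph_mult by (auto simp del: lie_group_prod_simps)
qed auto

lemma subgroup_diag: "subgroup (diag ` carrier G) K"
  by (rule group.subgroupI[OF lie_groupD(1)[OF LK]]) auto

lemma smooth_manifold_K: "smooth_manifold (manifold_prod (mfd G) (mfd G))"
  by (rule smooth_manifold_prod[OF lie_groupD(2)[OF LG] lie_groupD(2)[OF LG]])

lemma smooth_graph: "g \<in> carrier G \<Longrightarrow> smooth_at (mfd G) (manifold_prod (mfd G) (mfd G)) g graph"
  by (intro smooth_at_Pair AG smooth_at_mult LG smooth_\<B> smooth_at_ident) auto

lemma smooth_diag: "g \<in> carrier G \<Longrightarrow> smooth_at (mfd G) (manifold_prod (mfd G) (mfd G)) g diag"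
  by (intro smooth_at_Pair AG smooth_at_ident) auto

lemma smooth_components:
  assumes "k \<in> carrier G \<times> carrier G"
  shows "smooth_at (manifold_prod (mfd G) (mfd G)) (mfd G) k fst"
    "smooth_at (manifold_prod (mfd G) (mfd G)) (mfd G) k snd"
  using smooth_at_prod_fst[OF AG AG] smooth_at_prod_snd[OF AG AG] assms by auto

text \<open>Both subgroups are images of \<open>G\<close> under sections of smooth maps: \<open>g\<close> is recovered from
  \<open>(\<B>(g), g \<B>(g))\<close> as the quotient of the components.\<close>

sublocale graph: retract_embedding "mfd G" "mfd K" graph graph_retract
proof
  show "smooth_manifold (mfd G)" "smooth_manifold (mfd K)"
    using lie_groupD(2)[OF LG] smooth_manifold_K by auto
  show "smooth_at (mfd G) (mfd K) p graph" if "p \<in> points (mfd G)" for p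
    using smooth_graph that by simp
  show "smooth_at (mfd K) (mfd G) k graph_retract" if "k \<in> points (mfd K)" for k
    using that unfolding lie_group_prod_simps
    by (intro smooth_at_mult smooth_at_m_inv LG AK smooth_components) auto
  show "graph_retract (graph p) = p" if "p \<in> points (mfd G)" for p
    using that by (simp add: m_assoc)
qed

sublocale diag: retract_embedding "mfd G" "mfd K" diag fst
  by unfold_locales
    (use lie_groupD(2)[OF LG] smooth_manifold_K smooth_diag smooth_components in auto)

definition graph_group :: "('g \<times> 'g, 'e \<times> 'e) lie_group_struct" where
  "graph_group = embedded_group K (mfd G) graph graph_retract"

definition diag_group :: "('g \<times> 'g, 'e \<times> 'e) lie_group_struct" where
  "diag_group = embedded_group K (mfd G) diag fst"

lemma carrier_graph_group: "carrier graph_group = graph ` carrier G"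
  and carrier_diag_group: "carrier diag_group = diag ` carrier G"
  and mfd_graph_group: "mfd graph_group = image_manifold (mfd G) graph graph_retract"
  and mfd_diag_group: "mfd diag_group = image_manifold (mfd G) diag fst"
  by (simp_all add: graph_group_def diag_group_def)

lemma lie_subgroup_graph: "lie_subgroup graph_group K"
  unfolding graph_group_def
  by (rule lie_subgroup_embedded_group[OF LK graph.retract_embedding_axioms])
    (use subgroup_graph in simp)

lemma lie_subgroup_diag: "lie_subgroup diag_group K"
  unfolding diag_group_def
  by (rule lie_subgroup_embedded_group[OF LK diag.retract_embedding_axioms])
    (use subgroup_diag in simp)

text \<open>With \<open>k = b\<^sup>-\<^sup>1 a\<close>, dividing \<open>(a, b)\<close> by the diagonal element \<open>a \<B>(k)\<close> from the left leaves
  \<open>(\<B>(k)\<^sup>-\<^sup>1, \<B>(k)\<^sup>-\<^sup>1 k\<^sup>-\<^sup>1)\<close>, the point of the graph over \<open>rb_inv k\<close>.\<close>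

lemma diag_coproj:
  assumes "a \<in> carrier G" "b \<in> carrier G"
  shows "inv\<^bsub>K\<^esub> (diag_proj (a, b)) \<otimes>\<^bsub>K\<^esub> (a, b) = graph (rb_inv (inv b \<otimes> a))"
proof -
  define k where "k = inv b \<otimes> a"
  have k: "k \<in> carrier G" "inv k = inv a \<otimes> b" using assms by (simp_all add: k_def inv_mult_group)
  have "inv (a \<otimes> \<B> k) \<otimes> a = inv (\<B> k)" "inv (a \<otimes> \<B> k) \<otimes> b = inv (\<B> k) \<otimes> inv k"
    using assms k by (simp_all add: inv_mult_group m_assoc)
  moreover have "rb_inv k \<otimes> \<B> (rb_inv k) = inv (\<B> k) \<otimes> inv k"
    using k(1) by (simp add: \<B>_rb_inv) (simp add: rb_inv_def m_assoc)
  ultimately show ?thesis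
    using assms k(1) by (simp add: diag_proj_def \<B>_rb_inv flip: k_def)
qed

lemma diag_proj_mult:
  assumes "h \<in> carrier G" "g \<in> carrier G"
  shows "diag_proj (diag h \<otimes>\<^bsub>K\<^esub> graph g) = diag h"
proof -
  have "inv (h \<otimes> (g \<otimes> \<B> g)) \<otimes> (h \<otimes> \<B> g) = rb_inv g \<otimes> (inv h \<otimes> h) \<otimes> \<one>"
    using assms by (simp add: rb_inv_def inv_mult_group m_assoc)
      (simp add: m_assoc[symmetric])
  then have "inv (h \<otimes> (g \<otimes> \<B> g)) \<otimes> (h \<otimes> \<B> g) = rb_inv g"
    using assms by simp
  then show ?thesis
    using assms by (simp add: diag_proj_def \<B>_rb_inv m_assoc)
qed

lemma smooth_diag_proj:
  assumes "k \<in> carrier G \<times> carrier G"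
  shows "smooth_at (mfd K) (mfd diag_group) k diag_proj"
proof -
  have "smooth_at (mfd K) (mfd G) k (\<lambda>k. inv (snd k) \<otimes> fst k)"
    using assms unfolding lie_group_prod_simps
    by (intro smooth_at_mult smooth_at_m_inv LG AK smooth_components)
  then have "smooth_at (mfd K) (mfd G) k (\<lambda>k. \<B> (inv (snd k) \<otimes> fst k))"
    by (rule smooth_at_compose[OF graph.K AG AG]) (use assms in \<open>auto intro: smooth_\<B>\<close>)
  then have "smooth_at (mfd K) (mfd G) k (\<lambda>k. fst k \<otimes> \<B> (inv (snd k) \<otimes> fst k))"
    using assms unfolding lie_group_prod_simps
    by (intro smooth_at_mult LG AK smooth_components)
  then show ?thesis
    unfolding mfd_diag_group diag_proj_def
    by (rule smooth_at_compose[OF graph.K AG diag.atlas_P]) (use assms in \<open>auto intro!: diag.smooth_at_F\<close>)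
qed

lemma diag_proj_closed: "k \<in> carrier G \<times> carrier G \<Longrightarrow> diag_proj k \<in> carrier diag_group"
  by (auto simp: diag_proj_def carrier_diag_group)

lemma smooth_diag_coproj:
  assumes k: "k \<in> carrier G \<times> carrier G"
  shows "smooth_at (mfd K) (mfd graph_group) k (\<lambda>k. inv\<^bsub>K\<^esub> (diag_proj k) \<otimes>\<^bsub>K\<^esub> k)"
  unfolding mfd_graph_group
proof (rule graph.smooth_at_into_image[OF graph.K])
  have "smooth_at (mfd K) (mfd K) k diag_proj"
    using smooth_at_compose[OF graph.K _ graph.K smooth_diag_proj[OF k] lie_subgroupD(7)[OF lie_subgroup_diag]]
      lie_groupD(3)[OF lie_subgroupD(2)[OF lie_subgroup_diag]] diag_proj_closed[OF k] by blast
  then show "smooth_at (mfd K) (mfd K) k (\<lambda>k. inv\<^bsub>K\<^esub> (diag_proj k) \<otimes>\<^bsub>K\<^esub> k)"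
    by (intro smooth_at_mult LK graph.K smooth_at_m_inv smooth_at_ident) (use k in auto)
  show "inv\<^bsub>K\<^esub> (diag_proj x) \<otimes>\<^bsub>K\<^esub> x \<in> points graph.P" if x: "x \<in> points (mfd K)" for x
  proof -
    obtain a b where "x = (a, b)" "a \<in> carrier G" "b \<in> carrier G" using x by auto
    then show ?thesis
      using diag_coproj[of a b] by (simp add: graph.points_P del: lie_group_prod_simps)
  qed
qed

sublocale factorization: lie_group_factorization K graph_group diag_group diag_proj
proof (intro lie_group_factorization.intro group_factorization.intro
    lie_group_factorization_axioms.intro)
  show "group K" by (rule lie_groupD(1)[OF LK])
  show "subgroup (carrier graph_group) K" "subgroup (carrier diag_group) K"
    by (simp_all add: carrier_graph_group carrier_diag_group subgroup_graph subgroup_diag)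
  show "diag_proj k \<in> carrier diag_group" if "k \<in> carrier K" for k
    using that diag_proj_closed by simp
  show "inv\<^bsub>K\<^esub> (diag_proj k) \<otimes>\<^bsub>K\<^esub> k \<in> carrier graph_group" if k: "k \<in> carrier K" for k
  proof -
    obtain a b where "k = (a, b)" "a \<in> carrier G" "b \<in> carrier G" using k by auto
    then show ?thesis
      using diag_coproj[of a b] by (simp add: carrier_graph_group del: lie_group_prod_simps)
  qed
  show "diag_proj (q \<otimes>\<^bsub>K\<^esub> p) = q" if "q \<in> carrier diag_group" "p \<in> carrier graph_group" for q p
    using that diag_proj_mult
    by (auto simp: carrier_graph_group carrier_diag_group simp del: lie_group_prod_simps)
  show "lie_subgroup graph_group K" "lie_subgroup diag_group K"
    by (rule lie_subgroup_graph lie_subgroup_diag)+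
  show "smooth_at (mfd K) (mfd diag_group) k diag_proj" if "k \<in> carrier K" for k
    using smooth_diag_proj that by simp
  show "smooth_at (mfd K) (mfd graph_group) k (\<lambda>k. inv\<^bsub>K\<^esub> (diag_proj k) \<otimes>\<^bsub>K\<^esub> k)"
    if "k \<in> carrier K" for k
    using smooth_diag_coproj that by simp
qed

end

section \<open>Rota-Baxter Lie algebras\<close>

lemma lie_algebra_Times:
  fixes S :: "'a::real_vector set" and T :: "'b::real_vector set"
  assumes S: "lie_algebra S br" and T: "lie_algebra T br'"
  shows "lie_algebra (S \<times> T) (direct_sum_bracket br br')"
proof -
  have sp: "subspace S" "subspace T" using S T by (auto simp: lie_algebra_def)
  obtain X where X: "finite X" "span X = S" using S by (auto simp: lie_algebra_def)
  obtain Y where Y: "finite Y" "span Y = T" using T by (auto simp: lie_algebra_def)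
  let ?Z = "X \<times> {0} \<union> {0} \<times> Y"
  have "span ?Z = S \<times> T"
  proof
    have "?Z \<subseteq> S \<times> T"
      using X Y span_superset[of X] span_superset[of Y] sp by (auto simp: subspace_0)
    then show "span ?Z \<subseteq> S \<times> T" by (rule span_minimal[OF _ subspace_Times[OF sp]])
    show "S \<times> T \<subseteq> span ?Z"
    proof safe
      fix x y assume "x \<in> S" "y \<in> T"
      have lin: "linear (\<lambda>x :: 'a. (x, 0 :: 'b))" "linear (\<lambda>y :: 'b. (0 :: 'a, y))"
        by (auto intro!: linearI)
      have "(x, 0 :: 'b) \<in> (\<lambda>x. (x, 0 :: 'b)) ` span X" using X(2) \<open>x \<in> S\<close> by auto
      then have "(x, 0 :: 'b) \<in> span ((\<lambda>x. (x, 0 :: 'b)) ` X)" unfolding linear_span_image[OF lin(1)] .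
      then have 1: "(x, 0 :: 'b) \<in> span ?Z" by (rule subsetD[OF span_mono, rotated]) auto
      have "(0 :: 'a, y) \<in> (\<lambda>y. (0 :: 'a, y)) ` span Y" using Y(2) \<open>y \<in> T\<close> by auto
      then have "(0 :: 'a, y) \<in> span ((\<lambda>y. (0 :: 'a, y)) ` Y)" unfolding linear_span_image[OF lin(2)] .
      then have 2: "(0 :: 'a, y) \<in> span ?Z" by (rule subsetD[OF span_mono, rotated]) auto
      show "(x, y) \<in> span ?Z" using span_add[OF 1 2] by simp
    qed
  qed
  moreover have "finite ?Z" using X Y by simp
  ultimately have "\<exists>Z. finite Z \<and> span Z = S \<times> T" by blast
  then show ?thesis
    using S T subspace_Times[OF sp]
    by (auto simp: lie_algebra_def direct_sum_bracket_def linear_on_def zero_prod_def)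
qed

locale rota_baxter_algebra =
  fixes \<gg> :: "'a::real_vector set" and br :: "'a \<Rightarrow> 'a \<Rightarrow> 'a" and B :: "'a \<Rightarrow> 'a"
  assumes rota_baxter: "rota_baxter_lie_algebra \<gg> br B"
begin

lemma B: "x \<in> \<gg> \<Longrightarrow> B x \<in> \<gg>" "x \<in> \<gg> \<Longrightarrow> y \<in> \<gg> \<Longrightarrow> B (x + y) = B x + B y"
  "x \<in> \<gg> \<Longrightarrow> B (c *\<^sub>R x) = c *\<^sub>R B x"
  "x \<in> \<gg> \<Longrightarrow> y \<in> \<gg> \<Longrightarrow> br (B x) (B y) = B (br (B x) y + br x (B y) + br x y)"
  using rota_baxter unfolding rota_baxter_lie_algebra_def linear_on_def by blast+

lemma lie_algebra_\<gg>: "lie_algebra \<gg> br"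
  using rota_baxter by (simp add: rota_baxter_lie_algebra_def)

lemma subspace_\<gg>: "subspace \<gg>"
  using lie_algebra_\<gg> by (simp add: lie_algebra_def)

lemma br: "x \<in> \<gg> \<Longrightarrow> y \<in> \<gg> \<Longrightarrow> br x y \<in> \<gg>"
  "x \<in> \<gg> \<Longrightarrow> y \<in> \<gg> \<Longrightarrow> z \<in> \<gg> \<Longrightarrow> br x (y + z) = br x y + br x z"
  "x \<in> \<gg> \<Longrightarrow> y \<in> \<gg> \<Longrightarrow> z \<in> \<gg> \<Longrightarrow> br (x + y) z = br x z + br y z"
  using lie_algebra_\<gg> unfolding lie_algebra_def linear_on_def by blast+

lemmas closed = subspace_add[OF subspace_\<gg>] subspace_scale[OF subspace_\<gg>]
  subspace_diff[OF subspace_\<gg>] subspace_0[OF subspace_\<gg>] B(1) br(1)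

lemma B_0: "B 0 = 0"
  using B(3)[OF subspace_0[OF subspace_\<gg>], of 0] by simp

abbreviation "brk \<equiv> direct_sum_bracket br br"
abbreviation "gB \<equiv> rb_graph_algebra \<gg> B"
abbreviation "gdiag \<equiv> diagonal \<gg>"

lemma graph_subalgebra: "lie_subalgebra gB (\<gg> \<times> \<gg>) brk"
  unfolding lie_subalgebra_def
proof (intro conjI ballI)
  show "lie_algebra (\<gg> \<times> \<gg>) brk" by (rule lie_algebra_Times[OF lie_algebra_\<gg> lie_algebra_\<gg>])
  show "gB \<subseteq> \<gg> \<times> \<gg>" by (auto simp: rb_graph_algebra_def intro: closed)
  show "subspace gB"
    unfolding subspace_def
  proof (intro conjI ballI allI)
    show "0 \<in> gB" using B_0 closed(4) by (auto simp: rb_graph_algebra_def zero_prod_def)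
    fix u assume "u \<in> gB"
    then obtain x where x: "x \<in> \<gg>" "u = (B x, x + B x)" by (auto simp: rb_graph_algebra_def)
    have "c *\<^sub>R u = (B (c *\<^sub>R x), c *\<^sub>R x + B (c *\<^sub>R x))" for c
      using x by (simp add: B scaleR_add_right)
    then show "c *\<^sub>R u \<in> gB" for c using closed(2)[OF x(1)] by (auto simp: rb_graph_algebra_def)
    fix v assume "v \<in> gB"
    then obtain y where y: "y \<in> \<gg>" "v = (B y, y + B y)" by (auto simp: rb_graph_algebra_def)
    have "u + v = (B (x + y), (x + y) + B (x + y))" using x y by (simp add: B)
    then show "u + v \<in> gB" using closed(1)[OF x(1) y(1)] unfolding rb_graph_algebra_def by blast
  qed
next
  fix u v assume "u \<in> gB" "v \<in> gB"
  then obtain x y where x: "x \<in> \<gg>" "u = (B x, x + B x)" and y: "y \<in> \<gg>" "v = (B y, y + B y)"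
    by (auto simp: rb_graph_algebra_def)
  let ?w = "br (B x) y + br x (B y) + br x y"
  have "br (x + B x) (y + B y) = ?w + B ?w"
    using x y B(4)[OF x(1) y(1)] by (simp add: br closed)
  then have "brk u v = (B ?w, ?w + B ?w)"
    using B(4)[OF x(1) y(1)] by (simp add: x(2) y(2) direct_sum_bracket_def)
  moreover have "?w \<in> \<gg>" using x y by (intro closed)
  ultimately show "brk u v \<in> gB" unfolding rb_graph_algebra_def by blast
qed

lemma diag_subalgebra: "lie_subalgebra gdiag (\<gg> \<times> \<gg>) brk"
  unfolding lie_subalgebra_def
proof (intro conjI ballI)
  show "lie_algebra (\<gg> \<times> \<gg>) brk" by (rule lie_algebra_Times[OF lie_algebra_\<gg> lie_algebra_\<gg>])
  show "subspace gdiag"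
    unfolding subspace_def using closed(1,2,4) by (auto simp: diagonal_def zero_prod_def)
qed (auto simp: diagonal_def direct_sum_bracket_def intro: closed)

text \<open>The infinitesimal form of the factorization: \<open>(a, b)\<close> has the component \<open>(B x, x + B x)\<close> with
  \<open>x = b - a\<close>.\<close>

lemma complementary: "complementary_subspaces (\<gg> \<times> \<gg>) gB gdiag"
  unfolding complementary_subspaces_def
proof (intro conjI)
  show "subspace gB" "subspace gdiag"
    using graph_subalgebra diag_subalgebra by (auto simp: lie_subalgebra_def)
  show "\<gg> \<times> \<gg> = {x + y |x y. x \<in> gB \<and> y \<in> gdiag}"
  proof safe
    fix a b assume ab: "a \<in> \<gg>" "b \<in> \<gg>"
    let ?x = "b - a"
    have "(a, b) = (B ?x, ?x + B ?x) + (a - B ?x, a - B ?x)" by simp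
    moreover have "(B ?x, ?x + B ?x) \<in> gB" "(a - B ?x, a - B ?x) \<in> gdiag"
      using ab closed by (auto simp: rb_graph_algebra_def diagonal_def)
    ultimately show "\<exists>x y. (a, b) = x + y \<and> x \<in> gB \<and> y \<in> gdiag" by blast
  qed (auto simp: rb_graph_algebra_def diagonal_def intro: closed)
  show "gB \<inter> gdiag = {0}"
    using B_0 closed(4) by (auto simp: rb_graph_algebra_def diagonal_def zero_prod_def)
qed

sublocale splitting: lie_splitting "\<gg> \<times> \<gg>" gB gdiag brk
  by unfold_locales (rule graph_subalgebra diag_subalgebra complementary)+

lemma graph_coordinate: "bij_betw (\<lambda>z. snd z - fst z) gB \<gg>" "linear_on gB (\<lambda>z. snd z - fst z)"
  and diag_coordinate: "bij_betw fst gdiag \<gg>" "linear_on gdiag fst"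
proof -
  show "bij_betw (\<lambda>z. snd z - fst z) gB \<gg>"
    by (rule bij_betw_byWitness[of _ "\<lambda>x. (B x, x + B x)"]) (auto simp: rb_graph_algebra_def)
  show "bij_betw fst gdiag \<gg>"
    by (rule bij_betw_byWitness[of _ "\<lambda>x. (x, x)"]) (auto simp: diagonal_def)
qed (auto simp: linear_on_def scaleR_diff_right)

end

locale rota_baxter_integration =
  rota_baxter_algebra \<gg> br B + rota_baxter_group G \<B>
  for \<gg> :: "'a::real_vector set" and br B and G :: "('g, 'e::euclidean_space) lie_group_struct" and \<B> +
  fixes \<iota> :: "'a \<Rightarrow> 'g tangent"
  assumes \<iota>_iso: "lie_algebra_iso \<gg> br (lie G) (lie_bracket G) \<iota>"
    and tangent_\<B>: "x \<in> \<gg> \<Longrightarrow> tangent_map (mfd G) \<B> \<one>\<^bsub>G\<^esub> (\<iota> x) = \<iota> (B x)"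
begin

lemma \<iota>: "linear_on \<gg> \<iota>" "bij_betw \<iota> \<gg> (lie G)" "x \<in> \<gg> \<Longrightarrow> \<iota> x \<in> lie G"
  "x \<in> \<gg> \<Longrightarrow> y \<in> \<gg> \<Longrightarrow> \<iota> (br x y) = lie_bracket G (\<iota> x) (\<iota> y)"
  "x \<in> \<gg> \<Longrightarrow> y \<in> \<gg> \<Longrightarrow> \<iota> (x + y) = \<iota> x + \<iota> y" "x \<in> \<gg> \<Longrightarrow> \<iota> (a *\<^sub>R x) = a *\<^sub>R \<iota> x"
  using \<iota>_iso by (auto simp: lie_algebra_iso_def bij_betw_def linear_on_def)

definition \<Lambda> :: "'a \<times> 'a \<Rightarrow> ('g \<times> 'g) tangent" where
  "\<Lambda> z = lie_prod_pair G G (map_prod \<iota> \<iota> z)"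

lemma \<Lambda>_linear: "linear_on (\<gg> \<times> \<gg>) \<Lambda>"
  by (auto simp: linear_on_def \<Lambda>_def \<iota>(5,6) lie_prod_pair_add lie_prod_pair_scaleR)

lemma \<Lambda>_bracket:
  assumes "x \<in> \<gg> \<times> \<gg>" "y \<in> \<gg> \<times> \<gg>"
  shows "lie_bracket K (\<Lambda> x) (\<Lambda> y) = \<Lambda> (brk x y)"
  using assms
  by (auto simp: \<Lambda>_def direct_sum_bracket_def \<iota>(4) lie_bracket_lie_prod_pair[OF LG LG] \<iota>(3))

definition \<alpha> :: "'a \<times> 'a \<Rightarrow> ('g \<times> 'g) tangent" where
  "\<alpha> z = tangent_map (mfd graph_group) graph \<one>\<^bsub>G\<^esub> (\<iota> (snd z - fst z))"

definition \<beta> :: "'a \<times> 'a \<Rightarrow> ('g \<times> 'g) tangent" where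
  "\<beta> z = tangent_map (mfd diag_group) diag \<one>\<^bsub>G\<^esub> (\<iota> (fst z))"

lemma \<alpha>_linear: "linear_on gB \<alpha>" and \<alpha>_bij: "bij_betw \<alpha> gB (lie graph_group)"
  and \<alpha>_incl_graph: "z \<in> gB \<Longrightarrow> tangent_map (mfd K) (\<lambda>k. k) \<one>\<^bsub>K\<^esub> (\<alpha> z) =
    tangent_map (mfd K) graph \<one>\<^bsub>G\<^esub> (\<iota> (snd z - fst z))"
proof -
  have 1: "graph \<one>\<^bsub>G\<^esub> = \<one>\<^bsub>K\<^esub>" by simp
  note E = embedded_group_lie_algebra[OF LG LK graph.retract_embedding_axioms 1 \<iota>(1,2)
      graph_coordinate(2,1), folded graph_group_def]
  show "linear_on gB \<alpha>" "bij_betw \<alpha> gB (lie graph_group)"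
    using E(1,2) unfolding \<alpha>_def[abs_def] by auto
  show "tangent_map (mfd K) (\<lambda>k. k) \<one>\<^bsub>K\<^esub> (\<alpha> z) =
      tangent_map (mfd K) graph \<one>\<^bsub>G\<^esub> (\<iota> (snd z - fst z))" if "z \<in> gB"
    using E(3)[OF that] unfolding \<alpha>_def .
qed

lemma \<beta>_linear: "linear_on gdiag \<beta>" and \<beta>_bij: "bij_betw \<beta> gdiag (lie diag_group)"
  and \<beta>_incl_diag: "z \<in> gdiag \<Longrightarrow> tangent_map (mfd K) (\<lambda>k. k) \<one>\<^bsub>K\<^esub> (\<beta> z) =
    tangent_map (mfd K) diag \<one>\<^bsub>G\<^esub> (\<iota> (fst z))"
proof -
  have 1: "diag \<one>\<^bsub>G\<^esub> = \<one>\<^bsub>K\<^esub>" by simp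
  note E = embedded_group_lie_algebra[OF LG LK diag.retract_embedding_axioms 1 \<iota>(1,2)
      diag_coordinate(2,1), folded diag_group_def]
  show "linear_on gdiag \<beta>" "bij_betw \<beta> gdiag (lie diag_group)"
    using E(1,2) unfolding \<beta>_def[abs_def] by auto
  show "tangent_map (mfd K) (\<lambda>k. k) \<one>\<^bsub>K\<^esub> (\<beta> z) = tangent_map (mfd K) diag \<one>\<^bsub>G\<^esub> (\<iota> (fst z))"
    if "z \<in> gdiag"
    using E(3)[OF that] unfolding \<beta>_def .
qed

text \<open>A curve with velocity \<open>x\<close> is mapped to \<open>(\<B>(c), c \<B>(c))\<close>, with velocity \<open>(B x, x + B x)\<close>.\<close>

lemma tangent_graph:
  assumes x: "x \<in> \<gg>"
  shows "tangent_map (mfd K) graph \<one>\<^bsub>G\<^esub> (\<iota> x) = \<Lambda> (B x, x + B x)"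
proof -
  obtain c where c: "smooth_at euclid (mfd G) 0 c" "c 0 = \<one>\<^bsub>G\<^esub>" "\<iota> x = velocity (mfd G) c"
    using \<iota>(3)[OF x] by (auto simp: lie_iff[OF LG])
  have Bc: "smooth_at euclid (mfd G) 0 (\<lambda>t. \<B> (c t))"
    using smooth_at_compose[OF atlas_euclid AG AG c(1)] smooth_\<B> c(2) by simp
  have m: "smooth_at euclid (mfd G) 0 (\<lambda>t. c t \<otimes>\<^bsub>G\<^esub> \<B> (c t))"
    by (rule smooth_at_mult[OF LG atlas_euclid c(1) Bc])
  have \<iota>B: "\<iota> (B x) = velocity (mfd G) (\<lambda>t. \<B> (c t))"
    using tangent_\<B>[OF x] tangent_map_velocity[OF AG AG, of c \<B> "\<one>\<^bsub>G\<^esub>"] smooth_\<B> c by simp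
  have "\<iota> (x + B x) = velocity (mfd G) (\<lambda>t. c t \<otimes>\<^bsub>G\<^esub> \<B> (c t))"
    using velocity_mult[OF LG c(1,2) Bc] c(2,3) \<iota>(5)[OF x B(1)[OF x]] \<iota>B by simp
  then have "\<Lambda> (B x, x + B x) = velocity (mfd K) (\<lambda>t. graph (c t))"
    using lie_prod_pair_velocity[OF LG LG Bc _ m] c(2) \<iota>B by (simp add: \<Lambda>_def)
  moreover have "tangent_map (mfd K) graph \<one>\<^bsub>G\<^esub> (\<iota> x) = velocity (mfd K) (\<lambda>t. graph (c t))"
    unfolding c(3) by (rule tangent_map_velocity[OF AG graph.K, where c=c])
      (use smooth_graph c(2) in simp_all)
  ultimately show ?thesis by simp
qed

lemma tangent_diag:
  assumes x: "x \<in> \<gg>"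
  shows "tangent_map (mfd K) diag \<one>\<^bsub>G\<^esub> (\<iota> x) = \<Lambda> (x, x)"
proof -
  obtain c where c: "smooth_at euclid (mfd G) 0 c" "c 0 = \<one>\<^bsub>G\<^esub>" "\<iota> x = velocity (mfd G) c"
    using \<iota>(3)[OF x] by (auto simp: lie_iff[OF LG])
  have "tangent_map (mfd K) diag \<one>\<^bsub>G\<^esub> (\<iota> x) = velocity (mfd K) (\<lambda>t. diag (c t))"
    unfolding c(3) by (rule tangent_map_velocity[OF AG graph.K, where c=c])
      (use smooth_diag c(2) in simp_all)
  then show ?thesis
    using lie_prod_pair_velocity[OF LG LG c(1,2) c(1,2)] c(3) by (simp add: \<Lambda>_def)
qed

sublocale differentiated: differentiated_factorization K graph_group diag_group diag_proj
  "\<gg> \<times> \<gg>" gB gdiag brk \<Lambda> \<alpha> \<beta>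
proof
  show "tangent_map (mfd K) (\<lambda>k. k) \<one>\<^bsub>K\<^esub> (\<alpha> z) = \<Lambda> z" if z: "z \<in> gB" for z
  proof -
    obtain x where "x \<in> \<gg>" "z = (B x, x + B x)" using z unfolding rb_graph_algebra_def by blast
    then show ?thesis using \<alpha>_incl_graph[OF z] tangent_graph[of x] by simp
  qed
  show "tangent_map (mfd K) (\<lambda>k. k) \<one>\<^bsub>K\<^esub> (\<beta> z) = \<Lambda> z" if "z \<in> gdiag" for z
    using \<beta>_incl_diag[OF that] tangent_diag that by (auto simp: diagonal_def)
qed (simp_all add: \<Lambda>_linear \<Lambda>_bracket \<alpha>_linear \<alpha>_bij \<beta>_linear \<beta>_bij)

end

theorem theorem6p7:
  fixes \<gg> :: "'a::real_vector set" and br :: "'a \<Rightarrow> 'a \<Rightarrow> 'a" and B :: "'a \<Rightarrow> 'a"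
    and G :: "('g, 'e::euclidean_space) lie_group_struct" and \<B> :: "'g \<Rightarrow> 'g"
    and \<iota> :: "'a \<Rightarrow> 'g tangent"
  assumes "rota_baxter_lie_algebra \<gg> br B"
    and "integrated_rota_baxter \<gg> br B G \<B> \<iota>"
  shows
    "let K = lie_group_prod G G; GB = rb_graph_group G \<B>; Gdiag = diagonal (carrier G);
         lact = factor_lact K GB Gdiag; ract = factor_ract K GB Gdiag;
         brk = direct_sum_bracket br br; gB = rb_graph_algebra \<gg> B; gdiag = diagonal \<gg>;
         \<rho> = splitting_rho gB gdiag brk; \<mu> = splitting_mu gB gdiag brk
     in
       \<exists>P Q.
         carrier P = GB \<and> carrier Q = Gdiag \<and> lie_subgroup P K \<and> lie_subgroup Q K \<and>
         diffeomorphism (manifold_prod (mfd P) (mfd Q)) (mfd K) (\<lambda>(p, q). p \<otimes>\<^bsub>K\<^esub> q) \<and>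
         (\<forall>p\<in>GB. \<forall>q\<in>Gdiag. lact p q \<in> Gdiag \<and> ract p q \<in> GB \<and>
            p \<otimes>\<^bsub>K\<^esub> q = lact p q \<otimes>\<^bsub>K\<^esub> ract p q) \<and>
         matched_pair_lie_groups P Q lact ract \<and>
         lie_subalgebra gB (\<gg> \<times> \<gg>) brk \<and> lie_subalgebra gdiag (\<gg> \<times> \<gg>) brk \<and>
         complementary_subspaces (\<gg> \<times> \<gg>) gB gdiag \<and>
         (\<forall>x\<in>gB. \<forall>\<xi>\<in>gdiag. brk x \<xi> = \<rho> x \<xi> - \<mu> \<xi> x) \<and>
         matched_pair_lie_algebras gB brk gdiag brk \<rho> \<mu> \<and>
         (\<exists>\<alpha> \<beta>.
            (\<forall>z\<in>gB. tangent_map (mfd K) (\<lambda>k. k) \<one>\<^bsub>K\<^esub> (\<alpha> z) = lie_prod_pair G G (map_prod \<iota> \<iota> z)) \<and>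
            (\<forall>z\<in>gdiag. tangent_map (mfd K) (\<lambda>k. k) \<one>\<^bsub>K\<^esub> (\<beta> z) = lie_prod_pair G G (map_prod \<iota> \<iota> z)) \<and>
            is_differentiation P Q lact ract gB brk gdiag brk \<rho> \<mu> \<alpha> \<beta>)"
proof -
  interpret rb: rota_baxter_integration \<gg> br B G \<B> \<iota>
    using assms by unfold_locales (auto simp: integrated_rota_baxter_def)
  have P: "carrier rb.graph_group = rb_graph_group G \<B>"
    by (auto simp: rb.carrier_graph_group rb_graph_group_def)
  have Q: "carrier rb.diag_group = diagonal (carrier G)"
    by (auto simp: rb.carrier_diag_group diagonal_def)
  note facts = rb.factorization.lact_closed rb.factorization.ract_closed
    rb.factorization.lact_ract rb.factorization.matched_pair_groups
    rb.differentiated.\<alpha>_incl rb.differentiated.\<beta>_incl rb.differentiated.differentiation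
  note facts = facts[unfolded P Q rb.\<Lambda>_def]
  have "\<forall>p\<in>rb_graph_group G \<B>. \<forall>q\<in>diagonal (carrier G).
      factor_lact rb.K (rb_graph_group G \<B>) (diagonal (carrier G)) p q \<in> diagonal (carrier G) \<and>
      factor_ract rb.K (rb_graph_group G \<B>) (diagonal (carrier G)) p q \<in> rb_graph_group G \<B> \<and>
      p \<otimes>\<^bsub>rb.K\<^esub> q = factor_lact rb.K (rb_graph_group G \<B>) (diagonal (carrier G)) p q \<otimes>\<^bsub>rb.K\<^esub>
        factor_ract rb.K (rb_graph_group G \<B>) (diagonal (carrier G)) p q"
    using facts(1-3) by blast
  moreover have "\<forall>x\<in>rb.gB. \<forall>\<xi>\<in>rb.gdiag. rb.brk x \<xi> = rb.splitting.\<rho> x \<xi> - rb.splitting.\<mu> \<xi> x"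
    using rb.splitting.\<rho>\<mu>(3) by blast
  moreover have "\<forall>z\<in>rb.gB. tangent_map (mfd rb.K) (\<lambda>k. k) \<one>\<^bsub>rb.K\<^esub> (rb.\<alpha> z) =
      lie_prod_pair G G (map_prod \<iota> \<iota> z)"
    using facts(5) by blast
  moreover have "\<forall>z\<in>rb.gdiag. tangent_map (mfd rb.K) (\<lambda>k. k) \<one>\<^bsub>rb.K\<^esub> (rb.\<beta> z) =
      lie_prod_pair G G (map_prod \<iota> \<iota> z)"
    using facts(6) by blast
  ultimately show ?thesis
    unfolding Let_def
    using P Q rb.lie_subgroup_graph rb.lie_subgroup_diag rb.factorization.diffeomorphism_mult
      rb.graph_subalgebra rb.diag_subalgebra rb.complementary rb.splitting.matched_pair_algebras
      facts(4,7)
    by - (rule exI[of _ rb.graph_group], rule exI[of _ rb.diag_group],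
      intro conjI; ((rule exI[of _ rb.\<alpha>], rule exI[of _ rb.\<beta>], intro conjI)?; assumption))
qed

end
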